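(* Let $(\mathcal{L},Q)$ and $(\mathcal{L}^{\diamond},Q^{\diamond})$ be $L_\infty$-algebras and let $F: C(\mathcal{L})\to C(\mathcal{L}^{\diamond})$ be an $L_\infty$-quasi-isomorphism from $\mathcal{L}$ to $\mathcal{L}^{\diamond}$ with structure maps $F_m:\wedge^m\mathcal{L}\to\mathcal{L}^{\diamond}$. Let $n\ge 1$ and let $\widetilde{H}:\wedge^{n}\mathcal{L}\to\mathcal{L}^{\diamond}$ be any linear map of degree $-n$. Then there exists an $L_\infty$-quasi-isomorphism $\widetilde{F}: C(\mathcal{L})\to C(\mathcal{L}^{\diamond})$ from $\mathcal{L}$ to $\mathcal{L}^{\diamond}$, with structure maps $\widetilde{F}_m$, such that $$\widetilde{F}_m=F_m:\wedge^m\mathcal{L}\to\mathcal{L}^{\diamond}\qquad\text{for all } m<n,$$ and, for all homogeneous $\gamma_i\in\mathcal{L}^{k_i}$, $i=1,\dots,n$, $$\widetilde{F}_n(\gamma_1,\dots,\gamma_n)=F_n(\gamma_1,\dots,\gamma_n)+Q^{\diamond}_1\widetilde{H}(\gamma_1,\dots,\gamma_n)-\sum_{i=1}^{n}(-1)^{n+k_1+\dots+k_{i-1}}\,\widetilde{H}(\gamma_1,\dots,\gamma_{i-1},Q_1(\gamma_i),\gamma_{i+1},\dots,\gamma_n).$$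
   Context: All vector spaces are $\mathbb{Z}$-graded over $\mathbb{R}$, with cohomological grading and the Koszul sign rule. $s^{\pm1}V$ denotes $V$ with degrees shifted by $\pm1$: $s^{-1}\gamma$ has degree $|\gamma|-1$. $L_\infty$-algebras. For a graded vector space $\mathcal{L}$ let $B(\mathcal{L})=\bigoplus_{m\ge1}\mathrm{Sym}^m(s^{-1}\mathcal{L})$ be the (non-counital) cofree conilpotent cocommutative coalgebra cogenerated by $s^{-1}\mathcal{L}$, with the (reduced) unshuffle coproduct. An $L_\infty$-algebra structure on $\mathcal{L}$ is a degree $1$ coderivation $Q$ of $B(\mathcal{L})$ with $Q^2=0$. $C(\mathcal{L})$ denotes the resulting DG coalgebra up to an overall suspension: $C(\mathcal{L})=s\,B(\mathcal{L})$, a coalgebra over the suspended cocommutative cooperad. Codifferentials and coalgebra morphisms for $C(\mathcal{L})$ are the same data as for $B(\mathcal{L})$. As a vector space $C(\mathcal{L})$ is identified with $\bigoplus_{m\ge1}\wedge^m\mathcal{L}$. $L_\infty$-morphisms. An $L_\infty$-morphism from $(\mathcal{L},Q)$ to $(\mathcal{L}^{\diamond},Q^{\diamond})$ is a morphism of DG coalgebras $F:C(\mathcal{L})\to C(\mathcal{L}^{\diamond})$, so that $Q^{\diamond}F=FQ$. Structure maps. Let $\mathrm{pr}$ be the projection of the coalgebra onto its cogenerators. The structure maps $Q_m:\wedge^m\mathcal{L}\to\mathcal{L}$ (degree $2-m$) are the components $\mathrm{pr}\circ Q|_{\wedge^m\mathcal{L}}$, and the structure maps $F_m:\wedge^m\mathcal{L}\to\mathcal{L}^{\diamond}$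 (degree $1-m$) are the components $\mathrm{pr}\circ F|_{\wedge^m\mathcal{L}}$. A linear map $\wedge^m\mathcal{L}\to V$ means a multilinear map $f$ with $f(\dots,\gamma,\gamma',\dots)=-(-1)^{|\gamma||\gamma'|}f(\dots,\gamma',\gamma,\dots)$. Explicitly, a map $g:\mathrm{Sym}^m(s^{-1}\mathcal{L})\to s^{-1}\mathcal{L}^{\diamond}$ corresponds to the graded skew-symmetric map $$(\gamma_1,\dots,\gamma_m)\mapsto(-1)^{\sum_i(m-i)(|\gamma_i|-1)}\,s\,g(s^{-1}\gamma_1\cdots s^{-1}\gamma_m).$$ Consequences. $Q_1$ is a differential of degree $1$ on $\mathcal{L}$, and $F_1$ is a morphism of complexes $(\mathcal{L},Q_1)\to(\mathcal{L}^{\diamond},Q_1^{\diamond})$. An $L_\infty$-morphism $F$ is an $L_\infty$-quasi-isomorphism if $F_1$ is a quasi-isomorphism of complexes. *)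

theory Defs
  imports Complex_Main "HOL-Library.Poly_Mapping"
begin

section \<open>Free vector spaces and linear extension\<close>

instantiation poly_mapping :: (type, real_vector) real_vector
begin

lift_definition scaleR_poly_mapping :: "real \<Rightarrow> ('a \<Rightarrow>\<^sub>0 'b) \<Rightarrow> ('a \<Rightarrow>\<^sub>0 'b)"
  is "\<lambda>c f x. c *\<^sub>R f x"
  by (erule finite_subset[rotated]) auto

instance
  by standard (transfer, simp add: fun_eq_iff algebra_simps)+

end

abbreviation gen :: "'x \<Rightarrow> ('x \<Rightarrow>\<^sub>0 real)" where
  "gen x \<equiv> Poly_Mapping.single x 1"

definition lin_ext :: "('x \<Rightarrow> 'w::real_vector) \<Rightarrow> ('x \<Rightarrow>\<^sub>0 real) \<Rightarrow> 'w" where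
  "lin_ext f p = (\<Sum>x\<in>Poly_Mapping.keys p. Poly_Mapping.lookup p x *\<^sub>R f x)"

lemma lookup_scaleR: "Poly_Mapping.lookup (c *\<^sub>R p) x = c *\<^sub>R Poly_Mapping.lookup p x"
  by transfer simp

lemma lin_ext_superset:
  assumes "finite A" "Poly_Mapping.keys p \<subseteq> A"
  shows "lin_ext f p = (\<Sum>x\<in>A. Poly_Mapping.lookup p x *\<^sub>R f x)"
  unfolding lin_ext_def
  by (rule sum.mono_neutral_left) (use assms in \<open>auto simp: in_keys_iff\<close>)

lemma linear_lin_ext: "linear (lin_ext f)"
proof (rule linearI)
  fix p q :: "'a \<Rightarrow>\<^sub>0 real"
  let ?A = "Poly_Mapping.keys p \<union> Poly_Mapping.keys q"
  have "Poly_Mapping.keys (p + q) \<subseteq> ?A" by (rule Poly_Mapping.keys_add)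
  then show "lin_ext f (p + q) = lin_ext f p + lin_ext f q"
    by (simp add: lin_ext_superset[of ?A] lookup_add scaleR_add_left sum.distrib)
next
  fix c :: real and p :: "'a \<Rightarrow>\<^sub>0 real"
  have "Poly_Mapping.keys (c *\<^sub>R p) \<subseteq> Poly_Mapping.keys p"
    by (auto simp: in_keys_iff lookup_scaleR)
  then show "lin_ext f (c *\<^sub>R p) = c *\<^sub>R lin_ext f p"
    by (simp add: lin_ext_superset[of "Poly_Mapping.keys p"] lookup_scaleR scaleR_sum_right)
qed

lemma lin_ext_gen [simp]: "lin_ext f (gen x) = f x"
  by (simp add: lin_ext_def)

lemma poly_mapping_eq_sum_gen:
  fixes p :: "'x \<Rightarrow>\<^sub>0 real"
  shows "p = (\<Sum>x\<in>Poly_Mapping.keys p. Poly_Mapping.lookup p x *\<^sub>R gen x)"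
proof (rule poly_mapping_eqI)
  fix y
  have "Poly_Mapping.lookup (\<Sum>x\<in>Poly_Mapping.keys p. Poly_Mapping.lookup p x *\<^sub>R gen x) y
      = (\<Sum>x\<in>Poly_Mapping.keys p. Poly_Mapping.lookup p x * (1 when x = y))"
    by (simp add: lookup_sum lookup_scaleR lookup_single)
  also have "\<dots> = (\<Sum>x\<in>Poly_Mapping.keys p. if x = y then Poly_Mapping.lookup p x else 0)"
    by (rule sum.cong) (auto simp: when_def)
  also have "\<dots> = Poly_Mapping.lookup p y"
    by (simp add: sum.delta in_keys_iff)
  finally show "Poly_Mapping.lookup p y = Poly_Mapping.lookup
      (\<Sum>x\<in>Poly_Mapping.keys p. Poly_Mapping.lookup p x *\<^sub>R gen x) y" by simp
qed

lemma lin_ext_vanishes: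
  assumes "\<And>r. r \<in> R \<Longrightarrow> lin_ext f r = 0" "p \<in> span R"
  shows "lin_ext f p = 0"
  using linear_eq_0_on_span[OF linear_lin_ext assms(1) assms(2)] .

lemma equivp_span: "equivp (\<lambda>p q :: 'a::real_vector. p - q \<in> span R)"
proof (rule equivpI)
  show "reflp (\<lambda>p q. p - q \<in> span R)" by (simp add: reflp_def span_zero)
  show "symp (\<lambda>p q. p - q \<in> span R)"
    by (rule sympI) (metis minus_diff_eq span_neg)
  show "transp (\<lambda>p q. p - q \<in> span R)"
  proof (rule transpI)
    fix x y z :: 'a assume "x - y \<in> span R" "y - z \<in> span R"
    from span_add[OF this] show "x - z \<in> span R" by simp
  qed
qed

lemma span_rel_cong:
  fixes p q p' q' :: "'a::real_vector"
  assumes "p - q \<in> span R"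
  shows "p' - q' \<in> span R \<Longrightarrow> (p + p') - (q + q') \<in> span R"
    and "p' - q' \<in> span R \<Longrightarrow> (p - p') - (q - q') \<in> span R"
    and "- p - (- q) \<in> span R"
    and "c *\<^sub>R p - c *\<^sub>R q \<in> span R"
proof -
  have "(p + p') - (q + q') = (p - q) + (p' - q')" "(p - p') - (q - q') = (p - q) - (p' - q')"
    "- p - (- q) = - (p - q)" "c *\<^sub>R p - c *\<^sub>R q = c *\<^sub>R (p - q)"
    by (simp_all add: algebra_simps)
  then show "p' - q' \<in> span R \<Longrightarrow> (p + p') - (q + q') \<in> span R"
    "p' - q' \<in> span R \<Longrightarrow> (p - p') - (q - q') \<in> span R"
    "- p - (- q) \<in> span R" "c *\<^sub>R p - c *\<^sub>R q \<in> span R"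
    using assms by (simp_all only: span_add span_diff span_neg span_scale)
qed

lemma span_rel_add: "a - b - c \<in> R \<Longrightarrow> a - (b + c) \<in> span R"
  by (simp add: diff_diff_eq span_base)


section \<open>Graded vector spaces\<close>

text \<open>A type of this class is the total space of a graded vector space, that is, the
  internal direct sum of its homogeneous parts.\<close>

class graded_real_vector = real_vector +
  fixes grade :: "int \<Rightarrow> 'a set"
  assumes grade_zero [simp]: "0 \<in> grade k"
    and grade_add: "x \<in> grade k \<Longrightarrow> y \<in> grade k \<Longrightarrow> x + y \<in> grade k"
    and grade_scaleR: "x \<in> grade k \<Longrightarrow> scaleR c x \<in> grade k"
    and grade_direct_sum:
      "\<exists>!c. (\<forall>k. c k \<in> grade k) \<and> finite {k. c k \<noteq> 0} \<and> x = (\<Sum>k | c k \<noteq> 0. c k)"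

definition hcomp :: "'v::graded_real_vector \<Rightarrow> int \<Rightarrow> 'v" where
  "hcomp x = (THE c. (\<forall>k. c k \<in> grade k) \<and> finite {k. c k \<noteq> 0} \<and> x = (\<Sum>k | c k \<noteq> 0. c k))"

definition hscale :: "(int \<Rightarrow> real) \<Rightarrow> 'v::graded_real_vector \<Rightarrow> 'v" where
  "hscale a x = (\<Sum>k | hcomp x k \<noteq> 0. a k *\<^sub>R hcomp x k)"

definition grade_involution :: "'v::graded_real_vector \<Rightarrow> 'v" where
  "grade_involution = hscale (\<lambda>k. (-1) powi k)"

definition has_degree :: "int \<Rightarrow> ('v::graded_real_vector \<Rightarrow> 'w::graded_real_vector) \<Rightarrow> bool" where
  "has_degree d f \<longleftrightarrow> (\<forall>k. \<forall>x\<in>grade k. f x \<in> grade (k + d))"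

definition homogeneous_list :: "int list \<Rightarrow> 'v::graded_real_vector list \<Rightarrow> bool" where
  "homogeneous_list ks vs \<longleftrightarrow> list_all2 (\<lambda>k v. v \<in> grade k) ks vs"

lemma subspace_grade: "subspace (grade k)"
  by (simp add: subspace_def grade_add grade_scaleR)

lemma hcomp_props:
  "hcomp x k \<in> grade k" "finite {k. hcomp x k \<noteq> 0}" "x = (\<Sum>k | hcomp x k \<noteq> 0. hcomp x k)"
  using theI'[OF grade_direct_sum[of x]] unfolding hcomp_def by blast+

lemma hcomp_unique:
  assumes "\<And>k. c k \<in> grade k" "finite A" "\<And>k. k \<notin> A \<Longrightarrow> c k = 0" "x = (\<Sum>k\<in>A. c k)"
  shows "hcomp x = c"
  unfolding hcomp_def
proof (rule the1_equality[OF grade_direct_sum], intro conjI allI)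
  show "c k \<in> grade k" for k by fact
  have sub: "{k. c k \<noteq> 0} \<subseteq> A" using assms(3) by blast
  then show "finite {k. c k \<noteq> 0}" using assms(2) by (rule finite_subset)
  show "x = (\<Sum>k | c k \<noteq> 0. c k)"
    unfolding assms(4) by (rule sum.mono_neutral_right) (use assms(2) sub in auto)
qed

lemma hcomp_superset:
  assumes "finite A" "{k. hcomp x k \<noteq> 0} \<subseteq> A"
  shows "x = (\<Sum>k\<in>A. hcomp x k)"
proof -
  have "(\<Sum>k\<in>A. hcomp x k) = (\<Sum>k | hcomp x k \<noteq> 0. hcomp x k)"
    by (rule sum.mono_neutral_right) (use assms in auto)
  with hcomp_props(3)[of x] show ?thesis by simp
qed

lemma hscale_superset:
  assumes "finite A" "{k. hcomp x k \<noteq> 0} \<subseteq> A"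
  shows "hscale a x = (\<Sum>k\<in>A. a k *\<^sub>R hcomp x k)"
  unfolding hscale_def by (rule sum.mono_neutral_left) (use assms in auto)

lemma hcomp_add: "hcomp (x + y) = (\<lambda>k. hcomp x k + hcomp y k)"
proof (rule hcomp_unique)
  let ?A = "{k. hcomp x k \<noteq> 0} \<union> {k. hcomp y k \<noteq> 0}"
  show "finite ?A" by (simp add: hcomp_props)
  then show "x + y = (\<Sum>k\<in>?A. hcomp x k + hcomp y k)"
    using hcomp_superset[of ?A x] hcomp_superset[of ?A y] by (simp add: sum.distrib)
qed (auto intro: grade_add hcomp_props)

lemma hcomp_scaleR: "hcomp (c *\<^sub>R x) = (\<lambda>k. c *\<^sub>R hcomp x k)"
proof (rule hcomp_unique)
  show "c *\<^sub>R x = (\<Sum>k | hcomp x k \<noteq> 0. c *\<^sub>R hcomp x k)"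
    using hcomp_props(3)[of x] by (metis scaleR_sum_right)
qed (auto intro: grade_scaleR hcomp_props)

lemma hcomp_homogeneous: "x \<in> grade k \<Longrightarrow> hcomp x = (\<lambda>l. if l = k then x else 0)"
  by (rule hcomp_unique[where A = "{k}"]) auto

lemma linear_hscale: "linear (hscale a)"
proof (rule linearI)
  fix x y :: 'a
  let ?A = "{k. hcomp x k \<noteq> 0} \<union> {k. hcomp y k \<noteq> 0}"
  have "finite ?A" by (simp add: hcomp_props)
  moreover have "{k. hcomp (x + y) k \<noteq> 0} \<subseteq> ?A" by (auto simp: hcomp_add)
  ultimately show "hscale a (x + y) = hscale a x + hscale a y"
    by (simp add: hscale_superset[of ?A] hcomp_add scaleR_add_right sum.distrib)
next
  fix c and x :: 'a
  let ?A = "{k. hcomp x k \<noteq> 0}"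
  have "finite ?A" by (simp add: hcomp_props)
  moreover have "{k. hcomp (c *\<^sub>R x) k \<noteq> 0} \<subseteq> ?A" by (auto simp: hcomp_scaleR)
  ultimately show "hscale a (c *\<^sub>R x) = c *\<^sub>R hscale a x"
    by (simp add: hscale_superset[of ?A] hcomp_scaleR scaleR_sum_right mult.commute)
qed

lemma hscale_homogeneous: "x \<in> grade k \<Longrightarrow> hscale a x = a k *\<^sub>R x"
  by (subst hscale_superset[where A = "{k}"]) (auto simp: hcomp_homogeneous split: if_splits)

lemma hscale_grade: "x \<in> grade k \<Longrightarrow> hscale a x \<in> grade k"
  by (simp add: hscale_homogeneous grade_scaleR)

lemma linear_grade_involution: "linear grade_involution"
  by (simp add: grade_involution_def linear_hscale)

lemma grade_involution_homogeneous:
  "x \<in> grade k \<Longrightarrow> grade_involution x = (-1) powi k *\<^sub>R x"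
  by (simp add: grade_involution_def hscale_homogeneous)


section \<open>Desuspension\<close>

text \<open>Here \<open>desusp\<close> is the map $s^{-1}$ and \<open>susp\<close> is its inverse $s$.\<close>

typedef 'a desusp = "UNIV :: 'a set" morphisms susp desusp ..

setup_lifting type_definition_desusp

instantiation desusp :: (real_vector) real_vector
begin

lift_definition zero_desusp :: "'a desusp" is 0 .
lift_definition plus_desusp :: "'a desusp \<Rightarrow> 'a desusp \<Rightarrow> 'a desusp" is "(+)" .
lift_definition minus_desusp :: "'a desusp \<Rightarrow> 'a desusp \<Rightarrow> 'a desusp" is "(-)" .
lift_definition uminus_desusp :: "'a desusp \<Rightarrow> 'a desusp" is uminus .
lift_definition scaleR_desusp :: "real \<Rightarrow> 'a desusp \<Rightarrow> 'a desusp" is "scaleR" .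

instance
  by standard (transfer, simp add: algebra_simps)+

end

lemma linear_susp: "linear susp"
  by (rule linearI) (transfer, simp)+

lemma linear_desusp: "linear desusp"
  by (rule linearI)
    (simp_all add: plus_desusp.abs_eq scaleR_desusp.abs_eq)

lemma susp_eq_0_iff: "susp x = 0 \<longleftrightarrow> x = 0"
  by transfer simp

instantiation desusp :: (graded_real_vector) graded_real_vector
begin

definition grade_desusp :: "int \<Rightarrow> 'a desusp set" where
  "grade_desusp k = {x. susp x \<in> grade (k + 1)}"

instance
proof
  fix k :: int and x y :: "'a desusp" and c :: real
  show "0 \<in> (grade k :: 'a desusp set)"
    by (simp add: grade_desusp_def zero_desusp.rep_eq)
  show "x \<in> grade k \<Longrightarrow> y \<in> grade k \<Longrightarrow> x + y \<in> grade k"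
    by (simp add: grade_desusp_def plus_desusp.rep_eq grade_add)
  show "x \<in> grade k \<Longrightarrow> c *\<^sub>R x \<in> grade k"
    by (simp add: grade_desusp_def scaleR_desusp.rep_eq grade_scaleR)
next
  fix x :: "'a desusp"
  let ?P = "\<lambda>c. (\<forall>k. c k \<in> grade k) \<and> finite {k. c k \<noteq> 0} \<and> x = (\<Sum>k | c k \<noteq> 0. c k)"
  have shift: "(\<Sum>k | h (k + 1) \<noteq> 0. h (k + 1)) = (\<Sum>k | h k \<noteq> 0. h k)"
    and finite_shift: "finite {k. h (k + 1) \<noteq> 0} \<longleftrightarrow> finite {k. h k \<noteq> 0}"
    for h :: "int \<Rightarrow> 'a"
  proof -
    have img: "{k. h k \<noteq> 0} = (\<lambda>k. k + 1) ` {k. h (k + 1) \<noteq> 0}"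
      by (auto simp: image_iff) (metis diff_add_cancel)
    show "(\<Sum>k | h (k + 1) \<noteq> 0. h (k + 1)) = (\<Sum>k | h k \<noteq> 0. h k)"
      unfolding img by (subst sum.reindex) (auto simp: inj_on_def)
    show "finite {k. h (k + 1) \<noteq> 0} \<longleftrightarrow> finite {k. h k \<noteq> 0}"
      unfolding img by (subst finite_image_iff) (auto simp: inj_on_def)
  qed
  let ?c = "\<lambda>k. desusp (hcomp (susp x) (k + 1))"
  have nz: "desusp y \<noteq> 0 \<longleftrightarrow> y \<noteq> 0" for y :: 'a
    by (metis UNIV_I desusp_inverse susp_eq_0_iff)
  have "?P ?c"
  proof (intro conjI allI)
    show "?c k \<in> grade k" for k
      by (simp add: grade_desusp_def desusp_inverse hcomp_props)
    show "finite {k. ?c k \<noteq> 0}"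
      unfolding nz finite_shift by (rule hcomp_props)
    have "(\<Sum>k | ?c k \<noteq> 0. ?c k) = desusp (\<Sum>k | hcomp (susp x) (k + 1) \<noteq> 0. hcomp (susp x) (k + 1))"
      unfolding nz by (rule linear_sum[OF linear_desusp, symmetric])
    also have "\<dots> = x"
      unfolding shift by (simp add: hcomp_props(3)[symmetric] susp_inverse)
    finally show "x = (\<Sum>k | ?c k \<noteq> 0. ?c k)" by simp
  qed
  moreover have "c = ?c" if c: "?P c" for c
  proof
    fix k
    let ?h = "\<lambda>k. susp (c (k - 1))"
    have "hcomp (susp x) = ?h"
    proof (rule hcomp_unique)
      show "?h k \<in> grade k" for k
        using c by (auto simp: grade_desusp_def dest!: spec[of _ "k - 1"])
      have fin: "finite {k. ?h k \<noteq> 0}"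
        using c finite_shift[of ?h] by (simp add: susp_eq_0_iff)
      then show "finite {k. ?h k \<noteq> 0}" .
      show "?h k = 0" if "k \<notin> {k. ?h k \<noteq> 0}" for k using that by simp
      have "susp x = (\<Sum>k | c k \<noteq> 0. susp (c k))"
        using c linear_sum[OF linear_susp, of c "{k. c k \<noteq> 0}"] by metis
      also have "\<dots> = (\<Sum>k | ?h k \<noteq> 0. ?h k)"
        using shift[of ?h] by (simp add: susp_eq_0_iff)
      finally show "susp x = (\<Sum>k | ?h k \<noteq> 0. ?h k)" .
    qed
    then show "c k = ?c k" by (simp add: susp_inverse)
  qed
  ultimately show "\<exists>!c. ?P c" by (rule ex1I)
qed

end

lemma desusp_grade: "desusp x \<in> grade k \<longleftrightarrow> x \<in> grade (k + 1)"
  by (simp add: grade_desusp_def desusp_inverse)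


section \<open>Tensor products\<close>

inductive_set tensor_rels :: "(('v::real_vector \<times> 'w::real_vector) \<Rightarrow>\<^sub>0 real) set" where
  "gen (x + x', y) - gen (x, y) - gen (x', y) \<in> tensor_rels"
| "gen (x, y + y') - gen (x, y) - gen (x, y') \<in> tensor_rels"
| "gen (c *\<^sub>R x, y) - c *\<^sub>R gen (x, y) \<in> tensor_rels"
| "gen (x, c *\<^sub>R y) - c *\<^sub>R gen (x, y) \<in> tensor_rels"

quotient_type (overloaded) ('v, 'w) tensor = "('v::real_vector \<times> 'w::real_vector) \<Rightarrow>\<^sub>0 real"
  / "\<lambda>p q. p - q \<in> span tensor_rels"
  by (rule equivp_span)

instantiation tensor :: (real_vector, real_vector) real_vector
begin

lift_definition zero_tensor :: "('a, 'b) tensor" is 0 .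
lift_definition plus_tensor :: "('a, 'b) tensor \<Rightarrow> ('a, 'b) tensor \<Rightarrow> ('a, 'b) tensor" is "(+)"
  by (rule span_rel_cong)
lift_definition minus_tensor :: "('a, 'b) tensor \<Rightarrow> ('a, 'b) tensor \<Rightarrow> ('a, 'b) tensor" is "(-)"
  by (rule span_rel_cong)
lift_definition uminus_tensor :: "('a, 'b) tensor \<Rightarrow> ('a, 'b) tensor" is uminus
  by (rule span_rel_cong)
lift_definition scaleR_tensor :: "real \<Rightarrow> ('a, 'b) tensor \<Rightarrow> ('a, 'b) tensor" is scaleR
  by (rule span_rel_cong)

instance
  by standard (transfer, simp add: algebra_simps span_zero)+

end

lift_definition tens :: "'v::real_vector \<Rightarrow> 'w::real_vector \<Rightarrow> ('v, 'w) tensor" (infixr "\<otimes>" 75)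
  is "\<lambda>x y. gen (x, y)" .

definition tensor_lift :: "('v::real_vector \<Rightarrow> 'w::real_vector \<Rightarrow> 'u::real_vector) \<Rightarrow> ('v, 'w) tensor \<Rightarrow> 'u"
  where "tensor_lift b t = lin_ext (\<lambda>(x, y). b x y) (rep_tensor t)"

definition tensor_map ::
    "('v::real_vector \<Rightarrow> 'x::real_vector) \<Rightarrow> ('w::real_vector \<Rightarrow> 'y::real_vector) \<Rightarrow>
     ('v, 'w) tensor \<Rightarrow> ('x, 'y) tensor" where
  "tensor_map f g = tensor_lift (\<lambda>x y. f x \<otimes> g y)"

lemma tens_add_left: "(x + x') \<otimes> y = x \<otimes> y + x' \<otimes> y"
  by transfer (rule span_rel_add[OF tensor_rels.intros(1)])

lemma tens_add_right: "x \<otimes> (y + y') = x \<otimes> y + x \<otimes> y'"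
  by transfer (rule span_rel_add[OF tensor_rels.intros(2)])

lemma tens_scaleR_left: "(c *\<^sub>R x) \<otimes> y = c *\<^sub>R (x \<otimes> y)"
  by transfer (rule span_base[OF tensor_rels.intros(3)])

lemma tens_scaleR_right: "x \<otimes> (c *\<^sub>R y) = c *\<^sub>R (x \<otimes> y)"
  by transfer (rule span_base[OF tensor_rels.intros(4)])

lemma tens_zero [simp]: "0 \<otimes> y = 0" "x \<otimes> 0 = 0"
  using tens_scaleR_left[of 0 0 y] tens_scaleR_right[of x 0 0] by simp_all

lemma tensor_lift:
  fixes b :: "'v::real_vector \<Rightarrow> 'w::real_vector \<Rightarrow> 'u::real_vector"
  assumes "\<And>y. linear (\<lambda>x. b x y)" "\<And>x. linear (b x)"
  shows "linear (tensor_lift b)" "tensor_lift b (x \<otimes> y) = b x y"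
proof -
  let ?f = "\<lambda>(x, y). b x y"
  have rel: "lin_ext ?f r = 0" if "r \<in> tensor_rels" for r
    using that
    by cases (simp_all add: linear_diff[OF linear_lin_ext] linear_scale[OF linear_lin_ext]
        linear_add[OF assms(1)] linear_add[OF assms(2)]
        linear_scale[OF assms(1)] linear_scale[OF assms(2)])
  have abs: "tensor_lift b (abs_tensor p) = lin_ext ?f p" for p
  proof -
    have "rep_tensor (abs_tensor p) - p \<in> span tensor_rels"
      using Quotient3_tensor rep_abs_rsp_left[OF Quotient3_tensor, of p p] by (simp add: span_zero)
    then have "lin_ext ?f (rep_tensor (abs_tensor p) - p) = 0"
      using lin_ext_vanishes rel by blast
    then show ?thesis by (simp add: tensor_lift_def linear_diff[OF linear_lin_ext])
  qed
  have ex: "\<exists>p. t = abs_tensor p" for t :: "('v, 'w) tensor"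
    using Quotient3_abs_rep[OF Quotient3_tensor, of t] by (intro exI) (rule sym)
  show "linear (tensor_lift b)"
  proof (rule linearI)
    fix s t :: "('v, 'w) tensor" and c :: real
    obtain p q where "s = abs_tensor p" "t = abs_tensor q" using ex[of s] ex[of t] by blast
    then show "tensor_lift b (s + t) = tensor_lift b s + tensor_lift b t"
      "tensor_lift b (c *\<^sub>R s) = c *\<^sub>R tensor_lift b s"
      by (simp_all add: plus_tensor.abs_eq scaleR_tensor.abs_eq abs
          linear_add[OF linear_lin_ext] linear_scale[OF linear_lin_ext])
  qed
  show "tensor_lift b (x \<otimes> y) = b x y"
    by (simp add: tens.abs_eq abs)
qed

lemma tensor_map:
  assumes "linear f" "linear g"
  shows "linear (tensor_map f g)" "tensor_map f g (x \<otimes> y) = f x \<otimes> g y"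
proof -
  have *: "linear (\<lambda>x. f x \<otimes> g y)" "linear (\<lambda>y. f x \<otimes> g y)" for x y
    by (auto intro!: linearI simp: linear_add[OF assms(1)] linear_add[OF assms(2)]
        linear_scale[OF assms(1)] linear_scale[OF assms(2)]
        tens_add_left tens_add_right tens_scaleR_left tens_scaleR_right)
  show "linear (tensor_map f g)" "tensor_map f g (x \<otimes> y) = f x \<otimes> g y"
    unfolding tensor_map_def using tensor_lift[of "\<lambda>x y. f x \<otimes> g y"] * by blast+
qed


section \<open>The reduced graded symmetric coalgebra\<close>

text \<open>The relation \<open>empty\<close> discards the summand $\mathrm{Sym}^0$.\<close>

inductive_set sym_rels :: "('v::graded_real_vector list \<Rightarrow>\<^sub>0 real) set" where
  empty: "gen [] \<in> sym_rels"
| add: "gen (us @ (x + y) # vs) - gen (us @ x # vs) - gen (us @ y # vs) \<in> sym_rels"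
| scaleR: "gen (us @ (c *\<^sub>R x) # vs) - c *\<^sub>R gen (us @ x # vs) \<in> sym_rels"
| swap: "x \<in> grade k \<Longrightarrow> y \<in> grade l \<Longrightarrow>
    gen (us @ x # y # vs) - (-1) powi (k * l) *\<^sub>R gen (us @ y # x # vs) \<in> sym_rels"

quotient_type (overloaded) 'v sym = "'v::graded_real_vector list \<Rightarrow>\<^sub>0 real"
  / "\<lambda>p q. p - q \<in> span sym_rels"
  by (rule equivp_span)

instantiation sym :: (graded_real_vector) real_vector
begin

lift_definition zero_sym :: "'a sym" is 0 .
lift_definition plus_sym :: "'a sym \<Rightarrow> 'a sym \<Rightarrow> 'a sym" is "(+)"
  by (rule span_rel_cong)
lift_definition minus_sym :: "'a sym \<Rightarrow> 'a sym \<Rightarrow> 'a sym" is "(-)"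
  by (rule span_rel_cong)
lift_definition uminus_sym :: "'a sym \<Rightarrow> 'a sym" is uminus
  by (rule span_rel_cong)
lift_definition scaleR_sym :: "real \<Rightarrow> 'a sym \<Rightarrow> 'a sym" is scaleR
  by (rule span_rel_cong)

instance
  by standard (transfer, simp add: algebra_simps span_zero)+

end

lift_definition word :: "'v::graded_real_vector list \<Rightarrow> 'v sym" is gen .

definition sym_lift :: "('v::graded_real_vector list \<Rightarrow> 'w::real_vector) \<Rightarrow> 'v sym \<Rightarrow> 'w" where
  "sym_lift f x = lin_ext f (rep_sym x)"

text \<open>Multilinear graded symmetric functions, in all lengths at once.\<close>

definition gsym :: "('v::graded_real_vector list \<Rightarrow> 'w::real_vector) \<Rightarrow> bool" where
  "gsym f \<longleftrightarrow>
    (\<forall>us vs. linear (\<lambda>x. f (us @ x # vs))) \<and>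
    (\<forall>us vs k l. \<forall>x\<in>grade k. \<forall>y\<in>grade l.
      f (us @ x # y # vs) = (-1) powi (k * l) *\<^sub>R f (us @ y # x # vs))"

lemma gsymI:
  assumes "\<And>us x y vs. f (us @ (x + y) # vs) = f (us @ x # vs) + f (us @ y # vs)"
    and "\<And>us c x vs. f (us @ (c *\<^sub>R x) # vs) = c *\<^sub>R f (us @ x # vs)"
    and "\<And>us x y vs k l. x \<in> grade k \<Longrightarrow> y \<in> grade l \<Longrightarrow>
      f (us @ x # y # vs) = (-1) powi (k * l) *\<^sub>R f (us @ y # x # vs)"
  shows "gsym f"
  unfolding gsym_def by (intro conjI allI ballI linearI; rule assms)

lemma gsymD:
  assumes "gsym f"
  shows "linear (\<lambda>x. f (us @ x # vs))"
    and "f (us @ (x + y) # vs) = f (us @ x # vs) + f (us @ y # vs)"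
    and "f (us @ (c *\<^sub>R x) # vs) = c *\<^sub>R f (us @ x # vs)"
    and "x \<in> grade k \<Longrightarrow> y \<in> grade l \<Longrightarrow>
      f (us @ x # y # vs) = (-1) powi (k * l) *\<^sub>R f (us @ y # x # vs)"
proof -
  show lin: "linear (\<lambda>x. f (us @ x # vs))" using assms unfolding gsym_def by blast
  show "f (us @ (x + y) # vs) = f (us @ x # vs) + f (us @ y # vs)"
    using linear_add[OF lin] .
  show "f (us @ (c *\<^sub>R x) # vs) = c *\<^sub>R f (us @ x # vs)"
    using linear_scale[OF lin] .
  show "x \<in> grade k \<Longrightarrow> y \<in> grade l \<Longrightarrow>
      f (us @ x # y # vs) = (-1) powi (k * l) *\<^sub>R f (us @ y # x # vs)"
    using assms unfolding gsym_def by blast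
qed

lemma word_Nil [simp]: "word [] = 0"
  by transfer (simp add: span_base sym_rels.empty)

lemma gsym_word: "gsym word"
proof (rule gsymI)
  fix us vs :: "'a list" and x y :: 'a and c :: real and k l
  show "word (us @ (x + y) # vs) = word (us @ x # vs) + word (us @ y # vs)"
    by transfer (rule span_rel_add[OF sym_rels.add])
  show "word (us @ (c *\<^sub>R x) # vs) = c *\<^sub>R word (us @ x # vs)"
    by transfer (rule span_base[OF sym_rels.scaleR])
  show "word (us @ x # y # vs) = (-1) powi (k * l) *\<^sub>R word (us @ y # x # vs)"
    if "x \<in> grade k" "y \<in> grade l"
    using that by transfer (rule span_base[OF sym_rels.swap])
qed

lemma ex_abs_sym: "\<exists>p. t = abs_sym p"
  using Quotient3_abs_rep[OF Quotient3_sym, of t] by (intro exI) (rule sym)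

lemma sym_lift:
  assumes "gsym f" "f [] = 0"
  shows "linear (sym_lift f)" "sym_lift f (word vs) = f vs"
proof -
  have rel: "lin_ext f r = 0" if "r \<in> sym_rels" for r
    using that
  proof cases
    case (swap x k y l us vs)
    then show ?thesis
      by (simp add: linear_diff[OF linear_lin_ext] linear_scale[OF linear_lin_ext]
          gsymD(4)[OF assms(1) swap(2,3)])
  qed (simp_all add: linear_diff[OF linear_lin_ext] linear_scale[OF linear_lin_ext]
        gsymD(2,3)[OF assms(1)] assms(2))
  have abs: "sym_lift f (abs_sym p) = lin_ext f p" for p
  proof -
    have "rep_sym (abs_sym p) - p \<in> span sym_rels"
      using rep_abs_rsp_left[OF Quotient3_sym, of p p] by (simp add: span_zero)
    then have "lin_ext f (rep_sym (abs_sym p) - p) = 0"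
      using lin_ext_vanishes rel by blast
    then show ?thesis by (simp add: sym_lift_def linear_diff[OF linear_lin_ext])
  qed
  show "linear (sym_lift f)"
  proof (rule linearI)
    fix s t :: "'a sym" and c :: real
    obtain p q where "s = abs_sym p" "t = abs_sym q" using ex_abs_sym[of s] ex_abs_sym[of t] by blast
    then show "sym_lift f (s + t) = sym_lift f s + sym_lift f t"
      "sym_lift f (c *\<^sub>R s) = c *\<^sub>R sym_lift f s"
      by (simp_all add: plus_sym.abs_eq scaleR_sym.abs_eq abs
          linear_add[OF linear_lin_ext] linear_scale[OF linear_lin_ext])
  qed
  show "sym_lift f (word vs) = f vs"
    by (simp add: word.abs_eq abs)
qed

lemma linear_abs_sym: "linear abs_sym"
  by (rule linearI) (simp_all add: plus_sym.abs_eq scaleR_sym.abs_eq)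

lemma span_word: "span (range word) = UNIV"
proof -
  have "t \<in> span (range word)" for t :: "'a sym"
  proof -
    obtain p where p: "t = abs_sym p" using ex_abs_sym by blast
    have "t = (\<Sum>x\<in>Poly_Mapping.keys p. Poly_Mapping.lookup p x *\<^sub>R word x)"
      unfolding p by (subst poly_mapping_eq_sum_gen[of p])
        (simp add: linear_sum[OF linear_abs_sym] linear_scale[OF linear_abs_sym] word.abs_eq)
    also have "\<dots> \<in> span (range word)"
      by (intro span_sum span_scale span_base) auto
    finally show ?thesis .
  qed
  then show ?thesis by blast
qed

definition hom_words :: "'v::graded_real_vector sym set" where
  "hom_words = {word vs | ks vs. homogeneous_list ks vs}"

lemma homogeneous_list_Nil [simp]: "homogeneous_list ks [] \<longleftrightarrow> ks = []"
  by (simp add: homogeneous_list_def)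

lemma homogeneous_list_Cons:
  "homogeneous_list ks (v # vs) \<longleftrightarrow> (\<exists>k ks'. ks = k # ks' \<and> v \<in> grade k \<and> homogeneous_list ks' vs)"
  by (auto simp: homogeneous_list_def list_all2_Cons2)

lemma homogeneous_list_append:
  "homogeneous_list ks us \<Longrightarrow> homogeneous_list ls vs \<Longrightarrow> homogeneous_list (ks @ ls) (us @ vs)"
  by (simp add: homogeneous_list_def list_all2_appendI)

lemma gsym_in_span:
  assumes f: "gsym f" and H: "\<And>ks vs. homogeneous_list ks vs \<Longrightarrow> f vs \<in> span H"
  shows "f vs \<in> span H"
proof -
  have "\<forall>ks us. homogeneous_list ks us \<longrightarrow> f (us @ vs) \<in> span H"
  proof (induction vs)
    case Nil
    then show ?case using H by auto
  next
    case (Cons v vs)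
    show ?case
    proof (intro allI impI)
      fix ks us assume us: "homogeneous_list ks (us :: 'a list)"
      have "f (us @ v # vs) = (\<Sum>k | hcomp v k \<noteq> 0. f (us @ hcomp v k # vs))"
        by (subst hcomp_props(3)[of v]) (simp add: linear_sum[OF gsymD(1)[OF f]])
      also have "\<dots> \<in> span H"
      proof (rule span_sum)
        fix k
        have "homogeneous_list (ks @ [k]) (us @ [hcomp v k])"
          by (rule homogeneous_list_append[OF us]) (simp add: homogeneous_list_Cons hcomp_props)
        with Cons.IH have "f ((us @ [hcomp v k]) @ vs) \<in> span H" by blast
        then show "f (us @ hcomp v k # vs) \<in> span H" by simp
      qed
      finally show "f (us @ v # vs) \<in> span H" .
    qed
  qed
  from this[rule_format, of "[]" "[]"] show ?thesis by simp
qed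

lemma span_hom_words: "span hom_words = UNIV"
proof -
  have "word vs \<in> span hom_words" for vs :: "'a list"
    by (rule gsym_in_span[OF gsym_word]) (auto simp: hom_words_def intro: span_base)
  then have "span (range word) \<subseteq> span (hom_words :: 'a sym set)"
    by (intro span_minimal) auto
  then show ?thesis using span_word by auto
qed

lemma linear_eq_on_hom_words:
  assumes "linear f" "linear g"
    and "\<And>ks vs. homogeneous_list ks vs \<Longrightarrow> f (word vs) = g (word vs)"
  shows "f = g"
proof
  fix x
  show "f x = g x"
    by (rule linear_eq_on[OF assms(1,2), of x hom_words])
      (use span_hom_words assms(3) in \<open>auto simp: hom_words_def\<close>)
qed

lemma gsym_map:
  fixes g :: "'a::graded_real_vector \<Rightarrow> 'b::graded_real_vector"
  assumes f: "gsym f" and g: "linear g" and deg: "\<And>k x. x \<in> grade k \<Longrightarrow> g x \<in> grade k"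
  shows "gsym (\<lambda>vs. f (map g vs))"
proof (rule gsymI)
  fix us vs :: "'a list" and x y :: 'a and c :: real and k l :: int
  show "f (map g (us @ (x + y) # vs)) = f (map g (us @ x # vs)) + f (map g (us @ y # vs))"
    by (simp add: linear_add[OF g] gsymD(2)[OF f])
  show "f (map g (us @ (c *\<^sub>R x) # vs)) = c *\<^sub>R f (map g (us @ x # vs))"
    by (simp add: linear_scale[OF g] gsymD(3)[OF f])
  show "f (map g (us @ x # y # vs)) = (-1) powi (k * l) *\<^sub>R f (map g (us @ y # x # vs))"
    if "x \<in> grade k" "y \<in> grade l"
    using gsymD(4)[OF f deg[OF that(1)] deg[OF that(2)], of "map g us" "map g vs"] by simp
qed

instantiation sym :: (graded_real_vector) graded_real_vector
begin

definition grade_sym :: "int \<Rightarrow> 'a sym set" where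
  "grade_sym k = span {word vs | ks vs. homogeneous_list ks vs \<and> sum_list ks = k}"

instance
proof
  fix k :: int and x y :: "'a sym" and c :: real
  show "0 \<in> (grade k :: 'a sym set)"
    by (simp add: grade_sym_def span_zero)
  show "x \<in> grade k \<Longrightarrow> y \<in> grade k \<Longrightarrow> x + y \<in> grade k"
    by (simp add: grade_sym_def span_add)
  show "x \<in> grade k \<Longrightarrow> c *\<^sub>R x \<in> grade k"
    by (simp add: grade_sym_def span_scale)
next
  fix x :: "'a sym"
  let ?P = "\<lambda>(x :: 'a sym) c. (\<forall>k. c k \<in> grade k) \<and> finite {k. c k \<noteq> 0} \<and> x = (\<Sum>k | c k \<noteq> 0. c k)"
  have sub: "subspace (grade k :: 'a sym set)" for k by (simp add: grade_sym_def)
  have PI: "?P x c" if "\<And>k. c k \<in> grade k" "finite A" "\<And>k. k \<notin> A \<Longrightarrow> c k = 0" "x = (\<Sum>k\<in>A. c k)"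
    for x :: "'a sym" and c A
  proof -
    have sub: "{k. c k \<noteq> 0} \<subseteq> A" using that(3) by blast
    then have 1: "finite {k. c k \<noteq> 0}" using that(2) by (rule finite_subset)
    have 2: "x = (\<Sum>k | c k \<noteq> 0. c k)"
      unfolding that(4) by (rule sum.mono_neutral_right) (use that(2) sub in auto)
    show ?thesis using that(1) 1 2 by blast
  qed
  have ex: "\<exists>c. ?P x c"
  proof -
    have "x \<in> span hom_words" by (simp add: span_hom_words)
    then show ?thesis
    proof (induction rule: span_induct_alt)
      case base
      show ?case by (rule exI[of _ "\<lambda>_. 0"]) (simp add: subspace_0[OF sub])
    next
      case (step a w y)
      obtain c where c: "?P y c" using step by blast
      obtain ks vs where w: "w = word vs" "homogeneous_list ks vs"
        using step by (auto simp: hom_words_def)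
      have "w \<in> grade (sum_list ks)"
        using w unfolding grade_sym_def by (blast intro: span_base)
      then have w': "a *\<^sub>R w \<in> grade (sum_list ks)" by (rule subspace_scale[OF sub])
      have 1: "(if k = sum_list ks then a *\<^sub>R w else 0) \<in> grade k" for k
        by (cases "k = sum_list ks") (simp_all only: if_True if_False w' subspace_0[OF sub] simp_thms)
      have "?P (a *\<^sub>R w + y) (\<lambda>k. (if k = sum_list ks then a *\<^sub>R w else 0) + c k)"
      proof (rule PI)
        let ?A = "insert (sum_list ks) {k. c k \<noteq> 0}"
        show "finite ?A" using c by simp
        have "(\<Sum>k\<in>?A. c k) = (\<Sum>k | c k \<noteq> 0. c k)"
          by (rule sum.mono_neutral_right) (use c in auto)
        with c show "a *\<^sub>R w + y = (\<Sum>k\<in>?A. (if k = sum_list ks then a *\<^sub>R w else 0) + c k)"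
          by (simp add: sum.distrib sum.delta)
        show "(if k = sum_list ks then a *\<^sub>R w else 0) + c k \<in> grade k" for k
          by (rule subspace_add[OF sub 1]) (use c in blast)
        show "(if k = sum_list ks then a *\<^sub>R w else 0) + c k = 0" if "k \<notin> ?A" for k
          using that by simp
      qed
      then show ?case
        by (rule exI[of _ "\<lambda>k. (if k = sum_list ks then a *\<^sub>R w else 0) + c k"])
    qed
  qed
  text \<open>Scaling degree \<open>k\<close> by \<open>2 ^ k\<close> makes the homogeneous parts eigenspaces with
    distinct eigenvalues.\<close>
  define g :: "'a \<Rightarrow> 'a" where "g = hscale (\<lambda>k. 2 powi k)"
  define G where "G = sym_lift (\<lambda>vs. word (map g vs))"
  have lg: "linear g" and dg: "v \<in> grade k \<Longrightarrow> g v \<in> grade k" for v k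
    by (auto simp: g_def linear_hscale hscale_grade)
  have lG: "linear G" and Gw: "G (word vs) = word (map g vs)" for vs
    unfolding G_def using sym_lift[OF gsym_map[OF gsym_word lg dg]] by auto
  have Ghom: "word (map g vs) = 2 powi (sum_list ks) *\<^sub>R word vs" if "homogeneous_list ks vs" for ks vs
  proof -
    have "homogeneous_list ks vs \<Longrightarrow> word (us @ map g vs) = 2 powi (sum_list ks) *\<^sub>R word (us @ vs)" for us
    proof (induction vs arbitrary: us ks)
      case (Cons v vs)
      then obtain k ks' where ks: "ks = k # ks'" "v \<in> grade k" "homogeneous_list ks' vs"
        by (auto simp: homogeneous_list_Cons)
      have "word (us @ map g (v # vs)) = word (us @ (2 powi k *\<^sub>R v) # map g vs)"
        using ks by (simp add: g_def hscale_homogeneous)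
      also have "\<dots> = 2 powi k *\<^sub>R word ((us @ [v]) @ map g vs)"
        by (simp add: gsymD(3)[OF gsym_word])
      also have "\<dots> = 2 powi k *\<^sub>R 2 powi (sum_list ks') *\<^sub>R word ((us @ [v]) @ vs)"
        using Cons.IH[OF ks(3), of "us @ [v]"] by simp
      finally show ?case by (simp add: ks power_int_add)
    qed simp
    from this[of "[]"] that show ?thesis by simp
  qed
  have Geig: "G y = 2 powi k *\<^sub>R y" if "y \<in> grade k" for y k
  proof (rule linear_eq_on[OF lG, of "\<lambda>y. 2 powi k *\<^sub>R y"])
    show "linear (\<lambda>y. 2 powi k *\<^sub>R y :: 'a sym)"
      by (rule linearI) (simp_all add: scaleR_add_right)
    show "y \<in> span {word vs | ks vs. homogeneous_list ks vs \<and> sum_list ks = k}"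
      using that by (simp add: grade_sym_def)
  qed (auto simp: Gw Ghom)
  have indep: "\<forall>k\<in>A. d k = 0"
    if "finite A" "\<And>k. d k \<in> grade k" "(\<Sum>k\<in>A. d k) = 0" for A and d :: "int \<Rightarrow> 'a sym"
    using that
  proof (induction A arbitrary: d rule: finite_induct)
    case (insert j A)
    have "(\<Sum>k\<in>insert j A. 2 powi k *\<^sub>R d k) = G (\<Sum>k\<in>insert j A. d k)"
      by (simp only: linear_sum[OF lG] Geig[OF insert.prems(1)])
    then have "(\<Sum>k\<in>insert j A. 2 powi k *\<^sub>R d k) - 2 powi j *\<^sub>R (\<Sum>k\<in>insert j A. d k) = 0"
      using insert.prems linear_0[OF lG] by simp
    then have sum0: "(\<Sum>k\<in>A. (2 powi k - 2 powi j) *\<^sub>R d k) = 0"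
      using insert.hyps
      by (simp add: scaleR_sum_right scaleR_add_right scaleR_left_diff_distrib sum_subtractf)
    have *: "\<forall>k\<in>A. (2 powi k - 2 powi j) *\<^sub>R d k = 0"
      by (rule insert.IH[of "\<lambda>k. (2 powi k - 2 powi j) *\<^sub>R d k", OF _ sum0])
        (rule subspace_scale[OF sub insert.prems(1)])
    have A: "d k = 0" if "k \<in> A" for k
    proof -
      have "k \<noteq> j" using that insert.hyps by blast
      then have "(2::real) powi k \<noteq> 2 powi j"
        using power_int_strict_increasing[of k j "2::real"] power_int_strict_increasing[of j k "2::real"]
        by linarith
      then show ?thesis using * that by auto
    qed
    moreover have "d j = 0" using insert.prems(2) insert.hyps A by simp
    ultimately show ?case by simp
  qed simp
  have uniq: "c = c'" if c: "?P x c" and c': "?P x c'" for c c'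
  proof
    fix k
    let ?A = "{k. c k \<noteq> 0} \<union> {k. c' k \<noteq> 0}"
    have fin: "finite ?A" using c c' by simp
    have "(\<Sum>k\<in>?A. c k) = (\<Sum>k | c k \<noteq> 0. c k)" "(\<Sum>k\<in>?A. c' k) = (\<Sum>k | c' k \<noteq> 0. c' k)"
      by (rule sum.mono_neutral_right; use fin in auto)+
    then have "(\<Sum>k\<in>?A. c k) = x" "(\<Sum>k\<in>?A. c' k) = x" using c c' by simp_all
    then have "(\<Sum>k\<in>?A. c k - c' k) = 0" by (simp add: sum_subtractf)
    moreover have "c k - c' k \<in> grade k" for k by (rule subspace_diff[OF sub]; use c c' in blast)
    ultimately have "\<forall>k\<in>?A. c k - c' k = 0" by (intro indep[OF fin])
    then have "k \<in> ?A \<Longrightarrow> c k - c' k = 0" by (rule bspec)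
    moreover have "k \<notin> ?A \<Longrightarrow> c k = 0 \<and> c' k = 0" by simp
    ultimately show "c k = c' k" by (metis eq_iff_diff_eq_0)
  qed
  show "\<exists>!c. ?P x c" by (rule ex_ex1I[OF ex]) (rule uniq)
qed

end

definition pr :: "'v::graded_real_vector sym \<Rightarrow> 'v" where
  "pr = sym_lift (\<lambda>vs. case vs of [v] \<Rightarrow> v | _ \<Rightarrow> 0)"

lemma gsym_pr: "gsym (\<lambda>vs :: 'v::graded_real_vector list. case vs of [v] \<Rightarrow> v | _ \<Rightarrow> 0)"
proof (rule gsymI)
  fix us vs :: "'v list"
  show "(case us @ (x + y) # vs of [v] \<Rightarrow> v | _ \<Rightarrow> 0)
      = (case us @ x # vs of [v] \<Rightarrow> v | _ \<Rightarrow> 0) + (case us @ y # vs of [v] \<Rightarrow> v | _ \<Rightarrow> 0)" for x y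
    by (cases us; cases vs; cases "tl us") auto
  show "(case us @ (c *\<^sub>R x) # vs of [v] \<Rightarrow> v | _ \<Rightarrow> 0)
      = c *\<^sub>R (case us @ x # vs of [v] \<Rightarrow> v | _ \<Rightarrow> 0)" for c x
    by (cases us; cases vs; cases "tl us") auto
  show "(case us @ x # y # vs of [v] \<Rightarrow> v | _ \<Rightarrow> 0)
      = (-1) powi (k * l) *\<^sub>R (case us @ y # x # vs of [v] \<Rightarrow> v | _ \<Rightarrow> 0)" for x y k l
    by (cases us; cases "tl us") auto
qed

lemma linear_pr: "linear pr"
  unfolding pr_def by (rule sym_lift[OF gsym_pr]) simp

lemma pr_word: "pr (word vs) = (case vs of [v] \<Rightarrow> v | _ \<Rightarrow> 0)"
  unfolding pr_def by (rule sym_lift[OF gsym_pr]) simp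


subsection \<open>The reduced coproduct\<close>

text \<open>A subset \<open>S\<close> of positions stands for the unshuffle that moves the letters in
  \<open>S\<close> to the front, keeping the order inside \<open>S\<close> and inside its complement.\<close>

definition unshuffle_sign :: "int list \<Rightarrow> nat set \<Rightarrow> real" where
  "unshuffle_sign ks S = (-1) powi (\<Sum>j\<in>S. \<Sum>i\<in>{..<j} - S. ks ! i * ks ! j)"

definition coproduct :: "'v::graded_real_vector sym \<Rightarrow> ('v sym, 'v sym) tensor" where
  "coproduct = (THE \<Delta>. linear \<Delta> \<and> (\<forall>ks vs. homogeneous_list ks vs \<longrightarrow>
     \<Delta> (word vs) = (\<Sum>S | S \<subset> {..<length vs} \<and> S \<noteq> {}.
        unshuffle_sign ks S *\<^sub>R (word (nths vs S) \<otimes> word (nths vs (- S))))))"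

text \<open>Existence is shown by splitting the first letter off. Crossing a letter of odd degree
  past a word applies the grade involution to all letters of that word.\<close>

definition even_part :: "'v::graded_real_vector \<Rightarrow> 'v" where
  "even_part = hscale (\<lambda>k. if even k then 1 else 0)"

definition odd_part :: "'v::graded_real_vector \<Rightarrow> 'v" where
  "odd_part = hscale (\<lambda>k. if even k then 0 else 1)"

definition put_left ::
    "'v \<Rightarrow> ('v list \<Rightarrow> 'v list \<Rightarrow> 'w) \<Rightarrow> ('v::graded_real_vector list \<Rightarrow> 'v list \<Rightarrow> 'w::real_vector)" where
  "put_left v g = (\<lambda>A B. g (v # A) B)"

definition put_right ::
    "'v \<Rightarrow> ('v list \<Rightarrow> 'v list \<Rightarrow> 'w) \<Rightarrow> ('v::graded_real_vector list \<Rightarrow> 'v list \<Rightarrow> 'w::real_vector)" where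
  "put_right v g = (\<lambda>A B. g A (even_part v # B) + g (map grade_involution A) (odd_part v # B))"

primrec unshuffles ::
    "'v::graded_real_vector list \<Rightarrow> ('v list \<Rightarrow> 'v list \<Rightarrow> 'w::real_vector) \<Rightarrow> 'w" where
  "unshuffles [] g = g [] []"
| "unshuffles (v # vs) g = unshuffles vs (put_left v g) + unshuffles vs (put_right v g)"

definition bigsym :: "('v::graded_real_vector list \<Rightarrow> 'v list \<Rightarrow> 'w::real_vector) \<Rightarrow> bool" where
  "bigsym g \<longleftrightarrow> (\<forall>A. gsym (g A)) \<and> (\<forall>B. gsym (\<lambda>A. g A B))"

lemma parts_homogeneous:
  assumes "x \<in> grade k"
  shows "even_part x = (if even k then x else 0)" "odd_part x = (if even k then 0 else x)"
  using assms by (simp_all add: even_part_def odd_part_def hscale_homogeneous)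

lemma linear_parts: "linear even_part" "linear odd_part"
  by (simp_all add: even_part_def odd_part_def linear_hscale)

lemma grade_parts:
  "x \<in> grade k \<Longrightarrow> even_part x \<in> grade k" "x \<in> grade k \<Longrightarrow> odd_part x \<in> grade k"
  by (simp_all add: even_part_def odd_part_def hscale_grade)

lemma grade_involution_grade: "x \<in> grade k \<Longrightarrow> grade_involution x \<in> grade k"
  by (simp add: grade_involution_def hscale_grade)

lemma sign_int: "(-1 :: real) powi k = (if even k then 1 else - 1)"
  by (cases "even k") (auto simp: power_int_minus_left)

lemma gsym_zero: "gsym f \<Longrightarrow> f (us @ 0 # vs) = 0"
  using linear_0[OF gsymD(1)] .

lemma gsym_Cons:
  assumes "gsym f"
  shows "gsym (\<lambda>vs. f (v # vs))"
proof (rule gsymI)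
  fix us vs and x y and c :: real and k l :: int
  show "f (v # us @ (x + y) # vs) = f (v # us @ x # vs) + f (v # us @ y # vs)"
    using gsymD(2)[OF assms, of "v # us"] by simp
  show "f (v # us @ (c *\<^sub>R x) # vs) = c *\<^sub>R f (v # us @ x # vs)"
    using gsymD(3)[OF assms, of "v # us"] by simp
  show "f (v # us @ x # y # vs) = (-1) powi (k * l) *\<^sub>R f (v # us @ y # x # vs)"
    if "x \<in> grade k" "y \<in> grade l"
    using gsymD(4)[OF assms that, of "v # us"] by simp
qed

lemma gsym_add:
  assumes "gsym f" "gsym g"
  shows "gsym (\<lambda>vs. f vs + g vs)"
proof (rule gsymI)
  fix us vs and x y and c :: real and k l :: int
  show "f (us @ (x + y) # vs) + g (us @ (x + y) # vs)
      = (f (us @ x # vs) + g (us @ x # vs)) + (f (us @ y # vs) + g (us @ y # vs))"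
    by (simp add: gsymD(2)[OF assms(1)] gsymD(2)[OF assms(2)])
  show "f (us @ (c *\<^sub>R x) # vs) + g (us @ (c *\<^sub>R x) # vs) = c *\<^sub>R (f (us @ x # vs) + g (us @ x # vs))"
    by (simp add: gsymD(3)[OF assms(1)] gsymD(3)[OF assms(2)] scaleR_add_right)
  show "f (us @ x # y # vs) + g (us @ x # y # vs)
      = (-1) powi (k * l) *\<^sub>R (f (us @ y # x # vs) + g (us @ y # x # vs))"
    if "x \<in> grade k" "y \<in> grade l"
    using gsymD(4)[OF assms(1) that, of us vs] gsymD(4)[OF assms(2) that, of us vs]
    by (simp only: scaleR_add_right)
qed

lemma bigsymD:
  assumes "bigsym g"
  shows "gsym (g A)" "gsym (\<lambda>A. g A B)"
  using assms by (simp_all add: bigsym_def)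

lemma bigsym_put_left: "bigsym g \<Longrightarrow> bigsym (put_left v g)"
  by (auto simp: bigsym_def put_left_def intro: gsym_Cons)

lemma bigsym_put_right:
  assumes "bigsym g"
  shows "bigsym (put_right v g)"
  unfolding bigsym_def
proof (intro conjI allI)
  show "gsym (put_right v g A)" for A
    unfolding put_right_def by (intro gsym_add gsym_Cons bigsymD[OF assms])
  show "gsym (\<lambda>A. put_right v g A B)" for B
    unfolding put_right_def
    by (intro gsym_add bigsymD[OF assms] gsym_map[where f = "\<lambda>A. g A (odd_part v # B)"]
        linear_grade_involution grade_involution_grade)
qed

lemma unshuffles_add:
  "unshuffles vs (\<lambda>A B. g A B + h A B) = unshuffles vs g + unshuffles vs h"
proof (induction vs arbitrary: g h)
  case (Cons v vs)
  have 1: "put_left v (\<lambda>A B. g A B + h A B) = (\<lambda>A B. put_left v g A B + put_left v h A B)"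
    "put_right v (\<lambda>A B. g A B + h A B) = (\<lambda>A B. put_right v g A B + put_right v h A B)"
    by (simp_all add: put_left_def put_right_def fun_eq_iff add_ac)
  show ?case unfolding unshuffles.simps 1 Cons.IH by (simp add: add_ac)
qed simp

lemma unshuffles_scaleR:
  "unshuffles vs (\<lambda>A B. c *\<^sub>R g A B) = c *\<^sub>R unshuffles vs g"
proof (induction vs arbitrary: g)
  case (Cons v vs)
  have 1: "put_left v (\<lambda>A B. c *\<^sub>R g A B) = (\<lambda>A B. c *\<^sub>R put_left v g A B)"
    "put_right v (\<lambda>A B. c *\<^sub>R g A B) = (\<lambda>A B. c *\<^sub>R put_right v g A B)"
    by (simp_all add: put_left_def put_right_def fun_eq_iff scaleR_add_right)
  show ?case unfolding unshuffles.simps 1 Cons.IH by (simp add: scaleR_add_right)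
qed simp

lemma put_add:
  assumes "bigsym g"
  shows "put_left (x + y) g = (\<lambda>A B. put_left x g A B + put_left y g A B)"
    and "put_right (x + y) g = (\<lambda>A B. put_right x g A B + put_right y g A B)"
    and "put_left (c *\<^sub>R x) g = (\<lambda>A B. c *\<^sub>R put_left x g A B)"
    and "put_right (c *\<^sub>R x) g = (\<lambda>A B. c *\<^sub>R put_right x g A B)"
  using gsymD(2,3)[OF bigsymD(1)[OF assms], of _ "[]"]
    gsymD(2,3)[OF bigsymD(2)[OF assms], of "[]"]
  by (simp_all add: put_left_def put_right_def fun_eq_iff linear_add[OF linear_parts(1)]
      linear_add[OF linear_parts(2)] linear_scale[OF linear_parts(1)]
      linear_scale[OF linear_parts(2)] scaleR_add_right add_ac)

lemma put_swap:
  assumes g: "bigsym g" and x: "x \<in> grade k" and y: "y \<in> grade l"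
  shows "put_left y (put_left x g) = (\<lambda>A B. (-1) powi (k * l) *\<^sub>R put_left x (put_left y g) A B)"
    and "put_right y (put_left x g) = (\<lambda>A B. (-1) powi (k * l) *\<^sub>R put_left x (put_right y g) A B)"
    and "put_left y (put_right x g) = (\<lambda>A B. (-1) powi (k * l) *\<^sub>R put_right x (put_left y g) A B)"
    and "put_right y (put_right x g) = (\<lambda>A B. (-1) powi (k * l) *\<^sub>R put_right x (put_right y g) A B)"
proof -
  note g1 = bigsymD(1)[OF g] and g2 = bigsymD(2)[OF g]
  have z: "g (0 # A) B = 0" "g A (0 # B) = 0" "g A (a # 0 # B) = 0" for A B a
    using gsym_zero[OF g2, of "[]"] gsym_zero[OF g1, of _ "[]"] gsym_zero[OF g1, of _ "[a]"] by simp_all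
  have s: "g (- a # A) B = - g (a # A) B" for a A B
    using gsymD(3)[OF g2, of "[]" "-1" a] by simp
  have inv: "grade_involution x = (-1) powi k *\<^sub>R x" "grade_involution y = (-1) powi l *\<^sub>R y"
    using x y by (simp_all add: grade_involution_homogeneous)
  have sw1: "g (x # y # A) B = (-1) powi (k * l) *\<^sub>R g (y # x # A) B" for A B
    using gsymD(4)[OF g2 x y, of "[]"] by simp
  have sw2: "g A (x # y # B) = (-1) powi (k * l) *\<^sub>R g A (y # x # B)" for A B
    using gsymD(4)[OF g1 x y, of _ "[]"] by simp
  show "put_left y (put_left x g) = (\<lambda>A B. (-1) powi (k * l) *\<^sub>R put_left x (put_left y g) A B)"
    by (intro ext) (simp only: put_left_def sw1)
  show "put_right y (put_left x g) = (\<lambda>A B. (-1) powi (k * l) *\<^sub>R put_left x (put_right y g) A B)"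
    by (intro ext)
      (simp add: put_left_def put_right_def inv parts_homogeneous[OF y] z s sign_int)
  show "put_left y (put_right x g) = (\<lambda>A B. (-1) powi (k * l) *\<^sub>R put_right x (put_left y g) A B)"
    by (intro ext)
      (simp add: put_left_def put_right_def inv parts_homogeneous[OF x] z s sign_int)
  show "put_right y (put_right x g) = (\<lambda>A B. (-1) powi (k * l) *\<^sub>R put_right x (put_right y g) A B)"
    using sw2
    by (intro ext)
      (cases "even k"; cases "even l"; simp add: put_right_def parts_homogeneous[OF x]
        parts_homogeneous[OF y] z sign_int)
qed

lemma gsym_unshuffles:
  assumes "bigsym g"
  shows "gsym (\<lambda>vs. unshuffles vs g)"
proof (rule gsymI)
  fix us vs :: "'a list" and x y and c :: real and k l :: int
  show "unshuffles (us @ (x + y) # vs) g = unshuffles (us @ x # vs) g + unshuffles (us @ y # vs) g"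
    using assms
    by (induction us arbitrary: g)
      (simp_all add: put_add(1,2) unshuffles_add bigsym_put_left bigsym_put_right add_ac)
  show "unshuffles (us @ (c *\<^sub>R x) # vs) g = c *\<^sub>R unshuffles (us @ x # vs) g"
    using assms
    by (induction us arbitrary: g)
      (simp_all add: put_add(3,4) unshuffles_scaleR bigsym_put_left bigsym_put_right scaleR_add_right)
  show "unshuffles (us @ x # y # vs) g = (-1) powi (k * l) *\<^sub>R unshuffles (us @ y # x # vs) g"
    if "x \<in> grade k" "y \<in> grade l"
    using assms
  proof (induction us arbitrary: g)
    case Nil
    show ?case
      by (simp add: put_swap[OF Nil that] unshuffles_scaleR scaleR_add_right)
  next
    case (Cons u us)
    then show ?case
      by (simp add: bigsym_put_left bigsym_put_right scaleR_add_right)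
  qed
qed

lemma sum_Pow_lessThan_Suc:
  fixes F :: "nat set \<Rightarrow> 'w::real_vector"
  shows "(\<Sum>S\<in>Pow {..<Suc m}. F S)
    = (\<Sum>T\<in>Pow {..<m}. F (insert 0 (Suc ` T))) + (\<Sum>T\<in>Pow {..<m}. F (Suc ` T))"
proof -
  have 1: "Pow (Suc ` {..<m}) = image Suc ` Pow {..<m}"
    by (simp add: image_Pow_surj)
  have 2: "inj_on (image Suc) (Pow {..<m})"
    by (simp add: inj_on_def inj_image_eq_iff)
  have 3: "inj_on (insert 0) (Pow (Suc ` {..<m}))"
    by (rule inj_onI) (metis PowD Suc_neq_Zero image_iff insert_ident subsetD)
  have "(\<Sum>S\<in>Pow {..<Suc m}. F S)
      = (\<Sum>S\<in>Pow (Suc ` {..<m}). F S) + (\<Sum>S\<in>insert 0 ` Pow (Suc ` {..<m}). F S)"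
    unfolding lessThan_Suc_eq_insert_0 Pow_insert by (rule sum.union_disjoint) auto
  also have "\<dots> = (\<Sum>S\<in>Pow (Suc ` {..<m}). F S) + (\<Sum>S\<in>Pow (Suc ` {..<m}). F (insert 0 S))"
    by (simp only: sum.reindex[OF 3] o_def)
  finally show ?thesis
    unfolding 1 by (simp add: sum.reindex[OF 2] add.commute)
qed

lemma unshuffle_sign_Cons:
  assumes "finite T"
  shows "unshuffle_sign (k # ks) (insert 0 (Suc ` T)) = unshuffle_sign ks T"
    and "unshuffle_sign (k # ks) (Suc ` T) = (-1) powi (k * (\<Sum>j\<in>T. ks ! j)) * unshuffle_sign ks T"
proof -
  have 1: "{..<Suc j} - insert 0 (Suc ` T) = Suc ` ({..<j} - T)"
    "{..<Suc j} - Suc ` T = insert 0 (Suc ` ({..<j} - T))" for j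
    by (auto simp: lessThan_Suc_eq_insert_0)
  have 2: "(\<Sum>j\<in>insert 0 (Suc ` T). \<Sum>i\<in>{..<j} - insert 0 (Suc ` T). (k # ks) ! i * (k # ks) ! j)
     = (\<Sum>j\<in>T. \<Sum>i\<in>{..<j} - T. ks ! i * ks ! j)"
    using assms by (simp add: sum.reindex 1)
  have 3: "(\<Sum>j\<in>Suc ` T. \<Sum>i\<in>{..<j} - Suc ` T. (k # ks) ! i * (k # ks) ! j)
     = (\<Sum>j\<in>T. k * ks ! j + (\<Sum>i\<in>{..<j} - T. ks ! i * ks ! j))"
    by (simp add: sum.reindex 1)
  show "unshuffle_sign (k # ks) (insert 0 (Suc ` T)) = unshuffle_sign ks T"
    unfolding unshuffle_sign_def 2 ..
  show "unshuffle_sign (k # ks) (Suc ` T) = (-1) powi (k * (\<Sum>j\<in>T. ks ! j)) * unshuffle_sign ks T"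
    unfolding unshuffle_sign_def 3 by (simp add: sum.distrib sum_distrib_left power_int_add)
qed

lemma sum_list_nths:
  fixes ks :: "int list"
  assumes "T \<subseteq> {..<length ks}"
  shows "sum_list (nths ks T) = (\<Sum>j\<in>T. ks ! j)"
  using assms
proof (induction ks arbitrary: T)
  case (Cons k ks)
  let ?T = "{j. Suc j \<in> T}"
  have T: "T = (if 0 \<in> T then {0} else {}) \<union> Suc ` ?T"
    by (auto simp: image_iff) (metis not0_implies_Suc)+
  have sub: "?T \<subseteq> {..<length ks}" using Cons.prems by auto
  then have fin: "finite ?T" by (rule finite_subset) simp
  have "(\<Sum>j\<in>T. (k # ks) ! j) = (if 0 \<in> T then k else 0) + (\<Sum>j\<in>?T. ks ! j)"
    by (subst T, subst sum.union_disjoint) (use fin in \<open>auto simp: sum.reindex\<close>)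
  then show ?case using Cons.IH[OF sub] by (simp add: nths_Cons)
qed simp

lemma homogeneous_list_nths:
  "homogeneous_list ks vs \<Longrightarrow> homogeneous_list (nths ks T) (nths vs T)"
proof (induction vs arbitrary: ks T)
  case (Cons v vs)
  from Cons.prems obtain k ks' where "ks = k # ks'" "v \<in> grade k" "homogeneous_list ks' vs"
    by (auto simp: homogeneous_list_Cons)
  with Cons.IH show ?case by (simp add: nths_Cons homogeneous_list_Cons)
qed simp

lemma gsym_map_grade_involution:
  assumes f: "gsym f" and "homogeneous_list ks vs"
  shows "f (map grade_involution vs) = (-1) powi (sum_list ks) *\<^sub>R f vs"
proof -
  have "f (us @ map grade_involution vs) = (-1) powi (sum_list ks) *\<^sub>R f (us @ vs)" for us
    using assms(2)
  proof (induction vs arbitrary: us ks)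
    case (Cons v vs)
    then obtain k ks' where ks: "ks = k # ks'" "v \<in> grade k" "homogeneous_list ks' vs"
      by (auto simp: homogeneous_list_Cons)
    show ?case
      using Cons.IH[OF ks(3), of "us @ [v]"] ks
      by (simp add: grade_involution_homogeneous gsymD(3)[OF f] power_int_add)
  qed simp
  from this[of "[]"] show ?thesis by simp
qed

lemma homogeneous_list_length: "homogeneous_list ks vs \<Longrightarrow> length ks = length vs"
  by (simp add: homogeneous_list_def list_all2_lengthD)

lemma unshuffles_homogeneous:
  assumes "bigsym g" "homogeneous_list ks vs"
  shows "unshuffles vs g
    = (\<Sum>S\<in>Pow {..<length vs}. unshuffle_sign ks S *\<^sub>R g (nths vs S) (nths vs (- S)))"
  using assms
proof (induction vs arbitrary: g ks)
  case Nil
  then show ?case by (simp add: unshuffle_sign_def)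
next
  case (Cons v vs)
  then obtain k ks' where ks: "ks = k # ks'" "v \<in> grade k" "homogeneous_list ks' vs"
    by (auto simp: homogeneous_list_Cons)
  note g1 = bigsymD(1)[OF Cons.prems(1)] and g2 = bigsymD(2)[OF Cons.prems(1)]
  have sets: "{j. Suc j \<in> Suc ` T} = T" "{j. Suc j \<in> insert 0 (Suc ` T)} = T"
    "{j. Suc j \<in> - Suc ` T} = - T" "{j. Suc j \<in> - insert 0 (Suc ` T)} = - T" for T by auto
  have nths: "nths (v # vs) (insert 0 (Suc ` T)) = v # nths vs T"
    "nths (v # vs) (- insert 0 (Suc ` T)) = nths vs (- T)"
    "nths (v # vs) (Suc ` T) = nths vs T"
    "nths (v # vs) (- Suc ` T) = v # nths vs (- T)" for T
    unfolding nths_Cons sets by auto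
  have R: "unshuffle_sign ks' T *\<^sub>R put_right v g (nths vs T) B
      = unshuffle_sign ks (Suc ` T) *\<^sub>R g (nths vs T) (v # B)" if "T \<in> Pow {..<length vs}" for T B
  proof -
    have T: "T \<subseteq> {..<length ks'}" "finite T"
      using that homogeneous_list_length[OF ks(3)] by (auto intro: finite_subset)
    have inv: "g (map grade_involution (nths vs T)) C = (-1) powi (\<Sum>j\<in>T. ks' ! j) *\<^sub>R g (nths vs T) C" for C
      using gsym_map_grade_involution[OF g2 homogeneous_list_nths[OF ks(3)]] sum_list_nths[OF T(1)] by simp
    have z: "g A (0 # B) = 0" for A using gsym_zero[OF g1, of _ "[]"] by simp
    show ?thesis
      by (simp add: put_right_def parts_homogeneous[OF ks(2)] inv z ks(1)
          unshuffle_sign_Cons[OF T(2)] sign_int)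
  qed
  have L: "unshuffle_sign ks' T *\<^sub>R put_left v g (nths vs T) B
      = unshuffle_sign ks (insert 0 (Suc ` T)) *\<^sub>R g (v # nths vs T) B" if "T \<in> Pow {..<length vs}" for T B
  proof -
    have "finite T" using that by (auto intro: finite_subset)
    then show ?thesis by (simp add: put_left_def ks(1) unshuffle_sign_Cons)
  qed
  show ?case
    unfolding unshuffles.simps list.size add_0_right add_Suc_right sum_Pow_lessThan_Suc nths
      Cons.IH[OF bigsym_put_left[OF Cons.prems(1)] ks(3)]
      Cons.IH[OF bigsym_put_right[OF Cons.prems(1)] ks(3)]
    by (intro arg_cong2[where f = "(+)"] sum.cong refl L R)
qed

lemma bigsym_tens_word: "bigsym (\<lambda>A B. word A \<otimes> word B)"
proof -
  have 1: "linear (\<lambda>x. x \<otimes> b)" "linear (\<lambda>x. a \<otimes> x)" for a b :: "'a sym"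
    by (auto intro!: linearI simp: tens_add_left tens_add_right tens_scaleR_left tens_scaleR_right)
  have "gsym (\<lambda>vs. f (word vs))" if f: "linear f" for f :: "'a sym \<Rightarrow> ('a sym, 'a sym) tensor"
  proof (rule gsymI)
    fix us vs :: "'a list" and x y and c :: real and k l :: int
    show "f (word (us @ (x + y) # vs)) = f (word (us @ x # vs)) + f (word (us @ y # vs))"
      by (simp add: gsymD(2)[OF gsym_word] linear_add[OF f])
    show "f (word (us @ (c *\<^sub>R x) # vs)) = c *\<^sub>R f (word (us @ x # vs))"
      by (simp add: gsymD(3)[OF gsym_word] linear_scale[OF f])
    show "f (word (us @ x # y # vs)) = (-1) powi (k * l) *\<^sub>R f (word (us @ y # x # vs))"
      if "x \<in> grade k" "y \<in> grade l"
      using gsymD(4)[OF gsym_word that, of us vs] by (simp only: linear_scale[OF f])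
  qed
  then show ?thesis unfolding bigsym_def using 1 by blast
qed

lemma coproduct:
  shows linear_coproduct: "linear (coproduct :: 'v::graded_real_vector sym \<Rightarrow> _)"
    and coproduct_word: "\<And>ks vs :: 'v list. homogeneous_list ks vs \<Longrightarrow>
      coproduct (word vs) = (\<Sum>S | S \<subset> {..<length vs} \<and> S \<noteq> {}.
        unshuffle_sign ks S *\<^sub>R (word (nths vs S) \<otimes> word (nths vs (- S))))"
proof -
  let ?rhs = "\<lambda>ks (vs :: 'v list). \<Sum>S | S \<subset> {..<length vs} \<and> S \<noteq> {}.
        unshuffle_sign ks S *\<^sub>R (word (nths vs S) \<otimes> word (nths vs (- S)))"
  let ?P = "\<lambda>\<Delta> :: 'v sym \<Rightarrow> _. linear \<Delta> \<and> (\<forall>ks vs. homogeneous_list ks vs \<longrightarrow> \<Delta> (word vs) = ?rhs ks vs)"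
  define D where "D = sym_lift (\<lambda>vs :: 'v list. unshuffles vs (\<lambda>A B. word A \<otimes> word B))"
  have D: "linear D" "D (word vs) = unshuffles vs (\<lambda>A B. word A \<otimes> word B)" for vs
    unfolding D_def using sym_lift[OF gsym_unshuffles[OF bigsym_tens_word]] by simp_all
  have PD: "?P D"
  proof (intro conjI allI impI)
    fix ks and vs :: "'v list"
    assume hom: "homogeneous_list ks vs"
    have "D (word vs) = (\<Sum>S\<in>Pow {..<length vs}.
        unshuffle_sign ks S *\<^sub>R (word (nths vs S) \<otimes> word (nths vs (- S))))"
      unfolding D(2) by (rule unshuffles_homogeneous[OF bigsym_tens_word hom])
    also have "\<dots> = ?rhs ks vs"
    proof (rule sum.mono_neutral_right)
      show "\<forall>S\<in>Pow {..<length vs} - {S. S \<subset> {..<length vs} \<and> S \<noteq> {}}.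
          unshuffle_sign ks S *\<^sub>R (word (nths vs S) \<otimes> word (nths vs (- S))) = 0"
      proof
        fix S assume "S \<in> Pow {..<length vs} - {S. S \<subset> {..<length vs} \<and> S \<noteq> {}}"
        then consider "S = {}" | "S = {..<length vs}" by blast
        then have "nths vs S = [] \<or> nths vs (- S) = []"
          by cases (auto simp: set_nths simp flip: set_empty)
        then show "unshuffle_sign ks S *\<^sub>R (word (nths vs S) \<otimes> word (nths vs (- S))) = 0"
          by auto
      qed
    qed auto
    finally show "D (word vs) = ?rhs ks vs" .
  qed (fact D(1))
  have uniq: "\<Delta> = D" if "?P \<Delta>" for \<Delta>
    using linear_eq_on_hom_words[of \<Delta> D] that PD by simp
  have "?P coproduct"
    unfolding coproduct_def by (rule theI[of ?P, OF PD uniq])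
  then show "linear (coproduct :: 'v sym \<Rightarrow> _)"
    "\<And>ks vs :: 'v list. homogeneous_list ks vs \<Longrightarrow> coproduct (word vs) = ?rhs ks vs"
    by blast+
qed


section \<open>L-infinity algebras and morphisms\<close>

text \<open>Everything is stated on $B(\mathcal L)$; the suspension that leads to
  $C(\mathcal L) = s\,B(\mathcal L)$ does not change codifferentials or morphisms.\<close>

type_synonym 'a bar = "'a desusp sym"

text \<open>By the Koszul rule, $(1 \otimes Q)(x \otimes y) = (-1)^{|x|}\, x \otimes Q y$ for
  \<open>Q\<close> of degree 1.\<close>

definition degree_one_coderivation :: "('v::graded_real_vector sym \<Rightarrow> 'v sym) \<Rightarrow> bool" where
  "degree_one_coderivation Q \<longleftrightarrow> linear Q \<and> has_degree 1 Q \<and>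
     (\<forall>x. coproduct (Q x) = tensor_map Q id (coproduct x) + tensor_map grade_involution Q (coproduct x))"

definition coalgebra_morphism ::
    "('v::graded_real_vector sym \<Rightarrow> 'w::graded_real_vector sym) \<Rightarrow> bool" where
  "coalgebra_morphism F \<longleftrightarrow> linear F \<and> has_degree 0 F \<and>
     (\<forall>x. coproduct (F x) = tensor_map F F (coproduct x))"

definition L_infty_algebra :: "('a::graded_real_vector bar \<Rightarrow> 'a bar) \<Rightarrow> bool" where
  "L_infty_algebra Q \<longleftrightarrow> degree_one_coderivation Q \<and> (\<forall>x. Q (Q x) = 0)"

definition L_infty_morphism ::
    "('a::graded_real_vector bar \<Rightarrow> 'a bar) \<Rightarrow> ('b::graded_real_vector bar \<Rightarrow> 'b bar) \<Rightarrow>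
     ('a bar \<Rightarrow> 'b bar) \<Rightarrow> bool" where
  "L_infty_morphism Q Q' F \<longleftrightarrow> coalgebra_morphism F \<and> (\<forall>x. Q' (F x) = F (Q x))"

text \<open>Scaling the \<open>i\<close>-th argument (counted from 0) by $(-1)^{(m-1-i)(|\gamma_i|-1)}$ in each
  degree is the multilinear extension of the sign in the decalage isomorphism; see
  \<open>structure_map_homogeneous\<close> below.\<close>

definition structure_map ::
    "('a::graded_real_vector bar \<Rightarrow> 'b::graded_real_vector bar) \<Rightarrow> 'a list \<Rightarrow> 'b" where
  "structure_map F \<gamma>s = susp (pr (F (word (map
     (\<lambda>i. desusp (hscale (\<lambda>k. (-1) powi (int (length \<gamma>s - Suc i) * (k - 1))) (\<gamma>s ! i)))
     [0..<length \<gamma>s]))))"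

lemma gsym_map_hscale:
  assumes f: "gsym f" and g: "linear g" and "homogeneous_list ks us"
  shows "f (vs @ map (\<lambda>i. g (hscale (a i) (us ! i))) [0..<length us])
    = (\<Prod>i<length us. a i (ks ! i)) *\<^sub>R f (vs @ map g us)"
  using assms(3)
proof (induction us arbitrary: vs ks a)
  case (Cons u us)
  then obtain k ks' where ks: "ks = k # ks'" "u \<in> grade k" "homogeneous_list ks' us"
    by (auto simp: homogeneous_list_Cons)
  have "f (vs @ map (\<lambda>i. g (hscale (a i) ((u # us) ! i))) [0..<length (u # us)])
      = f (vs @ (a 0 k *\<^sub>R g u) # map (\<lambda>i. g (hscale (a (Suc i)) (us ! i))) [0..<length us])"
    unfolding list.size add_0_right add_Suc_right map_upt_Suc
    by (simp add: hscale_homogeneous[OF ks(2)] linear_scale[OF g])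
  also have "\<dots> = a 0 k *\<^sub>R f ((vs @ [g u]) @ map (\<lambda>i. g (hscale (a (Suc i)) (us ! i))) [0..<length us])"
    by (simp add: gsymD(3)[OF f])
  also have "\<dots> = a 0 k *\<^sub>R (\<Prod>i<length us. a (Suc i) (ks' ! i)) *\<^sub>R f ((vs @ [g u]) @ map g us)"
    by (simp only: Cons.IH[OF ks(3), of "vs @ [g u]" "\<lambda>i. a (Suc i)"])
  also have "\<dots> = (\<Prod>i<length (u # us). a i (ks ! i)) *\<^sub>R f (vs @ map g (u # us))"
    unfolding list.size add_0_right add_Suc_right prod.lessThan_Suc_shift by (simp add: ks)
  finally show ?case .
qed simp

lemma structure_map_homogeneous:
  assumes F: "linear F" and hom: "homogeneous_list ks \<gamma>s"
  shows "structure_map F \<gamma>s =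
    (-1) powi (\<Sum>i<length \<gamma>s. int (length \<gamma>s - Suc i) * (ks ! i - 1)) *\<^sub>R
      susp (pr (F (word (map desusp \<gamma>s))))"
proof -
  have "(\<Prod>i\<in>A. (-1 :: real) powi h i) = (-1) powi (\<Sum>i\<in>A. h i)" if "finite A" for A :: "nat set" and h
    using that by induction (simp_all add: power_int_add)
  then show ?thesis
    unfolding structure_map_def
    using gsym_map_hscale[OF gsym_word linear_desusp hom, of "[]"
        "\<lambda>i k. (-1) powi (int (length \<gamma>s - Suc i) * (k - 1))"]
    by (simp add: linear_scale[OF F] linear_scale[OF linear_pr] linear_scale[OF linear_susp])
qed

text \<open>A linear map from the \<open>n\<close>-th graded exterior power, as a function on lists of length \<open>n\<close>.\<close>

definition graded_alternating ::
    "nat \<Rightarrow> int \<Rightarrow> ('a::graded_real_vector list \<Rightarrow> 'b::graded_real_vector) \<Rightarrow> bool" where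
  "graded_alternating n d H \<longleftrightarrow>
    (\<forall>us vs. length us + 1 + length vs = n \<longrightarrow> linear (\<lambda>x. H (us @ x # vs))) \<and>
    (\<forall>us vs k l. \<forall>x\<in>grade k. \<forall>y\<in>grade l. length us + 2 + length vs = n \<longrightarrow>
      H (us @ x # y # vs) = - ((-1) powi (k * l) *\<^sub>R H (us @ y # x # vs))) \<and>
    (\<forall>ks \<gamma>s. length \<gamma>s = n \<longrightarrow> homogeneous_list ks \<gamma>s \<longrightarrow> H \<gamma>s \<in> grade (sum_list ks + d))"


section \<open>Quasi-isomorphisms\<close>

definition cocycles :: "('a::graded_real_vector \<Rightarrow> 'a) \<Rightarrow> int \<Rightarrow> 'a set" where
  "cocycles d k = {x \<in> grade k. d x = 0}"

definition cohomologous :: "('a::graded_real_vector \<Rightarrow> 'a) \<Rightarrow> int \<Rightarrow> ('a \<times> 'a) set" where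
  "cohomologous d k = {(x, y). x \<in> cocycles d k \<and> y \<in> cocycles d k \<and> x - y \<in> d ` grade (k - 1)}"

definition cohomology :: "('a::graded_real_vector \<Rightarrow> 'a) \<Rightarrow> int \<Rightarrow> 'a set set" where
  "cohomology d k = cocycles d k // cohomologous d k"

text \<open>For a morphism of complexes \<open>f\<close>, the map on cohomology sends a class \<open>C\<close> to the class
  containing \<open>f ` C\<close>. Being linear, it is an isomorphism as soon as it is bijective.\<close>

definition quasi_isomorphism ::
    "('a::graded_real_vector \<Rightarrow> 'a) \<Rightarrow> ('b::graded_real_vector \<Rightarrow> 'b) \<Rightarrow> ('a \<Rightarrow> 'b) \<Rightarrow> bool" where
  "quasi_isomorphism d d' f \<longleftrightarrow>
    (\<forall>k. bij_betw (\<lambda>C. cohomologous d' k `` (f ` C)) (cohomology d k) (cohomology d' k))"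

definition L_infty_quasi_isomorphism ::
    "('a::graded_real_vector bar \<Rightarrow> 'a bar) \<Rightarrow> ('b::graded_real_vector bar \<Rightarrow> 'b bar) \<Rightarrow>
     ('a bar \<Rightarrow> 'b bar) \<Rightarrow> bool" where
  "L_infty_quasi_isomorphism Q Q' F \<longleftrightarrow> L_infty_morphism Q Q' F \<and>
     quasi_isomorphism (\<lambda>x. structure_map Q [x]) (\<lambda>x. structure_map Q' [x])
       (\<lambda>x. structure_map F [x])"

end

theory Submission
  imports Defs "HOL-Analysis.Linear_Algebra"
begin

text \<open>
  View \<open>H\<close> as a map $h : B(\mathcal L) \to s^{-1}\mathcal L^\diamond$ of degree $-1$ and solve
  $\dot F_t = Q^\diamond K_t + K_t Q$, $F_0 = F$, where $K_t$ is the coderivation along $F_t$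
  with corestriction \<open>h\<close>. Both $F_t$ and $K_t$ are polynomial in \<open>t\<close> on each word, so the solution
  is the sum of its Taylor coefficients, and the equations $\Delta F_t = (F_t \otimes F_t)\Delta$ and
  $Q^\diamond F_t = F_t Q$ persist along the flow. The coderivation is
  $K_t = h + \mu(h \otimes F_t)\Delta$, where $\mu$ multiplies a word by a letter; that it satisfies
  $\Delta K_t = (K_t \otimes F_t + F_t \otimes K_t)\Delta$ follows from coassociativity and graded
  cocommutativity of $\Delta$. On words of at most \<open>n\<close> letters $K_t$ reduces to \<open>h\<close>, which
  leaves the first-order term $Q^\diamond h + h Q$ of $F_1$.
\<close>

section \<open>Linear and bilinear maps\<close>

text \<open>The one-step correction F + D with D = Q'K + KQ respects the differentials but not the
  coproduct: the term D (x) D is missing. Taking the homotopy along the current morphism at each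
  time restores it. As the spaces carry no topology, only Taylor coefficients occur, and each law
  becomes a family of Cauchy product identities proved order by order. Koszul signs are expressed
  linearly: an odd letter crossing \<open>x\<close> replaces \<open>x\<close> by
  \<open>grade_involution x\<close>, and a letter splits into \<open>even_part\<close> and
  \<open>odd_part\<close>. Identities then hold for inhomogeneous elements and arbitrary words.
  \<open>Q\<close> is given only by its co-Leibniz rule, whereas finiteness of the Taylor sum and
  the formula for the n-th structure map require its action on words. That action is recovered from
  the corestriction, because in characteristic 0 the primitive elements are the single letters.
  Quasi-isomorphism survives since the linear part changes only if n = 1, and then by a
  null-homotopic map.\<close>

lemma linear_comp: "linear f \<Longrightarrow> linear g \<Longrightarrow> linear (\<lambda>x. f (g x))"
  using linear_compose[of g f] by (simp add: o_def)

lemma bilinear_comp: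
  assumes "bilinear b"
  shows "linear f \<Longrightarrow> linear (\<lambda>x. b (f x) c)" "linear g \<Longrightarrow> linear (\<lambda>x. b d (g x))"
  using assms by (auto simp: bilinear_def intro: linear_comp[of "\<lambda>x. b x c"] linear_comp[of "b d"])

lemma bilinearI:
  "(\<And>y. linear (\<lambda>x. b x y)) \<Longrightarrow> (\<And>x. linear (\<lambda>y. b x y)) \<Longrightarrow> bilinear b"
  by (simp add: bilinear_def)

lemma linear_eq_on_homogeneous:
  fixes f g :: "'v::graded_real_vector \<Rightarrow> 'w::real_vector"
  assumes "linear f" "linear g" "\<And>k x. x \<in> grade k \<Longrightarrow> f x = g x"
  shows "f x = g x"
  by (subst (1 2) hcomp_props(3)[of x])
    (simp add: linear_sum[OF assms(1)] linear_sum[OF assms(2)] assms(3)[OF hcomp_props(1)])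

lemma bilinear_tens: "bilinear (\<otimes>)"
  by (intro bilinearI linearI)
    (simp_all add: tens_add_left tens_add_right tens_scaleR_left tens_scaleR_right)

lemmas linear_parts_comp = linear_comp[OF linear_grade_involution]
  linear_comp[OF linear_parts(1)] linear_comp[OF linear_parts(2)]

lemma grade_involution_involution [simp]: "grade_involution (grade_involution x) = x"
proof (rule linear_eq_on_homogeneous[of "\<lambda>x. grade_involution (grade_involution x)" "\<lambda>x. x" for x])
  show "grade_involution (grade_involution x) = x" if "x \<in> grade k" for x :: 'a and k
    using that by (simp add: grade_involution_homogeneous linear_scale[OF linear_grade_involution] sign_int)
qed (intro linear_parts_comp linear_grade_involution linear_ident)+

lemma parts_simps [simp]:
  "even_part (even_part x) = even_part x" "odd_part (even_part x) = 0"
  "even_part (odd_part x) = 0" "odd_part (odd_part x) = odd_part x"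
  "even_part (grade_involution x) = even_part x" "odd_part (grade_involution x) = - odd_part x"
  "grade_involution (even_part x) = even_part x" "grade_involution (odd_part x) = - odd_part x"
proof -
  have *: "\<lbrakk>linear f; linear g; \<And>k x. x \<in> grade k \<Longrightarrow> f x = g x\<rbrakk> \<Longrightarrow> f x = g x"
    for f g :: "'a \<Rightarrow> 'a" by (rule linear_eq_on_homogeneous)
  note lin = linear_parts_comp linear_parts linear_grade_involution linear_compose_neg linear_zero
  note simp = parts_homogeneous grade_involution_homogeneous sign_int linear_0[OF linear_parts(1)]
     linear_0[OF linear_parts(2)] linear_0[OF linear_grade_involution]
     linear_neg[OF linear_parts(1)] linear_neg[OF linear_parts(2)]
  show "even_part (even_part x) = even_part x" by (rule *) (auto intro!: lin simp: simp)
  show "odd_part (even_part x) = 0" by (rule *) (auto intro!: lin simp: simp)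
  show "even_part (odd_part x) = 0" by (rule *) (auto intro!: lin simp: simp)
  show "odd_part (odd_part x) = odd_part x" by (rule *) (auto intro!: lin simp: simp)
  show "even_part (grade_involution x) = even_part x" by (rule *) (auto intro!: lin simp: simp)
  show "odd_part (grade_involution x) = - odd_part x" by (rule *) (auto intro!: lin simp: simp)
  show "grade_involution (even_part x) = even_part x" by (rule *) (auto intro!: lin simp: simp)
  show "grade_involution (odd_part x) = - odd_part x" by (rule *) (auto intro!: lin simp: simp)
qed

lemma even_plus_odd: "even_part x + odd_part x = x"
  by (rule linear_eq_on_homogeneous[of "\<lambda>x. even_part x + odd_part x" "\<lambda>x. x" for x])
    (auto intro!: linear_parts linear_compose_add linear_ident simp: parts_homogeneous)

lemma grade_involution_parts: "grade_involution x = even_part x - odd_part x"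
  using arg_cong[OF even_plus_odd[of x], of grade_involution]
  by (simp add: linear_add[OF linear_grade_involution])

section \<open>Unshuffles\<close>

lemma unshuffles_zero: "unshuffles vs (\<lambda>A B. 0) = 0"
  using unshuffles_scaleR[of vs 0 "\<lambda>A B. 0"] by simp

lemma unshuffles_linear:
  assumes "linear f"
  shows "f (unshuffles vs g) = unshuffles vs (\<lambda>A B. f (g A B))"
proof (induction vs arbitrary: g)
  case (Cons v vs)
  show ?case
    unfolding unshuffles.simps linear_add[OF assms] Cons.IH
    by (simp add: put_left_def put_right_def linear_add[OF assms])
qed simp

text \<open>The involution keeps the even part of a letter and negates the odd part, so both pieces
  of a split inherit it. Coassociativity needs this, since \<open>put_right\<close> applies the
  involution to a left word that is then split again.\<close>

lemma unshuffles_map_grade_involution: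
  "unshuffles (map grade_involution vs) g
    = unshuffles vs (\<lambda>A B. g (map grade_involution A) (map grade_involution B))"
proof (induction vs arbitrary: g)
  case (Cons v vs)
  have *: "map grade_involution (map grade_involution A) = A" for A :: "'b list"
    by (simp add: o_def)
  show ?case
    by (simp add: Cons.IH put_left_def put_right_def * del: map_map)
qed simp

text \<open>A letter moved right past an empty word meets no sign, so its even and odd parts
  recombine by additivity of \<open>f\<close>.\<close>

lemma unshuffles_left_empty:
  assumes "gsym f"
  shows "unshuffles vs (\<lambda>A B. if A = [] then f B else 0) = f vs"
  using assms
proof (induction vs arbitrary: f)
  case (Cons v vs)
  have 1: "put_left v (\<lambda>A B. if A = [] then f B else 0) = (\<lambda>A B. 0)"
    by (simp add: put_left_def)
  have "f (even_part v # B) + f (odd_part v # B) = f (v # B)" for B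
    using gsymD(2)[OF Cons.prems, of "[]"] by (metis append_Nil even_plus_odd)
  then have 2: "put_right v (\<lambda>A B. if A = [] then f B else 0) = (\<lambda>A B. if A = [] then f (v # B) else 0)"
    by (auto simp: put_right_def fun_eq_iff)
  show ?case
    unfolding unshuffles.simps 1 2 unshuffles_zero Cons.IH[OF gsym_Cons[OF Cons.prems]] by simp
qed simp

lemma unshuffles_right_empty:
  "unshuffles vs (\<lambda>A B. if B = [] then f A else 0) = f vs"
proof (induction vs arbitrary: f)
  case (Cons v vs)
  have 1: "put_left v (\<lambda>A B. if B = [] then f A else 0) = (\<lambda>A B. if B = [] then f (v # A) else 0)"
    "put_right v (\<lambda>A B. if B = [] then f A else 0) = (\<lambda>A B. 0)"
    by (simp_all add: put_left_def put_right_def)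
  show ?case
    unfolding unshuffles.simps 1 unshuffles_zero Cons.IH by simp
qed simp

text \<open>Both sides place the first letter in one of three words; \<open>g'\<close> collects the
  five signed terms. The right side produces two more, whose third word starts with
  \<open>odd_part (even_part v)\<close> or \<open>even_part (odd_part v)\<close>, hence with
  0.\<close>

lemma unshuffles_coassoc:
  assumes "\<And>A B C. 0 \<in> set C \<Longrightarrow> g A B C = 0"
  shows "unshuffles vs (\<lambda>A B. unshuffles A (\<lambda>A1 A2. g A1 A2 B))
    = unshuffles vs (\<lambda>A B. unshuffles B (g A))"
  using assms
proof (induction vs arbitrary: g)
  case (Cons v vs)
  define g' where "g' = (\<lambda>A B C. g (v # A) B C + g A (even_part v # B) C
    + g (map grade_involution A) (odd_part v # B) C + g A B (even_part v # C)
    + g (map grade_involution A) (map grade_involution B) (odd_part v # C))"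
  have z: "g A B (0 # C) = 0" for A B C using Cons.prems by simp
  have "unshuffles (v # vs) (\<lambda>A B. unshuffles A (\<lambda>A1 A2. g A1 A2 B))
      = unshuffles vs (\<lambda>A B. unshuffles A (\<lambda>A1 A2. g' A1 A2 B))"
    by (simp add: put_left_def put_right_def unshuffles_map_grade_involution g'_def
        add_ac flip: unshuffles_add)
  also have "\<dots> = unshuffles vs (\<lambda>A B. unshuffles B (g' A))"
    by (rule Cons.IH) (simp add: g'_def Cons.prems)
  also have "\<dots> = unshuffles (v # vs) (\<lambda>A B. unshuffles B (g A))"
    by (simp add: put_left_def put_right_def g'_def z add_ac flip: unshuffles_add)
  finally show ?case .
qed simp

text \<open>With both arguments of parity \<open>a\<close> and \<open>b\<close>, the Koszul sign is
  $(-1)^{ab} = \frac12(1 + (-1)^a + (-1)^b - (-1)^{a+b})$.\<close>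

definition koszul_flip ::
    "('a \<Rightarrow> 'a) \<Rightarrow> ('a \<Rightarrow> 'a \<Rightarrow> 'w::real_vector) \<Rightarrow> 'a \<Rightarrow> 'a \<Rightarrow> 'w" where
  "koszul_flip J g = (\<lambda>A B. (1/2) *\<^sub>R (g B A + g B (J A) + g (J B) A - g (J B) (J A)))"

text \<open>The flip interchanges \<open>put_left v\<close> and \<open>put_right v\<close>, so the
  two choices for the first letter trade places in the induction.\<close>

lemma unshuffles_cocomm:
  assumes "bigsym g"
  shows "unshuffles vs g = unshuffles vs (koszul_flip (map grade_involution) g)"
  using assms
proof (induction vs arbitrary: g)
  case Nil
  have "x = (1/2) *\<^sub>R (x + x)" for x :: 'b by (simp flip: scaleR_2)
  then show ?case by (simp add: koszul_flip_def)
next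
  case (Cons v vs)
  note g = Cons.prems
  have add1: "g (v # A) B = g (even_part v # A) B + g (odd_part v # A) B"
    and add2: "g A (v # B) = g A (even_part v # B) + g A (odd_part v # B)"
    and neg1: "g (- x # A) B = - g (x # A) B" and neg2: "g A (- x # B) = - g A (x # B)"
    and inv2: "g A (grade_involution v # B) = g A (even_part v # B) - g A (odd_part v # B)" for A B x
    using gsymD(2)[OF bigsymD(1)[OF g], of _ "[]" "even_part v" "odd_part v"]
      gsymD(2)[OF bigsymD(2)[OF g], of "[]" "even_part v" "odd_part v"]
      gsymD(2)[OF bigsymD(1)[OF g], of _ "[]" "even_part v" "- odd_part v"]
      gsymD(3)[OF bigsymD(1)[OF g], of _ "[]" "-1"] gsymD(3)[OF bigsymD(2)[OF g], of "[]" "-1"]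
    by (simp_all add: even_plus_odd grade_involution_parts)
  let ?g = "\<lambda>A B. put_left v g A B + put_right v g A B"
  have inv: "map grade_involution (map grade_involution A) = A" for A :: "'a list"
    by (simp add: o_def)
  have flip: "koszul_flip (map grade_involution) ?g
      = (\<lambda>A B. put_left v (koszul_flip (map grade_involution) g) A B
             + put_right v (koszul_flip (map grade_involution) g) A B)"
    by (intro ext)
      (simp add: put_left_def put_right_def koszul_flip_def inv neg1 neg2
        add1 add2 inv2 algebra_simps del: map_map flip: scaleR_add_right)
  have "bigsym ?g"
    using bigsym_put_left[OF g] bigsym_put_right[OF g] by (auto simp: bigsym_def intro: gsym_add)
  from Cons.IH[OF this] show ?case by (simp add: unshuffles_add flip)
qed

section \<open>Evaluating bilinear maps on coproducts\<close>

text \<open>The Sweedler sum of \<open>b\<close> over the coproduct. Quantifying over bilinear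
  \<open>b\<close> lets coassociativity and cocommutativity be applied without iterated tensor
  products.\<close>

definition cop :: "('v::graded_real_vector sym \<Rightarrow> 'v sym \<Rightarrow> 'w::real_vector) \<Rightarrow> 'v sym \<Rightarrow> 'w" where
  "cop b x = tensor_lift b (coproduct x)"

definition trilinear :: "('a::real_vector \<Rightarrow> 'b::real_vector \<Rightarrow> 'c::real_vector \<Rightarrow> 'd::real_vector) \<Rightarrow> bool" where
  "trilinear T \<longleftrightarrow> (\<forall>b c. linear (\<lambda>a. T a b c)) \<and> (\<forall>a c. linear (\<lambda>b. T a b c)) \<and>
     (\<forall>a b. linear (T a b))"

lemma linear_eq_on_words:
  assumes "linear f" "linear g" "\<And>vs. f (word vs) = g (word vs)"
  shows "f x = g x"
  using linear_eq_on_hom_words[OF assms(1,2)] assms(3) by metis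

lemma word_in_grade: "homogeneous_list ks vs \<Longrightarrow> word vs \<in> grade (sum_list ks)"
  unfolding grade_sym_def by (blast intro: span_base)

lemma has_degree_symI:
  fixes f :: "'v::graded_real_vector sym \<Rightarrow> 'w::graded_real_vector"
  assumes f: "linear f"
    and "\<And>ks vs. homogeneous_list ks vs \<Longrightarrow> f (word vs) \<in> grade (sum_list ks + d)"
  shows "has_degree d f"
proof -
  have "f ` grade k \<subseteq> grade (k + d)" for k
    unfolding grade_sym_def[of k] linear_span_image[OF f, symmetric]
    by (intro span_minimal subspace_grade) (auto intro: assms(2))
  then show ?thesis by (auto simp: has_degree_def)
qed

lemma grade_involution_word:
  fixes vs :: "'a::graded_real_vector list"
  shows "grade_involution (word vs) = word (map grade_involution vs)"
proof -
  have g: "gsym (\<lambda>vs :: 'a list. word (map grade_involution vs))"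
    by (rule gsym_map[OF gsym_word linear_grade_involution grade_involution_grade])
  have eq: "grade_involution = sym_lift (\<lambda>vs. word (map grade_involution vs :: 'a list))"
    by (rule linear_eq_on_hom_words[OF linear_grade_involution])
      (simp_all add: sym_lift[OF g] grade_involution_homogeneous[OF word_in_grade]
        gsym_map_grade_involution[OF gsym_word])
  show ?thesis unfolding eq by (rule sym_lift(2)[OF g]) simp
qed

lemma has_degree_grade_involution:
  assumes "linear f" "has_degree d f"
  shows "f (grade_involution x) = (-1) powi d *\<^sub>R grade_involution (f x)"
proof (rule linear_eq_on_homogeneous[of "\<lambda>x. f (grade_involution x)"])
  show "f (grade_involution x) = (-1) powi d *\<^sub>R grade_involution (f x)" if "x \<in> grade k" for x k
    using assms that
    by (auto simp: has_degree_def grade_involution_homogeneous[where k = "k + d"]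
        grade_involution_homogeneous[OF that] linear_scale[OF assms(1)] power_int_add sign_int)
qed (intro linear_compose_scale_right linear_comp[OF linear_grade_involution] assms
      linear_comp[OF assms(1)] linear_grade_involution)+

text \<open>The formula characterising \<open>coproduct\<close> covers homogeneous words only;
  \<open>unshuffles\<close> makes sense on all words, and linear maps agreeing on homogeneous words
  coincide.\<close>

lemma coproduct_word_unshuffles:
  fixes vs :: "'a::graded_real_vector list"
  shows "coproduct (word vs) = unshuffles vs (\<lambda>A B. word A \<otimes> word B)"
proof -
  let ?f = "\<lambda>vs :: 'a list. unshuffles vs (\<lambda>A B. word A \<otimes> word B)"
  have g: "gsym ?f" by (rule gsym_unshuffles[OF bigsym_tens_word])
  have eq: "coproduct = sym_lift ?f"
  proof (rule linear_eq_on_hom_words)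
    fix ks and vs :: "'a list"
    assume hom: "homogeneous_list ks vs"
    have "?f vs = (\<Sum>S\<in>Pow {..<length vs}.
        unshuffle_sign ks S *\<^sub>R (word (nths vs S) \<otimes> word (nths vs (- S))))"
      by (rule unshuffles_homogeneous[OF bigsym_tens_word hom])
    also have "\<dots> = coproduct (word vs)"
      unfolding coproduct_word[OF hom]
    proof (rule sum.mono_neutral_right)
      show "\<forall>S\<in>Pow {..<length vs} - {S. S \<subset> {..<length vs} \<and> S \<noteq> {}}.
          unshuffle_sign ks S *\<^sub>R (word (nths vs S) \<otimes> word (nths vs (- S))) = 0"
      proof
        fix S assume "S \<in> Pow {..<length vs} - {S. S \<subset> {..<length vs} \<and> S \<noteq> {}}"
        then consider "S = {}" | "S = {..<length vs}" by blast
        then have "nths vs S = [] \<or> nths vs (- S) = []"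
          by cases (auto simp: set_nths simp flip: set_empty)
        then show "unshuffle_sign ks S *\<^sub>R (word (nths vs S) \<otimes> word (nths vs (- S))) = 0"
          by auto
      qed
    qed auto
    finally show "coproduct (word vs) = sym_lift ?f (word vs)" by (simp add: sym_lift[OF g])
  qed (simp_all add: linear_coproduct sym_lift[OF g])
  show ?thesis unfolding eq by (rule sym_lift(2)[OF g]) simp
qed

lemma linear_tensor_lift: "bilinear b \<Longrightarrow> linear (tensor_lift b)"
  by (rule tensor_lift) (simp_all add: bilinear_def)

lemma tensor_lift_tens: "bilinear b \<Longrightarrow> tensor_lift b (x \<otimes> y) = b x y"
  by (rule tensor_lift) (simp_all add: bilinear_def)

lemma linear_cop: "bilinear b \<Longrightarrow> linear (cop b)"
  unfolding cop_def by (intro linear_comp[OF linear_tensor_lift] linear_coproduct)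

lemma cop_word: "bilinear b \<Longrightarrow> cop b (word vs) = unshuffles vs (\<lambda>A B. b (word A) (word B))"
  unfolding cop_def coproduct_word_unshuffles
  by (subst unshuffles_linear[OF linear_tensor_lift]) (simp_all add: tensor_lift_tens)

lemma cop_letter: "bilinear b \<Longrightarrow> cop b (word [v]) = 0"
  using bilinear_lzero[of b] bilinear_rzero[of b]
  by (simp add: cop_word put_left_def put_right_def)

lemma cop_tens: "cop (\<otimes>) x = coproduct x"
proof (rule linear_eq_on_words)
  show "cop (\<otimes>) (word vs) = coproduct (word vs)" for vs :: "'a list"
    by (simp add: cop_word[OF bilinear_tens] coproduct_word_unshuffles)
qed (rule linear_cop[OF bilinear_tens] linear_coproduct)+

lemma linear_apply_cop:
  assumes "linear f"
  shows "f (cop b x) = cop (\<lambda>a c. f (b a c)) x"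
  unfolding cop_def tensor_lift_def lin_ext_def
  by (simp add: linear_sum[OF assms] linear_scale[OF assms] split_def)

lemma cop_tensor_map: "tensor_map f g (coproduct x) = cop (\<lambda>a b. f a \<otimes> g b) x"
  by (simp add: tensor_map_def cop_def)

lemma cop_add: "cop (\<lambda>a b. f a b + g a b) x = cop f x + cop g x"
  by (simp add: cop_def tensor_lift_def lin_ext_def split_def scaleR_add_right sum.distrib)

lemma cop_scaleR: "cop (\<lambda>a b. r *\<^sub>R f a b) x = r *\<^sub>R cop f x"
  by (simp add: cop_def tensor_lift_def lin_ext_def split_def scaleR_sum_right mult.commute)

lemma cop_zero: "cop (\<lambda>a b. 0) x = 0"
  by (simp add: cop_def tensor_lift_def lin_ext_def split_def)

lemma cop_sum: "cop (\<lambda>a b. \<Sum>i\<in>I. f i a b) x = (\<Sum>i\<in>I. cop (f i) x)"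
  by (induction I rule: infinite_finite_induct) (simp_all add: cop_zero cop_add)

lemma linear_cop_param:
  assumes "\<And>a b. linear (\<lambda>z. f z a b)"
  shows "linear (\<lambda>z. cop (f z) x)"
proof (rule linearI)
  fix y z and c :: real
  have "f (y + z) = (\<lambda>a b. f y a b + f z a b)" "f (c *\<^sub>R y) = (\<lambda>a b. c *\<^sub>R f y a b)"
    by (simp_all add: linear_add[OF assms] linear_scale[OF assms] fun_eq_iff)
  then show "cop (f (y + z)) x = cop (f y) x + cop (f z) x" "cop (f (c *\<^sub>R y)) x = c *\<^sub>R cop (f y) x"
    by (simp_all add: cop_add cop_scaleR)
qed

lemma trilinearD:
  assumes "trilinear T"
  shows "linear f \<Longrightarrow> linear (\<lambda>a. T (f a) b c)" "linear g \<Longrightarrow> linear (\<lambda>b. T a (g b) c)"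
    "linear h \<Longrightarrow> linear (\<lambda>c. T a b (h c))"
    "bilinear (\<lambda>a b. T a b c)" "bilinear (T a)"
  using assms
  by (auto simp: bilinear_def trilinear_def linear_comp[of "\<lambda>a. T a b c"]
      linear_comp[of "\<lambda>b. T a b c"] linear_comp[of "T a b"])

lemma gsym_linear_word:
  fixes f :: "'v::graded_real_vector sym \<Rightarrow> 'w::real_vector"
  assumes f: "linear f"
  shows "gsym (\<lambda>A. f (word A))"
proof (rule gsymI)
  fix us vs :: "'v list" and x y :: 'v and k l :: int
  assume "x \<in> grade k" "y \<in> grade l"
  from gsymD(4)[OF gsym_word this, of us vs]
  show "f (word (us @ x # y # vs)) = (-1) powi (k * l) *\<^sub>R f (word (us @ y # x # vs))"
    by (simp only: linear_scale[OF f])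
qed (simp_all add: gsymD(2,3)[OF gsym_word] linear_add[OF f] linear_scale[OF f])

lemma bigsym_bilinear_word: "bilinear b \<Longrightarrow> bigsym (\<lambda>A B. b (word A) (word B))"
  by (simp add: bilinear_def bigsym_def gsym_linear_word[of "\<lambda>x. b x y" for y]
      gsym_linear_word[of "b x" for x])

lemma cop_coassoc:
  assumes T: "trilinear T"
  shows "cop (\<lambda>a c. cop (\<lambda>a b. T a b c) a) x = cop (\<lambda>a b. cop (T a) b) x"
proof (rule linear_eq_on_words)
  have l: "bilinear (\<lambda>a c. cop (\<lambda>a b. T a b c) a)" and r: "bilinear (\<lambda>a b. cop (T a) b)"
    by (intro bilinearI linear_cop trilinearD[OF T] linear_cop_param linear_ident)+
  show "linear (cop (\<lambda>a c. cop (\<lambda>a b. T a b c) a))" "linear (cop (\<lambda>a b. cop (T a) b))"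
    by (intro linear_cop l r)+
  fix vs
  \<comment> \<open>A letter 0 makes the third factor 0; this is the vanishing condition of
    \<open>unshuffles_coassoc\<close>.\<close>
  have z: "T (word A) (word B) (word C) = 0" if C: "0 \<in> set C" for A B C
  proof -
    obtain us ws where "C = us @ 0 # ws" using C by (auto simp: in_set_conv_decomp)
    then have "word C = 0" using gsym_zero[OF gsym_word] by simp
    then show ?thesis using T by (simp add: trilinear_def linear_0)
  qed
  show "cop (\<lambda>a c. cop (\<lambda>a b. T a b c) a) (word vs) = cop (\<lambda>a b. cop (T a) b) (word vs)"
    unfolding cop_word[OF l] cop_word[OF r] cop_word[OF trilinearD(4)[OF T]]
      cop_word[OF trilinearD(5)[OF T]]
    by (rule unshuffles_coassoc) (rule z)
qed

lemma bilinear_koszul_flip: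
  assumes b: "bilinear b" and J: "linear J"
  shows "bilinear (koszul_flip J b)"
  unfolding koszul_flip_def
  by (intro bilinearI linear_compose_scale_right linear_compose_sub linear_compose_add
      bilinear_comp[OF b] J linear_ident)

lemma cop_cocomm:
  assumes b: "bilinear b"
  shows "cop b x = cop (koszul_flip grade_involution b) x"
proof (rule linear_eq_on_words)
  have f: "bilinear (koszul_flip grade_involution b)"
    by (rule bilinear_koszul_flip[OF b linear_grade_involution])
  show "linear (cop b)" "linear (cop (koszul_flip grade_involution b))"
    by (intro linear_cop b f)+
  show "cop b (word vs) = cop (koszul_flip grade_involution b) (word vs)" for vs
    unfolding cop_word[OF b] cop_word[OF f] unshuffles_cocomm[OF bigsym_bilinear_word[OF b], of vs]
    by (simp add: koszul_flip_def grade_involution_word)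
qed

lemma cop_in_grade:
  assumes b: "bilinear b"
    and deg: "\<And>i j x y. x \<in> grade i \<Longrightarrow> y \<in> grade j \<Longrightarrow> b x y \<in> grade (i + j + d)"
    and x: "x \<in> grade k"
  shows "cop b x \<in> grade (k + d)"
proof -
  have "cop b (word vs) \<in> grade (sum_list ks + d)" if hom: "homogeneous_list ks vs" for ks vs
    unfolding cop_word[OF b] unshuffles_homogeneous[OF bigsym_bilinear_word[OF b] hom]
  proof (intro subspace_sum[OF subspace_grade] grade_scaleR)
    fix S assume S: "S \<in> Pow {..<length vs}"
    have len: "length ks = length vs" by (rule homogeneous_list_length[OF hom])
    have split: "sum_list (nths ks S) + sum_list (nths ks (- S)) = sum_list ks"
    proof -
      have "nths ks (- S) = nths ks ({..<length ks} - S)"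
        by (simp add: nths_def cong: filter_cong) (rule arg_cong[of _ _ "map fst"], rule filter_cong, auto simp: in_set_zip)
      moreover have "(\<Sum>j<length ks. ks ! j) = (\<Sum>j\<in>S. ks ! j) + (\<Sum>j\<in>{..<length ks} - S. ks ! j)"
        using S len sum.subset_diff[of S "{..<length ks}"] by (simp add: add.commute)
      moreover have "sum_list (nths ks S) = (\<Sum>j\<in>S. ks ! j)"
        "sum_list (nths ks ({..<length ks} - S)) = (\<Sum>j\<in>{..<length ks} - S. ks ! j)"
        using S len by (auto intro!: sum_list_nths)
      moreover have "sum_list ks = (\<Sum>j<length ks. ks ! j)"
        by (simp add: sum_list_sum_nth atLeast0LessThan)
      ultimately show ?thesis by simp
    qed
    show "b (word (nths vs S)) (word (nths vs (- S))) \<in> grade (sum_list ks + d)"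
      using deg[OF word_in_grade word_in_grade, OF homogeneous_list_nths homogeneous_list_nths, OF hom hom, of S "- S"]
      by (simp add: split)
  qed
  then have "has_degree d (cop b)" by (rule has_degree_symI[OF linear_cop[OF b]])
  then show ?thesis using x by (simp add: has_degree_def)
qed

section \<open>Multiplication by a letter\<close>

text \<open>\<open>word [] = 0\<close> forces the value 0 on the empty word, although v times a unit
  would be \<open>word [v]\<close>; such one-letter terms are always added separately.\<close>

definition lmul :: "'v::graded_real_vector \<Rightarrow> 'v sym \<Rightarrow> 'v sym" where
  "lmul v = sym_lift (\<lambda>vs. if vs = [] then 0 else word (v # vs))"

lemma gsym_nonempty: "gsym f \<Longrightarrow> gsym (\<lambda>vs. if vs = [] then 0 else f vs)"
  by (rule gsymI) (simp_all add: gsymD(2,3), rule gsymD(4))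

lemma lmul:
  shows linear_lmul: "linear (lmul v)"
    and lmul_word: "lmul v (word vs) = (if vs = [] then 0 else word (v # vs))"
proof -
  have "gsym (\<lambda>vs. if vs = [] then 0 else word (v # vs))"
    by (rule gsym_nonempty[OF gsym_Cons[OF gsym_word]])
  from sym_lift[OF this] show "linear (lmul v)"
    "lmul v (word vs) = (if vs = [] then 0 else word (v # vs))"
    unfolding lmul_def by simp_all
qed

lemma linear_letter: "linear (\<lambda>v. word [v])"
  using gsymD(1)[OF gsym_word, of "[]" "[]"] by simp

lemma bilinear_letter_mult: "bilinear lmul"
proof (rule bilinearI[OF linearI linear_lmul])
  fix u v :: 'a and c :: real and w :: "'a sym"
  show "lmul (u + v) w = lmul u w + lmul v w"
    by (rule linear_eq_on_words[where f = "lmul (u + v)"])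
      (use gsymD(2)[OF gsym_word, of "[]"] in \<open>auto simp: linear_lmul linear_compose_add lmul_word\<close>)
  show "lmul (c *\<^sub>R v) w = c *\<^sub>R lmul v w"
    by (rule linear_eq_on_words[where f = "lmul (c *\<^sub>R v)"])
      (use gsymD(3)[OF gsym_word, of "[]"] in \<open>auto simp: linear_lmul linear_compose_scale_right lmul_word\<close>)
qed

lemma lmul_in_grade:
  assumes "v \<in> grade k" "w \<in> grade l"
  shows "lmul v w \<in> grade (k + l)"
proof -
  have "lmul v (word vs) \<in> grade (sum_list ks + k)" if "homogeneous_list ks vs" for ks vs
    using word_in_grade[of "k # ks" "v # vs"] assms(1) that
    by (simp add: lmul_word homogeneous_list_Cons add.commute)
  then have "has_degree k (lmul v)" by (rule has_degree_symI[OF linear_lmul])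
  then show ?thesis using assms(2) by (auto simp: has_degree_def add.commute[of k])
qed

text \<open>The even part of \<open>v\<close> passes \<open>u\<close> freely, the odd part at the
  price of the involution on \<open>u\<close>: the Koszul sign in linear form.\<close>

lemma word_swap: "word (u # even_part v # B) + word (grade_involution u # odd_part v # B) = word (v # u # B)"
proof (rule linear_eq_on_homogeneous[where x = v])
  note w1 = gsymD(1)[OF gsym_word, of "[]", simplified]
    and w2 = gsymD(1)[OF gsym_word, of "[a]" for a, simplified]
  show "linear (\<lambda>v. word (u # even_part v # B) + word (grade_involution u # odd_part v # B))"
    by (intro linear_compose_add linear_comp[OF w2] linear_parts)
  show "linear (\<lambda>v. word (v # u # B))" by (rule w1)
  fix k and v :: 'a assume v: "v \<in> grade k"
  show "word (u # even_part v # B) + word (grade_involution u # odd_part v # B) = word (v # u # B)"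
  proof (rule linear_eq_on_homogeneous[where x = u])
    show "linear (\<lambda>u. word (u # even_part v # B) + word (grade_involution u # odd_part v # B))"
      by (intro linear_compose_add linear_comp[OF w1] linear_grade_involution linear_ident)
    show "linear (\<lambda>u. word (v # u # B))" by (rule w2)
    fix l and u :: 'a assume u: "u \<in> grade l"
    have "word (u # 0 # B) = 0" "word ((- u) # v # B) = - word (u # v # B)" for u v :: 'a
      using gsym_zero[OF gsym_word, of "[u]"] gsymD(3)[OF gsym_word, of "[]" "-1" u] by simp_all
    then show "word (u # even_part v # B) + word (grade_involution u # odd_part v # B) = word (v # u # B)"
      using gsymD(4)[OF gsym_word v u, of "[]" B]
      by (simp add: parts_homogeneous[OF v] grade_involution_homogeneous[OF u] sign_int)
  qed
qed

text \<open>The coproduct of a product with v is (v (x) 1 + 1 (x) v) acting on the coproduct of w,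
  plus the terms v (x) w and w (x) v that a unit would otherwise supply.\<close>

lemma cop_lmul:
  assumes b: "bilinear b"
  shows "cop b (lmul v w) = b (word [v]) w + b w (word [even_part v])
      + b (grade_involution w) (word [odd_part v])
      + cop (\<lambda>a c. b (lmul v a) c + b a (lmul (even_part v) c)
          + b (grade_involution a) (lmul (odd_part v) c)) w"
proof (rule linear_eq_on_words[where x = w])
  note lin = bilinear_comp[OF b] bilinear_comp[OF bilinear_letter_mult] linear_lmul linear_grade_involution
     linear_ident linear_compose_add
  have b': "bilinear (\<lambda>a c. b (lmul v a) c + b a (lmul (even_part v) c)
          + b (grade_involution a) (lmul (odd_part v) c))"
    by (intro bilinearI lin)
  show "linear (\<lambda>w. cop b (lmul v w))" by (intro linear_comp[OF linear_cop[OF b]] lin)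
  show "linear (\<lambda>w. b (word [v]) w + b w (word [even_part v])
      + b (grade_involution w) (word [odd_part v])
      + cop (\<lambda>a c. b (lmul v a) c + b a (lmul (even_part v) c)
          + b (grade_involution a) (lmul (odd_part v) c)) w)"
    by (intro lin linear_cop b')
  fix vs
  note z = bilinear_lzero[OF b] bilinear_rzero[OF b]
  show "cop b (lmul v (word vs)) = b (word [v]) (word vs) + b (word vs) (word [even_part v])
      + b (grade_involution (word vs)) (word [odd_part v])
      + cop (\<lambda>a c. b (lmul v a) c + b a (lmul (even_part v) c)
          + b (grade_involution a) (lmul (odd_part v) c)) (word vs)"
  proof (cases "vs = []")
    case True
    then show ?thesis
      by (simp add: z linear_0[OF linear_lmul] linear_0[OF linear_grade_involution]
          linear_0[OF linear_cop[OF b]] linear_0[OF linear_cop[OF b']])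
  next
    case False
    have 1: "put_left v (\<lambda>A B. b (word A) (word B))
        = (\<lambda>A B. (if A = [] then b (word [v]) (word B) else 0) + b (lmul v (word A)) (word B))"
      by (auto simp: put_left_def lmul_word fun_eq_iff z)
    have 2: "put_right v (\<lambda>A B. b (word A) (word B))
        = (\<lambda>A B. (if B = [] then b (word A) (word [even_part v]) +
                    b (grade_involution (word A)) (word [odd_part v]) else 0)
            + (b (word A) (lmul (even_part v) (word B))
               + b (grade_involution (word A)) (lmul (odd_part v) (word B))))"
      by (auto simp: put_right_def lmul_word fun_eq_iff z grade_involution_word)
    show ?thesis
      using False b
      by (simp add: lmul_word cop_word[OF b] cop_word[OF b'] 1 2 unshuffles_add
          unshuffles_left_empty[OF gsym_linear_word] unshuffles_right_empty bilinear_def)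
  qed
qed

section \<open>Coderivations along coalgebra morphisms\<close>

text \<open>The part of the \<open>f\<close>-coderivation with corestriction \<open>h\<close> in
  which \<open>h\<close> leaves a nonempty remainder to \<open>f\<close>.\<close>

definition conv ::
    "('v::graded_real_vector sym \<Rightarrow> 'w::graded_real_vector) \<Rightarrow> ('v sym \<Rightarrow> 'w sym) \<Rightarrow> 'v sym \<Rightarrow> 'w sym" where
  "conv h f = cop (\<lambda>a b. lmul (h a) (f b))"

text \<open>Coefficient of t^k in the morphism law for F_t; the sum is a Cauchy product.\<close>

definition comult_at :: "(nat \<Rightarrow> 'v::graded_real_vector sym \<Rightarrow> 'w::graded_real_vector sym) \<Rightarrow> nat \<Rightarrow> bool" where
  "comult_at F k \<longleftrightarrow>
     (\<forall>x. coproduct (F k x) = (\<Sum>i\<le>k. tensor_map (F i) (F (k - i)) (coproduct x)))"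

text \<open>Signs depend only on parity, so one notion covers \<open>h\<close> of degree -1 and the
  corestriction of \<open>Q\<close> of degree 1.\<close>

definition odd_map :: "('v::graded_real_vector \<Rightarrow> 'w::graded_real_vector) \<Rightarrow> bool" where
  "odd_map h \<longleftrightarrow> linear h \<and> (\<forall>a. h (grade_involution a) = - grade_involution (h a))"

definition even_map :: "('v::graded_real_vector \<Rightarrow> 'w::graded_real_vector) \<Rightarrow> bool" where
  "even_map h \<longleftrightarrow> linear h \<and> (\<forall>a. h (grade_involution a) = grade_involution (h a))"

lemma word_zero_Cons: "word (0 # vs) = 0"
  using gsym_zero[OF gsym_word, of "[]"] by simp

lemma bilinear_conv:
  assumes "linear h" "linear f"
  shows "bilinear (\<lambda>a b. lmul (h a) (f b))"
  by (intro bilinearI bilinear_comp[OF bilinear_letter_mult] assms)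

lemma linear_conv: "linear h \<Longrightarrow> linear f \<Longrightarrow> linear (conv h f)"
  unfolding conv_def by (intro linear_cop bilinear_conv)

lemma comult_at_cop:
  assumes "comult_at F k" "bilinear b"
  shows "cop b (F k x) = (\<Sum>i\<le>k. cop (\<lambda>a c. b (F i a) (F (k - i) c)) x)"
  using assms
  by (simp add: comult_at_def cop_def[of b] linear_sum[OF linear_tensor_lift] cop_tensor_map
      linear_apply_cop[OF linear_tensor_lift] tensor_lift_tens)

text \<open>After expansion by \<open>cop_lmul\<close>, a factor \<open>h a\<close> that stays left
  is regrouped by coassociativity alone. One that moves right also needs cocommutativity to restore
  the order of the arguments; since \<open>h\<close> is odd, the flip then leaves just one
  \<open>grade_involution\<close>. The first \<open>cop\<close> collects the terms with a bare
  letter on one side.\<close>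

lemma cop_conv:
  assumes h: "odd_map h"
    and F: "\<And>i. i \<le> k \<Longrightarrow> even_map (F i)" and com: "comult_at F k"
    and b: "bilinear b"
  shows "cop b (conv h (F k) x)
    = cop (\<lambda>a c. b (word [h a]) (F k c) + b (F k (grade_involution a)) (word [h c])) x
    + (\<Sum>i\<le>k. cop (\<lambda>a c. b (conv h (F i) a) (F (k - i) c)
                  + b (F i (grade_involution a)) (conv h (F (k - i)) c)) x)"
proof -
  let ?J = grade_involution
  have h': "linear h" "h (?J a) = - ?J (h a)" for a using h by (auto simp: odd_map_def)
  have F': "linear (F i)" "F i (?J a) = ?J (F i a)" if "i \<le> k" for i a
    using F[OF that] by (auto simp: even_map_def)
  have Fk: "linear (F i)" "linear (F (k - i))" if "i \<in> {..k}" for i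
    using F'[of i] F'[of "k - i"] that by auto
  have linear_lmul_left: "linear (\<lambda>u. lmul u c)" for c :: "'b sym"
    by (rule bilinear_comp(1)[OF bilinear_letter_mult linear_ident])
  note lin = bilinear_comp[OF b] bilinear_comp[OF bilinear_letter_mult] linear_comp[OF linear_letter]
    linear_comp[OF h'(1)] linear_parts_comp linear_compose_add linear_ident

  have bl: "bilinear (\<lambda>a c. b (lmul v a) c + b a (lmul (even_part v) c)
          + b (?J a) (lmul (odd_part v) c))" for v
    by (intro bilinearI lin)
  have parts: "even_part v = (1/2) *\<^sub>R (v + ?J v)" "odd_part v = (1/2) *\<^sub>R (v - ?J v)" for v :: 'b
  proof -
    have "v + ?J v = 2 *\<^sub>R even_part v" "v - ?J v = 2 *\<^sub>R odd_part v"
      unfolding grade_involution_parts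
      by (subst (1) even_plus_odd[symmetric], simp add: scaleR_2)+
    then show "even_part v = (1/2) *\<^sub>R (v + ?J v)" "odd_part v = (1/2) *\<^sub>R (v - ?J v)" by simp_all
  qed
  \<comment> \<open>Rewriting the parity split of \<open>h a\<close> through \<open>a\<close> and
    its involution gives the four terms of a Koszul flip; the minus sign of the odd \<open>h\<close>
    puts an involution on the other argument.\<close>
  have flip: "b y (m (even_part (h a))) + b (?J y) (m (odd_part (h a)))
      = (1/2) *\<^sub>R (b y (m (h a)) - b y (m (h (?J a))) + b (?J y) (m (h a)) + b (?J y) (m (h (?J a))))"
    if m: "linear m" for m :: "'b \<Rightarrow> 'b sym" and y a
  proof -
    note b2 = bilinear_comp(2)[OF b m]
    have *: "b y (m (c *\<^sub>R u)) = c *\<^sub>R b y (m u)" "b y (m (u + v)) = b y (m u) + b y (m v)"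
      "b y (m (u - v)) = b y (m u) - b y (m v)" "b y (m (- v)) = - b y (m v)" for c u v y
      by (rule linear_scale[OF b2] linear_add[OF b2] linear_diff[OF b2] linear_neg[OF b2])+
    show ?thesis by (simp add: parts h' * scaleR_add_right scaleR_diff_right)
  qed

  have "cop b (conv h (F k) x) = cop (\<lambda>a c. cop b (lmul (h a) (F k c))) x"
    unfolding conv_def by (rule linear_apply_cop[OF linear_cop[OF b]])
  also have "\<dots> = cop (\<lambda>a c. b (word [h a]) (F k c)) x
     + cop (\<lambda>a c. b (F k c) (word [even_part (h a)]) + b (?J (F k c)) (word [odd_part (h a)])) x
     + cop (\<lambda>a c. cop (\<lambda>c d. b (lmul (h a) c) d + (b c (lmul (even_part (h a)) d)
          + b (?J c) (lmul (odd_part (h a)) d))) (F k c)) x"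
    unfolding cop_lmul[OF b] by (simp add: add.assoc flip: cop_add)
  also have "cop (\<lambda>a c. b (F k c) (word [even_part (h a)]) + b (?J (F k c)) (word [odd_part (h a)])) x
     = cop (\<lambda>a c. b (F k (?J a)) (word [h c])) x"
  proof -
    have "bilinear (\<lambda>a c. b (F k (?J a)) (word [h c]))"
      by (intro bilinearI lin linear_comp[OF F'(1)] h'(1)) simp_all
    from cop_cocomm[OF this] show ?thesis
      by (simp add: koszul_flip_def flip[OF linear_letter] F' algebra_simps)
  qed
  also have "cop (\<lambda>a c. cop (\<lambda>c d. b (lmul (h a) c) d + (b c (lmul (even_part (h a)) d)
          + b (?J c) (lmul (odd_part (h a)) d))) (F k c)) x
     = (\<Sum>i\<le>k. cop (\<lambda>a c. cop (\<lambda>c d. b (lmul (h a) (F i c)) (F (k - i) d)) c) x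
            + cop (\<lambda>a c. cop (\<lambda>c d. b (F i c) (lmul (even_part (h a)) (F (k - i) d))
               + b (?J (F i c)) (lmul (odd_part (h a)) (F (k - i) d))) c) x)"
    unfolding add.assoc[symmetric] comult_at_cop[OF com bl] cop_sum
    unfolding add.assoc cop_add ..
  also have "\<dots> = (\<Sum>i\<le>k. cop (\<lambda>a c. b (conv h (F i) a) (F (k - i) c)) x
                       + cop (\<lambda>a c. b (F i (?J a)) (conv h (F (k - i)) c)) x)"
  proof (intro sum.cong refl arg_cong2[where f = "(+)"])
    fix i assume i: "i \<in> {..k}"
    note li = lin linear_comp[OF Fk(1)[OF i]] linear_comp[OF Fk(2)[OF i]] h'(1) Fk[OF i]
    have "trilinear (\<lambda>a c d. b (lmul (h a) (F i c)) (F (k - i) d))"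
      unfolding trilinear_def by (intro conjI allI li)
    from cop_coassoc[OF this, symmetric]
    show "cop (\<lambda>a c. cop (\<lambda>c d. b (lmul (h a) (F i c)) (F (k - i) d)) c) x
        = cop (\<lambda>a c. b (conv h (F i) a) (F (k - i) c)) x"
      using b by (simp add: conv_def linear_apply_cop[of "\<lambda>x. b x c" for c] bilinear_def)
    \<comment> \<open>\<open>?T\<close> carries the sign of \<open>h a\<close> passing
      \<open>c\<close>, \<open>?S\<close> is the target with these arguments exchanged.
      Coassociativity groups the two arguments, the flip exchanges them, coassociativity
      regroups.\<close>
    let ?T = "\<lambda>a c d. b (F i c) (lmul (even_part (h a)) (F (k - i) d))
               + b (?J (F i c)) (lmul (odd_part (h a)) (F (k - i) d))"
    let ?S = "\<lambda>c a d. b (F i (?J c)) (lmul (h a) (F (k - i) d))"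
    have T: "trilinear ?T"
      unfolding trilinear_def by (intro conjI allI li)
    have S: "trilinear ?S"
      unfolding trilinear_def by (intro conjI allI li)
    have "koszul_flip ?J (\<lambda>c a. ?S c a d) = (\<lambda>a c. ?T a c d)" for d
      using i unfolding koszul_flip_def flip[OF linear_lmul_left]
      by (simp add: F' algebra_simps)
    then have "cop (\<lambda>a c. ?T a c d) y = cop (\<lambda>c a. ?S c a d) y" for d y
      using cop_cocomm[OF trilinearD(4)[OF S]] by simp
    then have "cop (\<lambda>a c. cop (\<lambda>c d. ?T a c d) c) x = cop (\<lambda>c d. cop (\<lambda>c a. ?S c a d) c) x"
      using cop_coassoc[OF T, of x] by simp
    also have "\<dots> = cop (\<lambda>c e. cop (\<lambda>a d. ?S c a d) e) x"
      by (rule cop_coassoc[OF S])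
    also have "\<dots> = cop (\<lambda>a c. b (F i (?J a)) (conv h (F (k - i)) c)) x"
      using b by (simp add: conv_def linear_apply_cop[of "b y" for y] bilinear_def)
    finally show "cop (\<lambda>a c. cop (\<lambda>c d. ?T a c d) c) x = cop (\<lambda>a c. b (F i (?J a)) (conv h (F (k - i)) c)) x" .
  qed
  finally show ?thesis by (simp add: cop_add add.assoc)
qed

text \<open>Coefficient of t^k in K_t. The letter \<open>word [h x]\<close> is the term with empty
  remainder that \<open>conv\<close> omits; \<open>h\<close> is constant in t, so it occurs only for
  \<open>k = 0\<close>.\<close>

definition homotopy ::
    "('v::graded_real_vector sym \<Rightarrow> 'w::graded_real_vector) \<Rightarrow> (nat \<Rightarrow> 'v sym \<Rightarrow> 'w sym) \<Rightarrow> nat \<Rightarrow> 'v sym \<Rightarrow> 'w sym" where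
  "homotopy h F k x = (if k = 0 then word [h x] else 0) + conv h (F k) x"

lemma linear_homotopy:
  assumes "linear h" "linear (F k)"
  shows "linear (homotopy h F k)"
proof -
  have "linear (\<lambda>x. (if k = 0 then word [h x] else 0) + conv h (F k) x)"
    by (intro linear_compose_add linear_conv assms)
      (cases "k = 0"; simp add: linear_comp[OF linear_letter assms(1)] linear_zero)
  then show ?thesis by (simp add: homotopy_def[abs_def])
qed

text \<open>A letter is primitive and adds nothing on the left; on the right it supplies, at i = 0
  and i = k, exactly the two bare-letter terms of \<open>cop_conv\<close>.\<close>

lemma cop_homotopy:
  assumes h: "odd_map h"
    and F: "\<And>i. i \<le> k \<Longrightarrow> even_map (F i)" and com: "comult_at F k"
    and b: "bilinear b"
  shows "cop b (homotopy h F k x)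
    = (\<Sum>i\<le>k. cop (\<lambda>a c. b (homotopy h F i a) (F (k - i) c)
                  + b (F i (grade_involution a)) (homotopy h F (k - i) c)) x)"
proof -
  let ?d = "\<lambda>k x. if k = (0::nat) then word [h x] else 0"
  have "cop b (homotopy h F k x) = cop b (conv h (F k) x)"
    by (simp add: homotopy_def linear_add[OF linear_cop[OF b]] cop_letter[OF b] linear_0[OF linear_cop[OF b]])
  moreover have "(\<Sum>i\<le>k. cop (\<lambda>a c. b (?d i a) (F (k - i) c)) x) = cop (\<lambda>a c. b (word [h a]) (F k c)) x"
  proof -
    have "(\<Sum>i\<le>k. cop (\<lambda>a c. b (?d i a) (F (k - i) c)) x)
        = (\<Sum>i\<in>{0}. cop (\<lambda>a c. b (?d i a) (F (k - i) c)) x)"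
      by (rule sum.mono_neutral_right) (auto simp: bilinear_lzero[OF b] cop_zero)
    then show ?thesis by simp
  qed
  moreover have "(\<Sum>i\<le>k. cop (\<lambda>a c. b (F i (grade_involution a)) (?d (k - i) c)) x)
      = cop (\<lambda>a c. b (F k (grade_involution a)) (word [h c])) x"
  proof -
    have "(\<Sum>i\<le>k. cop (\<lambda>a c. b (F i (grade_involution a)) (?d (k - i) c)) x)
        = (\<Sum>i\<in>{k}. cop (\<lambda>a c. b (F i (grade_involution a)) (?d (k - i) c)) x)"
      by (rule sum.mono_neutral_right) (auto simp: bilinear_rzero[OF b] cop_zero)
    then show ?thesis by simp
  qed
  moreover have "(\<Sum>i\<le>k. cop (\<lambda>a c. b (homotopy h F i a) (F (k - i) c)
                  + b (F i (grade_involution a)) (homotopy h F (k - i) c)) x)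
      = ((\<Sum>i\<le>k. cop (\<lambda>a c. b (?d i a) (F (k - i) c)) x)
        + (\<Sum>i\<le>k. cop (\<lambda>a c. b (F i (grade_involution a)) (?d (k - i) c)) x))
        + (\<Sum>i\<le>k. cop (\<lambda>a c. b (conv h (F i) a) (F (k - i) c)
                  + b (F i (grade_involution a)) (conv h (F (k - i)) c)) x)"
    unfolding homotopy_def bilinear_ladd[OF b] bilinear_radd[OF b] cop_add sum.distrib
    by (simp only: add_ac)
  ultimately show ?thesis
    by (simp only: cop_conv[OF h F com b] cop_add)
qed

section \<open>Coderivations\<close>

text \<open>The case F_t = id, so that the co-Leibniz rule is an instance of
  \<open>cop_homotopy\<close>.\<close>

definition coder ::
    "('v::graded_real_vector sym \<Rightarrow> 'v) \<Rightarrow> 'v sym \<Rightarrow> 'v sym" where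
  "coder q = homotopy q (\<lambda>_. id) 0"

lemma unshuffles_eq_0:
  assumes "\<And>A B. length A + length B = length vs \<Longrightarrow> g A B = 0"
  shows "unshuffles vs g = 0"
  using assms
proof (induction vs arbitrary: g)
  case (Cons v vs)
  have "unshuffles vs (put_left v g) = 0" "unshuffles vs (put_right v g) = 0"
    by (rule Cons.IH, simp add: put_left_def put_right_def Cons.prems)+
  then show ?case by simp
qed simp

lemma unshuffles_cong:
  assumes "\<And>A B. length A + length B = length vs \<Longrightarrow> f A B = g A B"
  shows "unshuffles vs f = unshuffles vs g"
proof -
  have "unshuffles vs (\<lambda>A B. f A B + (-1) *\<^sub>R g A B) = 0"
    by (rule unshuffles_eq_0) (simp add: assms)
  then show ?thesis
    unfolding unshuffles_add unshuffles_scaleR by simp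
qed

lemma linear_coder: "linear q \<Longrightarrow> linear (coder q)"
  unfolding coder_def by (rule linear_homotopy) (simp_all add: linear_id)

lemma coder_word:
  assumes "linear q"
  shows "coder q (word vs) = unshuffles vs (\<lambda>A B. word (q (word A) # B))"
proof -
  have eq: "(\<lambda>A B. word (q (word A) # B))
      = (\<lambda>A B. (if B = [] then word [q (word A)] else 0) + lmul (q (word A)) (word B))"
    by (simp add: lmul_word fun_eq_iff)
  show ?thesis
    unfolding eq by (simp add: coder_def homotopy_def conv_def cop_word bilinear_conv[OF assms linear_ident]
        unshuffles_add unshuffles_right_empty)
qed

lemma cop_coder:
  assumes "odd_map q" "bilinear b"
  shows "cop b (coder q x)
    = cop (\<lambda>a c. b (coder q a) c + b (grade_involution a) (coder q c)) x"
proof -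
  have "comult_at (\<lambda>_. id :: 'a sym \<Rightarrow> _) 0"
    by (simp add: comult_at_def cop_tensor_map cop_tens)
  then show ?thesis
    using cop_homotopy[where F = "\<lambda>_. id :: 'a sym \<Rightarrow> _" and k = 0, OF assms(1) _ _ assms(2)]
    by (simp add: coder_def even_map_def linear_id)
qed

text \<open>Either \<open>q\<close> consumes the first letter, or the letter is moved back to the
  front past the output of \<open>q\<close>, where its odd part picks up the parity sign
  \<open>s\<close>: 1 for \<open>pr\<close>, -1 for an odd \<open>q\<close>.\<close>

lemma coder_word_Cons:
  assumes q: "linear q" and sgn: "\<And>a. q (grade_involution a) = s *\<^sub>R grade_involution (q a)"
  shows "coder q (word (v # vs)) = unshuffles vs (\<lambda>A B. word (q (word (v # A)) # B))
    + lmul (even_part v + s *\<^sub>R odd_part v) (coder q (word vs))"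
proof -
  have "word (q (word A) # even_part v # B)
      + word (q (word (map grade_involution A)) # odd_part v # B)
      = lmul (even_part v + s *\<^sub>R odd_part v) (word (q (word A) # B))" for A B
  proof -
    let ?v = "even_part v + s *\<^sub>R odd_part v"
    have ev: "even_part ?v = even_part v" "odd_part ?v = s *\<^sub>R odd_part v"
      by (simp_all add: linear_add[OF linear_parts(1)] linear_add[OF linear_parts(2)]
          linear_scale[OF linear_parts(1)] linear_scale[OF linear_parts(2)])
    have "word (grade_involution (q (word A)) # s *\<^sub>R odd_part v # B)
        = word (s *\<^sub>R grade_involution (q (word A)) # odd_part v # B)"
      by (simp add: gsymD(3)[OF gsym_word, of "[]", simplified]
          gsymD(3)[OF gsym_word, of "[u]" for u, simplified])
    then show ?thesis
      using word_swap[of "q (word A)" ?v B]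
      by (simp add: ev lmul_word sgn flip: grade_involution_word)
  qed
  then show ?thesis
    by (simp add: coder_word[OF q] put_left_def put_right_def unshuffles_linear[OF linear_lmul])
qed

lemma word_letter_unshuffles:
  "unshuffles vs (\<lambda>A B. if A = [] then f (word (v # B)) else 0) = f (word (v # vs))" if "linear f"
  using unshuffles_left_empty[OF gsym_Cons[OF gsym_linear_word[OF that], of v]] by simp

section \<open>Primitive elements\<close>

lemma pr_grade_involution: "pr (grade_involution x) = grade_involution (pr x)"
proof (rule linear_eq_on_words[of "\<lambda>x. pr (grade_involution x)"])
  show "pr (grade_involution (word vs)) = grade_involution (pr (word vs))" for vs :: "'a list"
    by (simp add: grade_involution_word pr_word linear_0[OF linear_grade_involution] split: list.split)
qed (intro linear_comp[OF linear_pr] linear_comp[OF linear_grade_involution]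
    linear_grade_involution linear_pr)+

text \<open>In characteristic 0 this Euler coderivation is injective, and it factors through \<open>pr\<close>
  on primitive elements.\<close>

lemma coder_pr_word: "coder pr (word vs) = real (length vs) *\<^sub>R word vs"
proof (induction vs)
  case Nil
  then show ?case using linear_0[OF linear_coder[OF linear_pr]] by simp
next
  case (Cons v vs)
  have "word (pr (word (v # A)) # B) = (if A = [] then word (v # B) else 0)" for A B
    by (cases A) (simp_all add: pr_word word_zero_Cons)
  then have "unshuffles vs (\<lambda>A B. word (pr (word (v # A)) # B)) = word (v # vs)"
    using word_letter_unshuffles[of "\<lambda>x. x" vs v] by (simp add: linear_ident)
  then show ?case
    using coder_word_Cons[of pr 1 v vs] Cons.IH
    by (simp add: linear_pr pr_grade_involution even_plus_odd linear_scale[OF linear_lmul]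
        lmul_word scaleR_add_left)
qed

text \<open>On a primitive element the Euler coderivation leaves only the letter
  \<open>pr y\<close>, and dividing by word length inverts that coderivation.\<close>

lemma primitive_eq_letter:
  assumes "coproduct y = 0"
  shows "y = word [pr y]"
proof -
  \<comment> \<open>Division by length 0 gives 0, in agreement with
    \<open>word [] = 0\<close>.\<close>
  let ?f = "\<lambda>vs :: 'a list. (1 / real (length vs)) *\<^sub>R word vs"
  have g: "gsym ?f"
  proof (rule gsymI)
    fix us vs :: "'a list" and x y :: 'a and k l :: int
    assume "x \<in> grade k" "y \<in> grade l"
    from gsymD(4)[OF gsym_word this, of us vs]
    show "?f (us @ x # y # vs) = (-1) powi (k * l) *\<^sub>R ?f (us @ y # x # vs)"
      by (simp only: scaleR_left_commute length_append length_Cons)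
  qed (simp_all add: gsymD(2,3)[OF gsym_word] scaleR_add_right)
  define E where "E = sym_lift ?f"
  have E: "linear E" "E (word vs) = ?f vs" for vs
    unfolding E_def using sym_lift[OF g] by simp_all
  have "E (coder pr y) = y" for y
  proof (rule linear_eq_on_words[where x = y])
    show "E (coder pr (word vs)) = word vs" for vs
      by (cases "vs = []") (simp_all add: coder_pr_word linear_scale[OF E(1)] linear_0[OF E(1)] E(2)
          linear_0[OF linear_coder[OF linear_pr]])
  qed (intro linear_comp[OF E(1)] linear_coder linear_pr linear_ident)+
  moreover have "coder pr y = word [pr y]"
    using assms linear_0[OF linear_tensor_lift[OF bilinear_conv[OF linear_pr linear_ident]]]
    by (simp add: coder_def homotopy_def conv_def cop_def)
  ultimately show ?thesis by (metis E(2) One_nat_def div_by_1 length_Cons list.size(3) of_nat_1 scaleR_one)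
qed

lemma pr_lmul: "pr (lmul v w) = 0"
proof (rule linear_eq_on_words[where x = w])
  show "pr (lmul v (word vs)) = 0" for vs :: "'a list"
    by (cases vs) (simp_all add: lmul_word pr_word linear_0[OF linear_pr] linear_0[OF linear_lmul])
qed (intro linear_comp[OF linear_pr] linear_lmul linear_zero)+

lemma pr_conv: "pr (conv h f x) = 0"
  by (simp add: conv_def linear_apply_cop[OF linear_pr] pr_lmul cop_zero)

lemma pr_homotopy: "pr (homotopy h F k x) = (if k = 0 then h x else 0)"
  by (simp add: homotopy_def linear_add[OF linear_pr] pr_conv pr_word linear_0[OF linear_pr])

lemma has_degree_pr: "has_degree 0 pr"
  by (rule has_degree_symI[OF linear_pr])
    (auto simp: pr_word homogeneous_list_Cons split: list.split)

text \<open>The difference \<open>?R\<close> is again a coderivation, with zero corestriction. By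
  induction on length its values on words are primitive, hence letters, hence 0.\<close>

lemma coderivation_eq_coder:
  assumes "degree_one_coderivation Q"
  shows "odd_map (\<lambda>x. pr (Q x))" and "Q = coder (\<lambda>x. pr (Q x))"
proof -
  have Q: "linear Q" "has_degree 1 Q"
    and coQ: "coproduct (Q x) = cop (\<lambda>a c. Q a \<otimes> c) x + cop (\<lambda>a c. grade_involution a \<otimes> Q c) x" for x
    using assms by (simp_all add: degree_one_coderivation_def cop_tensor_map)
  let ?q = "\<lambda>x. pr (Q x)"
  show q: "odd_map ?q"
    using has_degree_grade_involution[OF Q]
    by (simp add: odd_map_def linear_comp[OF linear_pr] Q pr_grade_involution linear_neg[OF linear_pr])
  then have lq: "linear ?q" by (simp add: odd_map_def)
  let ?R = "\<lambda>x. Q x - coder ?q x"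
  have R: "linear ?R" by (intro linear_compose_sub Q linear_coder lq)
  have b: "bilinear (\<lambda>a c. ?R a \<otimes> c + grade_involution a \<otimes> ?R c)"
    by (intro bilinearI linear_compose_add bilinear_comp[OF bilinear_tens] R
        linear_ident linear_grade_involution)
  have coR: "coproduct (?R x) = cop (\<lambda>a c. ?R a \<otimes> c + grade_involution a \<otimes> ?R c) x" for x
  proof -
    have "coproduct (coder ?q x)
        = cop (\<lambda>a c. coder ?q a \<otimes> c + grade_involution a \<otimes> coder ?q c) x"
      using cop_coder[OF q bilinear_tens] by (simp add: cop_tens)
    moreover have "Q a \<otimes> c + grade_involution a \<otimes> Q c
        = (?R a \<otimes> c + grade_involution a \<otimes> ?R c)
          + (coder ?q a \<otimes> c + grade_involution a \<otimes> coder ?q c)" for a c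
      by (simp add: bilinear_lsub[OF bilinear_tens] bilinear_rsub[OF bilinear_tens])
    ultimately show ?thesis
      unfolding linear_diff[OF linear_coproduct] coQ cop_add[symmetric] by (simp add: cop_add)
  qed
  have "?R (word vs) = 0" for vs
  proof (induction vs rule: length_induct)
    case (1 vs)
    have "coproduct (?R (word vs)) = 0"
      unfolding coR cop_word[OF b]
    proof (rule unshuffles_eq_0)
      fix A B :: "'a list" assume len: "length A + length B = length vs"
      consider "A = []" | "B = []" | "length A < length vs" "length B < length vs"
        using len by (cases A; cases B) auto
      then show "?R (word A) \<otimes> word B + grade_involution (word A) \<otimes> ?R (word B) = 0"
      proof cases
        case 3
        with 1 have "?R (word A) = 0" "?R (word B) = 0" by blast+
        then show ?thesis by (simp only: tens_zero add_0)
      qed (simp_all add: linear_0[OF Q(1)] linear_0[OF linear_coder[OF lq]]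
            linear_0[OF linear_grade_involution])
    qed
    from primitive_eq_letter[OF this] show ?case
      by (simp add: linear_diff[OF linear_pr] coder_def pr_homotopy word_zero_Cons)
  qed
  then have R0: "?R x = 0" for x
    using linear_eq_on_words[OF R linear_zero] by blast
  show "Q = coder ?q"
    by (rule ext) (rule iffD2[OF eq_iff_diff_eq_0 R0])
qed

section \<open>Word length and leading terms of a coderivation\<close>

text \<open>\<open>q\<close> replaces a nonempty block by one letter, so no word gets
  longer.\<close>

lemma vanish_coder_word:
  assumes q: "linear q" and f: "linear f"
    and "\<And>us. length us \<le> length vs \<Longrightarrow> f (word us) = 0"
  shows "f (coder q (word vs)) = 0"
  unfolding coder_word[OF q] unshuffles_linear[OF f]
proof (rule unshuffles_eq_0)
  fix A B :: "'a list" assume "length A + length B = length vs"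
  then show "f (word (q (word A) # B)) = 0"
    by (cases A) (auto simp: linear_0[OF q] linear_0[OF f] word_zero_Cons intro: assms(3))
qed

text \<open>Replacing two or more letters by one shortens the word and is invisible to
  \<open>f\<close>; only \<open>q\<close> on single letters remains, signed by the letters it
  passes.\<close>

lemma leading_term_coder:
  assumes q: "odd_map q" and f: "linear f" and hom: "homogeneous_list ks vs"
    and short: "\<And>us. length us < length vs \<Longrightarrow> f (word us) = 0"
  shows "f (coder q (word vs))
    = (\<Sum>i<length vs. (-1) powi (\<Sum>j<i. ks ! j) *\<^sub>R f (word (vs[i := q (word [vs ! i])])))"
  using f hom short
proof (induction vs arbitrary: f ks)
  case Nil
  have "linear (coder q)" using q by (simp add: odd_map_def linear_coder)
  then show ?case by (simp add: linear_0 linear_0[OF Nil(1)])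
next
  case (Cons v vs)
  then obtain k ks' where ks: "ks = k # ks'" "v \<in> grade k" "homogeneous_list ks' vs"
    by (auto simp: homogeneous_list_Cons)
  have lq: "linear q" and sgn: "q (grade_involution a) = (-1) *\<^sub>R grade_involution (q a)" for a
    using q by (simp_all add: odd_map_def)
  have inv: "even_part v + (-1) *\<^sub>R odd_part v = (-1) powi k *\<^sub>R v"
    using ks(2) by (simp add: parts_homogeneous sign_int)
  \<comment> \<open>Multiplication by \<open>v\<close> is absorbed into the functional, which again
    kills shorter words.\<close>
  let ?f = "\<lambda>x. (-1) powi k *\<^sub>R f (lmul v x)"
  have lf: "linear ?f"
    by (intro linear_compose_scale_right linear_comp[OF Cons.prems(1)] linear_lmul)
  have "unshuffles vs (\<lambda>A B. f (word (q (word (v # A)) # B)))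
      = unshuffles vs (\<lambda>A B. if A = [] then f (word (q (word [v]) # B)) else 0)"
  proof (rule unshuffles_cong)
    fix A B :: "'a list" assume "length A + length B = length vs"
    then show "f (word (q (word (v # A)) # B)) = (if A = [] then f (word (q (word [v]) # B)) else 0)"
      using Cons.prems(3) by (cases A) auto
  qed
  also have "\<dots> = f (word (q (word [v]) # vs))"
    by (rule word_letter_unshuffles[OF Cons.prems(1)])
  finally have "f (coder q (word (v # vs))) = f (word (q (word [v]) # vs)) + ?f (coder q (word vs))"
    unfolding coder_word_Cons[OF lq sgn] inv
    by (simp add: linear_add[OF Cons.prems(1)] unshuffles_linear[OF Cons.prems(1)]
        bilinear_lmul[OF bilinear_letter_mult] linear_scale[OF Cons.prems(1)])
  also have "?f (coder q (word vs)) = (\<Sum>i<length vs. (-1) powi (\<Sum>j<i. ks' ! j) *\<^sub>R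
      ?f (word (vs[i := q (word [vs ! i])])))"
  proof (rule Cons.IH[OF lf ks(3)])
    fix us :: "'a list" assume "length us < length vs"
    then show "?f (word us) = 0"
      using Cons.prems(3)[of "v # us"] by (simp add: lmul_word linear_0[OF Cons.prems(1)])
  qed
  also have "\<dots> = (\<Sum>i<length vs. (-1) powi (k + (\<Sum>j<i. ks' ! j)) *\<^sub>R
      f (word (v # vs[i := q (word [vs ! i])])))"
  proof (rule sum.cong[OF refl])
    fix i assume "i \<in> {..<length vs}"
    then have "vs[i := q (word [vs ! i])] \<noteq> []" by auto
    then show "(-1) powi (\<Sum>j<i. ks' ! j) *\<^sub>R ?f (word (vs[i := q (word [vs ! i])]))
        = (-1) powi (k + (\<Sum>j<i. ks' ! j)) *\<^sub>R f (word (v # vs[i := q (word [vs ! i])]))"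
      by (simp add: lmul_word power_int_add mult.commute)
  qed
  finally show ?case
    unfolding list.size add_0_right add_Suc_right sum.lessThan_Suc_shift
    by (simp add: ks(1) sum.lessThan_Suc_shift)
qed

section \<open>The flow of a homotopy\<close>

lemma even_map_degree: "linear f \<Longrightarrow> has_degree 0 f \<Longrightarrow> even_map f"
  using has_degree_grade_involution[of f 0] by (simp add: even_map_def)

lemma odd_map_degree: "linear f \<Longrightarrow> has_degree (-1) f \<Longrightarrow> odd_map f"
  using has_degree_grade_involution[of f "-1"] by (simp add: odd_map_def)

lemma coderivation_grade_involution:
  assumes "degree_one_coderivation Q"
  shows "Q (grade_involution x) = - grade_involution (Q x)"
  using assms has_degree_grade_involution[of Q 1] by (simp add: degree_one_coderivation_def)

lemma cop_coderivation:
  assumes "degree_one_coderivation Q" "bilinear b"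
  shows "cop b (Q x) = cop (\<lambda>a c. b (Q a) c + b (grade_involution a) (Q c)) x"
  using assms
  by (simp add: degree_one_coderivation_def cop_def[of b] linear_add[OF linear_tensor_lift]
      cop_tensor_map linear_apply_cop[OF linear_tensor_lift] tensor_lift_tens cop_add)

lemma has_degree_homotopy:
  assumes h: "linear h" "has_degree (-1) h" and F: "linear (F k)" "has_degree 0 (F k)"
  shows "has_degree (-1) (homotopy h F k)"
proof -
  have "homotopy h F k x \<in> grade (j - 1)" if x: "x \<in> grade j" for x j
  proof -
    have "lmul (h a) (F k b) \<in> grade (i + l + (-1))" if "a \<in> grade i" "b \<in> grade l" for a b i l
    proof -
      have "h a \<in> grade (i - 1)" "F k b \<in> grade l"
        using that h(2) F(2) by (auto simp: has_degree_def)
      from lmul_in_grade[OF this] show ?thesis by (simp add: algebra_simps)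
    qed
    from cop_in_grade[OF bilinear_conv[OF h(1) F(1)] this x]
    have "conv h (F k) x \<in> grade (j - 1)" by (simp add: conv_def)
    moreover have "word [h x] \<in> grade (j - 1)"
      using word_in_grade[of "[j - 1]" "[h x]"] h(2) x by (auto simp: has_degree_def homogeneous_list_Cons)
    ultimately show ?thesis by (simp add: homotopy_def grade_add)
  qed
  then show ?thesis by (simp add: has_degree_def)
qed

locale homotopy_flow =
  fixes Q :: "'a::graded_real_vector bar \<Rightarrow> 'a bar"
    and Q' :: "'b::graded_real_vector bar \<Rightarrow> 'b bar"
    and F :: "'a bar \<Rightarrow> 'b bar"
    and h :: "'a bar \<Rightarrow> 'b desusp"
    and n :: nat
  assumes Q: "L_infty_algebra Q" and Q': "L_infty_algebra Q'" and F: "L_infty_morphism Q Q' F"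
    and h: "linear h" "has_degree (-1) h" and h_word: "\<And>us. length us \<noteq> n \<Longrightarrow> h (word us) = 0"
begin

text \<open>The Taylor coefficients at \<open>t = 0\<close> of the solution of
  $\dot F_t = Q' K_t + K_t Q$, where $K_t$ is the $F_t$-coderivation with corestriction \<open>h\<close>.\<close>

primrec flow :: "nat \<Rightarrow> 'a bar \<Rightarrow> 'b bar" where
  "flow 0 = F"
| "flow (Suc k) = (\<lambda>x. (1 / real (Suc k)) *\<^sub>R
     (Q' (homotopy h (\<lambda>_. flow k) k x) + homotopy h (\<lambda>_. flow k) k (Q x)))"

abbreviation K :: "nat \<Rightarrow> 'a bar \<Rightarrow> 'b bar" where
  "K \<equiv> homotopy h flow"

text \<open>\<open>homotopy\<close> consults its family only at index k, so the constant family in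
  the recursion may be replaced by \<open>flow\<close>.\<close>

lemma flow_Suc: "flow (Suc k) x = (1 / real (Suc k)) *\<^sub>R (Q' (K k x) + K k (Q x))"
  by (simp add: flow.simps(2) homotopy_def)

declare flow.simps(2) [simp del]

lemma Q_props: "linear Q" "has_degree 1 Q" "Q (Q x) = 0" "degree_one_coderivation Q"
  and Q'_props: "linear Q'" "has_degree 1 Q'" "Q' (Q' y) = 0" "degree_one_coderivation Q'"
  using Q Q' by (auto simp: L_infty_algebra_def degree_one_coderivation_def)

lemma linear_K: "linear (flow k) \<Longrightarrow> linear (K k)"
  by (intro linear_homotopy h)

text \<open>Strong induction, because the coproduct law at one order involves all lower orders;
  there the differential law at lower orders cancels the mixed terms.\<close>

lemma flow_invariants:
  "linear (flow k) \<and> has_degree 0 (flow k) \<and> comult_at flow k \<and> (\<forall>x. Q' (flow k x) = flow k (Q x))"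
proof (induction k rule: less_induct)
  case (less k)
  show ?case
  proof (cases k)
    case 0
    then show ?thesis
      using F by (simp add: L_infty_morphism_def coalgebra_morphism_def comult_at_def)
  next
    case (Suc m)
    let ?J = grade_involution
    have IH: "linear (flow i)" "has_degree 0 (flow i)" "comult_at flow i" "Q' (flow i x) = flow i (Q x)"
      "even_map (flow i)" "flow i (?J x) = ?J (flow i x)" if "i \<le> m" for i x
      using less.IH[of i] that Suc even_map_degree[of "flow i"] by (auto simp: even_map_def)
    have K: "linear (K i)" "has_degree (-1) (K i)" "K i (?J x) = - ?J (K i x)" if "i \<le> m" for i x
      using linear_K[OF IH(1)[OF that]] has_degree_homotopy[where F = flow and k = i, OF h IH(1,2)[OF that]]
        has_degree_grade_involution[of "K i" "-1"] by simp_all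
    note linK = K(1)[OF order.refl]
    have lin: "linear (\<lambda>x. Q' (K m x) + K m (Q x))"
      by (intro linear_compose_add linear_comp[OF Q'_props(1)] linear_comp[OF linK] linK Q_props)
    have fS: "flow k = (\<lambda>x. (1 / real (Suc m)) *\<^sub>R (Q' (K m x) + K m (Q x)))"
      unfolding Suc by (rule ext) (rule flow_Suc)
    have "linear (flow k)"
      unfolding fS by (rule linear_compose_scale_right[OF lin])
    moreover have "has_degree 0 (flow k)"
      unfolding has_degree_def
    proof (intro allI ballI)
      fix j and x :: "'a bar" assume x: "x \<in> grade j"
      have "K m x \<in> grade (j - 1)" "Q x \<in> grade (j + 1)"
        using K(2)[OF order.refl] Q_props(2) x by (auto simp: has_degree_def)
      then have "Q' (K m x) \<in> grade j" "K m (Q x) \<in> grade j"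
        using K(2)[OF order.refl] Q'_props(2) by (force simp: has_degree_def)+
      then show "flow k x \<in> grade (j + 0)"
        by (simp only: fS grade_scaleR grade_add add_0_right)
    qed
    \<comment> \<open>As \<open>Q\<close> and \<open>Q'\<close> square to zero, both sides reduce to
      \<open>Q' (K m (Q x))\<close> divided by k.\<close>
    moreover have "Q' (flow k x) = flow k (Q x)" for x
      by (simp add: fS linear_scale[OF Q'_props(1)] linear_add[OF Q'_props(1)] Q_props Q'_props
          linear_0[OF linK])
    moreover have "comult_at flow k"
      unfolding comult_at_def
    proof
      fix x
      let ?b = "(\<otimes>) :: 'b bar \<Rightarrow> 'b bar \<Rightarrow> _"
      let ?D = "\<lambda>i x. Q' (K i x) + K i (Q x)"
      let ?G = "\<lambda>i. cop (\<lambda>a c. flow i a \<otimes> flow (k - i) c) x"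
      note bl = bilinear_comp[OF bilinear_tens] linear_compose_add linear_ident
        linear_comp[OF linear_grade_involution] linear_grade_involution
      have b1: "bilinear (\<lambda>a c. Q' a \<otimes> c + ?J a \<otimes> Q' c)"
        by (intro bilinearI bl Q'_props)
      have b2: "bilinear (\<lambda>a c. K i a \<otimes> flow (m - i) c + flow i (?J a) \<otimes> K (m - i) c)" if "i \<le> m" for i
        using that by (intro bilinearI bl linear_comp[OF IH(1)] IH K) simp_all
      have 1: "coproduct (Q' (K m x)) = (\<Sum>i\<le>m. cop (\<lambda>a c.
          Q' (K i a) \<otimes> flow (m - i) c + ?J (K i a) \<otimes> Q' (flow (m - i) c)
          + (Q' (flow i (?J a)) \<otimes> K (m - i) c + ?J (flow i (?J a)) \<otimes> Q' (K (m - i) c))) x)"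
        unfolding cop_tens[symmetric] cop_coderivation[OF Q'_props(4) bilinear_tens]
        by (rule cop_homotopy[OF odd_map_degree[OF h] IH(5) IH(3)[OF order.refl] b1])
      have "coproduct (K m (Q x)) = (\<Sum>i\<le>m. cop (\<lambda>a c. K i a \<otimes> flow (m - i) c
          + flow i (?J a) \<otimes> K (m - i) c) (Q x))"
        unfolding cop_tens[symmetric]
        by (rule cop_homotopy[OF odd_map_degree[OF h] IH(5) IH(3)[OF order.refl] bilinear_tens])
      also have "\<dots> = (\<Sum>i\<le>m. cop (\<lambda>a c.
          (K i (Q a) \<otimes> flow (m - i) c + flow i (?J (Q a)) \<otimes> K (m - i) c)
          + (K i (?J a) \<otimes> flow (m - i) (Q c) + flow i (?J (?J a)) \<otimes> K (m - i) (Q c))) x)"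
        by (intro sum.cong refl cop_coderivation[OF Q_props(4)] b2) simp
      finally have "coproduct (?D m x) = (\<Sum>i\<le>m. cop (\<lambda>a c.
          Q' (K i a) \<otimes> flow (m - i) c + ?J (K i a) \<otimes> Q' (flow (m - i) c)
          + (Q' (flow i (?J a)) \<otimes> K (m - i) c + ?J (flow i (?J a)) \<otimes> Q' (K (m - i) c))
          + ((K i (Q a) \<otimes> flow (m - i) c + flow i (?J (Q a)) \<otimes> K (m - i) c)
          + (K i (?J a) \<otimes> flow (m - i) (Q c) + flow i (?J (?J a)) \<otimes> K (m - i) (Q c)))) x)"
        unfolding linear_add[OF linear_coproduct] 1 by (simp only: cop_add sum.distrib)
      \<comment> \<open>Terms with a differential on the \<open>flow\<close> factor cancel in pairs:
        \<open>Q'\<close> after \<open>flow\<close> equals \<open>flow\<close> after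
        \<open>Q\<close>, and the oddness of \<open>K\<close> or of \<open>Q\<close> makes the signs
        opposite.\<close>
      also have "\<dots> = (\<Sum>i\<le>m. cop (\<lambda>a c. ?D i a \<otimes> flow (m - i) c + flow i a \<otimes> ?D (m - i) c) x)"
      proof (intro sum.cong refl arg_cong2[where f = cop] ext)
        fix i a c assume i: "i \<in> {..m}"
        then show "Q' (K i a) \<otimes> flow (m - i) c + ?J (K i a) \<otimes> Q' (flow (m - i) c)
          + (Q' (flow i (?J a)) \<otimes> K (m - i) c + ?J (flow i (?J a)) \<otimes> Q' (K (m - i) c))
          + ((K i (Q a) \<otimes> flow (m - i) c + flow i (?J (Q a)) \<otimes> K (m - i) c)
          + (K i (?J a) \<otimes> flow (m - i) (Q c) + flow i (?J (?J a)) \<otimes> K (m - i) (Q c)))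
          = ?D i a \<otimes> flow (m - i) c + flow i a \<otimes> ?D (m - i) c"
          by (simp add: IH K coderivation_grade_involution[OF Q_props(4)]
              coderivation_grade_involution[OF Q'_props(4)] linear_neg[OF linear_grade_involution]
              bilinear_lneg[OF bilinear_tens] bilinear_rneg[OF bilinear_tens]
              tens_add_left tens_add_right add_ac)
      qed
      also have "\<dots> = (\<Sum>i\<le>m. real (Suc i) *\<^sub>R ?G (Suc i)) + (\<Sum>i\<le>m. real (Suc m - i) *\<^sub>R ?G i)"
      proof -
        have D: "?D i a = real (Suc i) *\<^sub>R flow (Suc i) a" for i a
          unfolding flow_Suc by simp
        have "cop (\<lambda>a c. ?D i a \<otimes> flow (m - i) c + flow i a \<otimes> ?D (m - i) c) x
            = real (Suc i) *\<^sub>R ?G (Suc i) + real (Suc m - i) *\<^sub>R ?G i" if "i \<le> m" for i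
          using that unfolding D cop_add tens_scaleR_left tens_scaleR_right cop_scaleR
          by (simp only: Suc Suc_diff_le diff_Suc_Suc)
        then show ?thesis by (simp add: sum.distrib)
      qed
      \<comment> \<open>Leibniz rule in coefficients: the weights i and k - i add up to k, which
        cancels the factor 1/k of the recursion.\<close>
      also have "\<dots> = real k *\<^sub>R (\<Sum>i\<le>k. ?G i)"
      proof -
        have "(\<Sum>i\<le>m. real (Suc i) *\<^sub>R ?G (Suc i)) = (\<Sum>i\<le>k. real i *\<^sub>R ?G i)"
          unfolding Suc sum.atMost_Suc_shift by simp
        moreover have "(\<Sum>i\<le>m. real (Suc m - i) *\<^sub>R ?G i) = (\<Sum>i\<le>k. real (k - i) *\<^sub>R ?G i)"
          by (simp add: Suc)
        moreover have "real i *\<^sub>R g + real (k - i) *\<^sub>R g = real k *\<^sub>R g" if "i \<in> {..k}" for i and g :: "('b bar, 'b bar) tensor"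
          using that by (simp add: of_nat_diff flip: scaleR_add_left)
        ultimately show ?thesis
          by (simp add: scaleR_sum_right flip: sum.distrib)
      qed
      finally show "coproduct (flow k x) = (\<Sum>i\<le>k. tensor_map (flow i) (flow (k - i)) (coproduct x))"
        unfolding fS linear_scale[OF linear_coproduct] by (simp add: cop_tensor_map Suc)
    qed
    ultimately show ?thesis by blast
  qed
qed

lemmas linear_flow = flow_invariants[THEN conjunct1]
lemmas linear_homotopy_flow = linear_K[OF linear_flow]

section \<open>Finiteness of the Taylor sum\<close>

lemma Q_vanish:
  assumes "linear f" "\<And>us. length us \<le> length vs \<Longrightarrow> f (word us) = 0"
  shows "f (Q (word vs)) = 0"
proof -
  note Qc = coderivation_eq_coder[OF Q_props(4)]
  show ?thesis
    by (subst Qc(2), rule vanish_coder_word) (use Qc(1) assms in \<open>simp_all add: odd_map_def\<close>)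
qed

lemma conv_word: "conv h (flow k) (word vs) = unshuffles vs (\<lambda>A B. lmul (h (word A)) (flow k (word B)))"
  unfolding conv_def by (rule cop_word[OF bilinear_conv[OF h(1) linear_flow]])

text \<open>\<open>K\<close> spends at least one letter on \<open>h\<close> and \<open>Q\<close>
  does not lengthen words, so every order costs a letter.\<close>

lemma flow_short: "length vs < k \<Longrightarrow> flow k (word vs) = 0"
proof (induction k arbitrary: vs)
  case (Suc k)
  have K0: "K k (word us) = 0" if us: "length us \<le> k" for us
  proof -
    have "conv h (flow k) (word us) = 0"
      unfolding conv_word
    proof (rule unshuffles_eq_0)
      fix A B :: "'a desusp list" assume "length A + length B = length us"
      then show "lmul (h (word A)) (flow k (word B)) = 0"
        using us Suc.IH[of B]
        by (cases A) (auto simp: linear_0[OF h(1)] linear_0[OF linear_lmul] bilinear_lzero[OF bilinear_letter_mult])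
    qed
    moreover have "k = 0 \<Longrightarrow> us = []" using us by simp
    ultimately show ?thesis by (auto simp: homotopy_def linear_0[OF h(1)] word_zero_Cons)
  qed
  have "K k (Q (word vs)) = 0"
    by (rule Q_vanish[OF linear_homotopy_flow]) (use Suc.prems in \<open>simp add: K0\<close>)
  then show ?case
    using Suc.prems unfolding flow_Suc by (simp add: K0 linear_0[OF Q'_props(1)])
qed simp

text \<open>The value F_1; by \<open>flow_short\<close>, truncation at the word length keeps the
  whole Taylor sum.\<close>

definition flowed :: "'a bar \<Rightarrow> 'b bar" where
  "flowed = sym_lift (\<lambda>vs. \<Sum>k\<le>length vs. flow k (word vs))"

lemma linear_flowed: "linear flowed"
  and flowed_word: "length vs \<le> N \<Longrightarrow> flowed (word vs) = (\<Sum>k\<le>N. flow k (word vs))"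
proof -
  let ?f = "\<lambda>vs. \<Sum>k\<le>length vs. flow k (word vs)"
  note g = gsym_linear_word[OF linear_flow]
  have "gsym ?f"
  proof (rule gsymI)
    fix us vs :: "'a desusp list" and x y and c :: real and k l :: int
    show "?f (us @ (x + y) # vs) = ?f (us @ x # vs) + ?f (us @ y # vs)"
      by (simp add: gsymD(2)[OF g] sum.distrib del: sum.atMost_Suc)
    show "?f (us @ (c *\<^sub>R x) # vs) = c *\<^sub>R ?f (us @ x # vs)"
      by (simp add: gsymD(3)[OF g] scaleR_sum_right del: sum.atMost_Suc)
    show "?f (us @ x # y # vs) = (-1) powi (k * l) *\<^sub>R ?f (us @ y # x # vs)"
      if "x \<in> grade k" "y \<in> grade l"
      by (simp add: gsymD(4)[OF g that, of _ us vs] scaleR_sum_right del: sum.atMost_Suc)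
  qed
  note lift = sym_lift[OF this]
  show "linear flowed"
    using lift(1) linear_0[OF linear_flow[of 0]] by (simp add: flowed_def)
  have w: "flowed (word vs) = ?f vs"
    using lift(2) linear_0[OF linear_flow[of 0]] by (simp add: flowed_def)
  show "flowed (word vs) = (\<Sum>k\<le>N. flow k (word vs))" if "length vs \<le> N"
    unfolding w by (rule sum.mono_neutral_left) (use that flow_short in auto)
qed

lemma L_infty_morphism_flowed: "L_infty_morphism Q Q' flowed"
  unfolding L_infty_morphism_def coalgebra_morphism_def
proof (intro conjI allI)
  show "linear flowed" by (rule linear_flowed)
  show "has_degree 0 flowed"
  proof (rule has_degree_symI[OF linear_flowed])
    fix ks and vs :: "'a desusp list" assume "homogeneous_list ks vs"
    then have "flow k (word vs) \<in> grade (sum_list ks + 0)" for k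
      using flow_invariants[of k] word_in_grade by (auto simp: has_degree_def)
    then show "flowed (word vs) \<in> grade (sum_list ks + 0)"
      unfolding flowed_word[OF order.refl] by (intro subspace_sum[OF subspace_grade])
  qed
  have b: "bilinear (\<lambda>a c. flowed a \<otimes> flowed c)"
    by (intro bilinearI bilinear_comp[OF bilinear_tens] linear_flowed)
  have bk: "bilinear (\<lambda>a c. flow i a \<otimes> flow j c)" for i j
    by (intro bilinearI bilinear_comp[OF bilinear_tens] linear_flow)
  fix x
  show "coproduct (flowed x) = tensor_map flowed flowed (coproduct x)"
    unfolding cop_tensor_map
  proof (rule linear_eq_on_words[where x = x])
    fix vs :: "'a desusp list"
    let ?N = "length vs"
    have "coproduct (flowed (word vs))
        = (\<Sum>k\<le>?N. \<Sum>i\<le>k. cop (\<lambda>a c. flow i a \<otimes> flow (k - i) c) (word vs))"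
      using flow_invariants by (simp add: flowed_word[OF order.refl] linear_sum[OF linear_coproduct]
          comult_at_def cop_tensor_map)
    also have "\<dots> = unshuffles vs (\<lambda>A B. \<Sum>k\<le>?N. \<Sum>i\<le>k. flow i (word A) \<otimes> flow (k - i) (word B))"
    proof -
      have "unshuffles vs (\<lambda>A B. \<Sum>k\<in>I. f k A B) = (\<Sum>k\<in>I. unshuffles vs (f k))"
        for I :: "nat set" and f :: "nat \<Rightarrow> 'a desusp list \<Rightarrow> 'a desusp list \<Rightarrow> ('b bar, 'b bar) tensor"
        by (induction I rule: infinite_finite_induct) (simp_all add: unshuffles_zero unshuffles_add)
      then show ?thesis by (simp add: cop_word[OF bk])
    qed
    also have "\<dots> = unshuffles vs (\<lambda>A B. flowed (word A) \<otimes> flowed (word B))"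
    proof (rule unshuffles_cong)
      fix A B :: "'a desusp list" assume len: "length A + length B = ?N"
      let ?g = "\<lambda>i j. flow i (word A) \<otimes> flow j (word B)"
      have "(\<Sum>k\<le>?N. \<Sum>i\<le>k. ?g i (k - i)) = (\<Sum>(i, j)\<in>{(i, j). i + j \<le> ?N}. ?g i j)"
        by (rule sum.triangle_reindex_eq[symmetric])
      \<comment> \<open>Outside the triangle i + j exceeds the total length, so one index exceeds
        the length of its word and that factor vanishes.\<close>
      also have "\<dots> = (\<Sum>(i, j)\<in>{..?N} \<times> {..?N}. ?g i j)"
      proof (rule sum.mono_neutral_left)
        show "\<forall>p\<in>{..?N} \<times> {..?N} - {(i, j). i + j \<le> ?N}. (case p of (i, j) \<Rightarrow> ?g i j) = 0"
        proof
          fix p assume "p \<in> {..?N} \<times> {..?N} - {(i, j). i + j \<le> ?N}"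
          then obtain i j where p: "p = (i, j)" "\<not> i + j \<le> ?N" by (cases p) auto
          then have "length A < i \<or> length B < j" using len by linarith
          then show "(case p of (i, j) \<Rightarrow> ?g i j) = 0" using flow_short p(1) by auto
        qed
      qed auto
      also have "\<dots> = flowed (word A) \<otimes> flowed (word B)"
        using len by (simp add: flowed_word[of _ ?N] bilinear_sum[OF bilinear_tens] split_def)
      finally show "(\<Sum>k\<le>?N. \<Sum>i\<le>k. ?g i (k - i)) = flowed (word A) \<otimes> flowed (word B)" .
    qed
    also have "\<dots> = cop (\<lambda>a c. flowed a \<otimes> flowed c) (word vs)"
      by (rule cop_word[OF b, symmetric])
    finally show "coproduct (flowed (word vs)) = cop (\<lambda>a c. flowed a \<otimes> flowed c) (word vs)" .
  qed (intro linear_comp[OF linear_coproduct] linear_flowed linear_cop b)+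
  show "Q' (flowed x) = flowed (Q x)"
  proof (rule linear_eq_on_words[where x = x])
    fix vs :: "'a desusp list"
    \<comment> \<open>\<open>Q (word vs)\<close> combines words no longer than \<open>vs\<close>, on
      which the same truncated sum computes \<open>flowed\<close>.\<close>
    let ?f = "\<lambda>x. flowed x - (\<Sum>k\<le>length vs. flow k x)"
    have "?f (Q (word vs)) = 0"
      by (rule Q_vanish) (auto intro!: linear_compose_sub linear_compose_sum linear_flowed linear_flow
          simp: flowed_word)
    then show "Q' (flowed (word vs)) = flowed (Q (word vs))"
      using flow_invariants by (simp add: flowed_word[OF order.refl] linear_sum[OF Q'_props(1)])
  qed (intro linear_comp[OF Q'_props(1)] linear_comp[OF linear_flowed] linear_flowed Q_props)+
qed

text \<open>A nonzero term needs n letters for \<open>h\<close> and at least one more for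
  \<open>flow k\<close>.\<close>

lemma conv_low: "length vs \<le> n \<Longrightarrow> conv h (flow k) (word vs) = 0"
  unfolding conv_word
proof (rule unshuffles_eq_0)
  fix A B :: "'a desusp list" assume "length A + length B = length vs" "length vs \<le> n"
  then show "lmul (h (word A)) (flow k (word B)) = 0"
    using h_word[of A]
    by (cases B) (auto simp: linear_0[OF linear_flow] linear_0[OF linear_lmul]
        bilinear_lzero[OF bilinear_letter_mult])
qed

lemma flowed_low:
  assumes "length vs \<le> n"
  shows "flowed (word vs) = F (word vs) + Q' (word [h (word vs)]) + word [h (Q (word vs))]"
proof -
  have conv: "conv h (flow k) (word vs) = 0" "conv h (flow k) (Q (word vs)) = 0" for k
    using assms conv_low Q_vanish[OF linear_conv[OF h(1) linear_flow], of vs k] by simp_all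
  have "flow (Suc (Suc k)) (word vs) = 0" for k
    unfolding flow_Suc by (simp add: homotopy_def conv linear_0[OF Q'_props(1)])
  then have *: "flow k (word vs) = 0" if "k \<notin> {0, 1}" for k
    using that by (cases k; cases "k - 1") auto
  \<comment> \<open>The bound \<open>Suc (length vs)\<close> includes order 1 even for the empty
    word.\<close>
  have "(\<Sum>k\<le>Suc (length vs). flow k (word vs)) = (\<Sum>k\<in>{0, 1}. flow k (word vs))"
    by (intro sum.mono_neutral_right) (auto intro: *)
  then show ?thesis
    using flowed_word[of vs "Suc (length vs)"] flow_Suc[of 0 "word vs"]
    by (simp add: homotopy_def conv conv[of 0, simplified] add.assoc del: sum.atMost_Suc)
qed

lemma flowed_below:
  assumes "length vs < n"
  shows "flowed (word vs) = F (word vs)"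
proof -
  have "h (word vs) = 0" "h (Q (word vs)) = 0"
    using assms h_word Q_vanish[OF h(1), of vs] by simp_all
  then show ?thesis
    using flowed_low[of vs] assms by (simp add: word_zero_Cons linear_0[OF Q'_props(1)])
qed

end

section \<open>Decalage\<close>

text \<open>The scaling of \<open>structure_map\<close> again, with the number of letters that
  follow as exponent; its signs are their own inverses, so it undoes that scaling.\<close>

primrec decal :: "'v::graded_real_vector desusp list \<Rightarrow> 'v list" where
  "decal [] = []"
| "decal (v # vs) = hscale (\<lambda>k. (-1) powi (int (length vs) * (k - 1))) (susp v) # decal vs"

definition cochain ::
    "nat \<Rightarrow> ('v::graded_real_vector list \<Rightarrow> 'w::graded_real_vector) \<Rightarrow> 'v desusp list \<Rightarrow> 'w desusp" where
  "cochain n H vs = (if length vs = n then desusp (H (decal vs)) else 0)"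

definition decalage_sign :: "int list \<Rightarrow> real" where
  "decalage_sign ks = (-1) powi (\<Sum>i<length ks. int (length ks - Suc i) * (ks ! i - 1))"

lemma length_decal [simp]: "length (decal vs) = length vs"
  by (induction vs) simp_all

text \<open>The sign on a prefix letter depends on the tail only through its length, so one
  \<open>A\<close> serves all tails of length \<open>m\<close>.\<close>

lemma decal_append: "\<exists>A. length A = length us \<and> (\<forall>ws. length ws = m \<longrightarrow> decal (us @ ws) = A @ decal ws)"
proof (induction us)
  case (Cons u us)
  then obtain A where "length A = length us" "\<And>ws. length ws = m \<Longrightarrow> decal (us @ ws) = A @ decal ws"
    by blast
  then show ?case
    by (intro exI[of _ "hscale (\<lambda>k. (-1) powi (int (length us + m) * (k - 1))) (susp u) # A"]) auto
qed simp

lemma graded_alternatingD: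
  assumes "graded_alternating n d H"
  shows "length us + 1 + length vs = n \<Longrightarrow> linear (\<lambda>x. H (us @ x # vs))"
    and "x \<in> grade k \<Longrightarrow> y \<in> grade l \<Longrightarrow> length us + 2 + length vs = n \<Longrightarrow>
      H (us @ x # y # vs) = - ((-1) powi (k * l) *\<^sub>R H (us @ y # x # vs))"
    and "length \<gamma>s = n \<Longrightarrow> homogeneous_list ks \<gamma>s \<Longrightarrow> H \<gamma>s \<in> grade (sum_list ks + d)"
  using assms unfolding graded_alternating_def by blast+

lemma susp_desusp [simp]: "susp (desusp x) = x" "desusp (susp y) = y"
  by (simp_all add: desusp_inverse susp_inverse)

lemma susp_grade: "x \<in> grade k \<Longrightarrow> susp x \<in> grade (k + 1)"
  by (simp add: grade_desusp_def)

text \<open>Exchanging neighbours of desuspended degrees k and l costs -(-1)^((k+1)(l+1)) in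
  \<open>H\<close> and (-1)^(k+l) in the scaling, together (-1)^(kl).\<close>

lemma gsym_cochain:
  assumes H: "graded_alternating n d H"
  shows "gsym (cochain n H)"
proof (rule gsymI)
  fix us vs :: "'a desusp list" and x y :: "'a desusp" and c :: real and k l :: int
  obtain A where A: "length A = length us"
    "\<And>ws. length ws = Suc (length vs) \<Longrightarrow> decal (us @ ws) = A @ decal ws"
    using decal_append[of us "Suc (length vs)"] by blast
  let ?s = "hscale (\<lambda>k. (-1) powi (int (length vs) * (k - 1)))"
  have "linear (\<lambda>z. desusp (H (A @ ?s (susp z) # decal vs)))" if "length us + 1 + length vs = n"
    using that A(1)
    by (intro linear_comp[OF linear_desusp] linear_comp[OF graded_alternatingD(1)[OF H]]
        linear_comp[OF linear_hscale] linear_susp) simp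
  note lin = linear_add[OF this] linear_scale[OF this]
  show "cochain n H (us @ (x + y) # vs) = cochain n H (us @ x # vs) + cochain n H (us @ y # vs)"
    "cochain n H (us @ (c *\<^sub>R x) # vs) = c *\<^sub>R cochain n H (us @ x # vs)"
    using lin by (simp_all add: cochain_def A(2))
  show "cochain n H (us @ x # y # vs) = (-1) powi (k * l) *\<^sub>R cochain n H (us @ y # x # vs)"
    if x: "x \<in> grade k" and y: "y \<in> grade l"
  proof (cases "length us + 2 + length vs = n")
    case True
    obtain A where A: "length A = length us"
      "\<And>ws. length ws = Suc (Suc (length vs)) \<Longrightarrow> decal (us @ ws) = A @ decal ws"
      using decal_append[of us "Suc (Suc (length vs))"] by blast
    note gx = susp_grade[OF x] and gy = susp_grade[OF y]
    have lin: "linear (\<lambda>z. H (A @ z # w # decal vs))" "linear (\<lambda>z. H (A @ w # z # decal vs))" for w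
      using graded_alternatingD(1)[OF H, of A "w # decal vs"]
        graded_alternatingD(1)[OF H, of "A @ [w]" "decal vs"] True A(1) by simp_all
    have "H (A @ susp x # susp y # decal vs)
        = - ((-1) powi ((k + 1) * (l + 1)) *\<^sub>R H (A @ susp y # susp x # decal vs))"
      using True A(1) by (intro graded_alternatingD(2)[OF H] gx gy) simp
    then show ?thesis
      using True
      by (cases "even k"; cases "even l"; cases "even (length vs)")
        (simp_all add: cochain_def A(2) hscale_homogeneous[OF gx] hscale_homogeneous[OF gy]
          linear_scale[OF lin(1)] linear_scale[OF lin(2)] linear_neg[OF lin(1)] linear_neg[OF lin(2)]
          linear_neg[OF linear_desusp] sign_int)
  qed (auto simp: cochain_def)
qed

lemma decal_homogeneous:
  assumes H: "graded_alternating n d H" and hom: "homogeneous_list ks \<gamma>s"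
    and "length us + length \<gamma>s = n"
  shows "H (us @ decal (map desusp \<gamma>s)) = decalage_sign ks *\<^sub>R H (us @ \<gamma>s)"
  using assms(2,3)
proof (induction \<gamma>s arbitrary: us ks)
  case (Cons g gs)
  then obtain k ks' where ks: "ks = k # ks'" "g \<in> grade k" "homogeneous_list ks' gs"
    by (auto simp: homogeneous_list_Cons)
  have len: "length ks' = length gs" using homogeneous_list_length[OF ks(3)] .
  have "H (us @ decal (map desusp (g # gs)))
      = (-1) powi (int (length gs) * (k - 1)) *\<^sub>R H ((us @ [g]) @ decal (map desusp gs))"
    using Cons.prems(2) linear_scale[OF graded_alternatingD(1)[OF H, of us "decal (map desusp gs)"]]
    by (simp add: hscale_homogeneous[OF ks(2)])
  also have "H ((us @ [g]) @ decal (map desusp gs)) = decalage_sign ks' *\<^sub>R H ((us @ [g]) @ gs)"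
    by (rule Cons.IH[OF ks(3)]) (use Cons.prems(2) in simp)
  finally show ?case
    unfolding decalage_sign_def
    by (simp add: ks(1) len sum.lessThan_Suc_shift power_int_add del: sum.lessThan_Suc)
qed (simp add: decalage_sign_def)

lemma decal_homogeneous_list: "homogeneous_list ks vs \<Longrightarrow> homogeneous_list (map (\<lambda>k. k + 1) ks) (decal vs)"
proof (induction vs arbitrary: ks)
  case (Cons v vs)
  then show ?case by (auto simp: homogeneous_list_Cons intro!: hscale_grade susp_grade)
qed simp

text \<open>Suspending n letters adds n, \<open>H\<close> subtracts n, the final
  \<open>desusp\<close> subtracts 1. As n is positive, the cochain vanishes on the empty word, as
  lifting requires.\<close>

lemma has_degree_cochain:
  assumes H: "graded_alternating n (- int n) H" and "n \<ge> 1"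
  shows "has_degree (-1) (sym_lift (cochain n H))"
proof (rule has_degree_symI)
  have *: "gsym (cochain n H)" "cochain n H [] = 0"
    using assms gsym_cochain by (auto simp: cochain_def)
  from sym_lift(1)[OF this] show "linear (sym_lift (cochain n H))" .
  fix ks and vs :: "'a desusp list" assume hom: "homogeneous_list ks vs"
  have "H (decal vs) \<in> grade (sum_list ks)" if "length vs = n"
  proof -
    have "sum_list (map (\<lambda>k. k + 1) ks) = sum_list ks + int n"
      using homogeneous_list_length[OF hom] that by (simp add: sum_list_addf sum_list_triv)
    then show ?thesis
      using graded_alternatingD(3)[OF H _ decal_homogeneous_list[OF hom]] that by simp
  qed
  then show "sym_lift (cochain n H) (word vs) \<in> grade (sum_list ks + - 1)"
    by (simp add: sym_lift(2)[OF *] cochain_def desusp_grade)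
qed

section \<open>Homotopic maps on cohomology\<close>

text \<open>The images of a cocycle differ by a coboundary, so both maps induce the same map on
  classes; on cocycles the other term of a chain homotopy is absent.\<close>

lemma quasi_isomorphism_homotopic:
  assumes f: "quasi_isomorphism d d' f"
    and d': "linear d'" "has_degree 1 d'" "\<And>x. d' (d' x) = 0"
    and g: "\<And>k x. x \<in> grade k \<Longrightarrow> d x = 0 \<Longrightarrow> \<exists>z\<in>grade (k - 1). g x = f x + d' z"
  shows "quasi_isomorphism d d' g"
  unfolding quasi_isomorphism_def
proof
  fix k
  have eq: "(g x, y) \<in> cohomologous d' k \<longleftrightarrow> (f x, y) \<in> cohomologous d' k" if "x \<in> cocycles d k" for x y
  proof -
    obtain z where z: "z \<in> grade (k - 1)" "g x = f x + d' z"
      using g[of x k] \<open>x \<in> cocycles d k\<close> by (auto simp: cocycles_def)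
    have dz: "d' z \<in> grade k" using z(1) d'(2) by (force simp: has_degree_def)
    have sub: "subspace (d' ` grade (k - 1))"
      by (rule linear_subspace_image[OF d'(1) subspace_grade])
    have "f x + d' z \<in> grade k \<longleftrightarrow> f x \<in> grade k"
      using subspace_add[OF subspace_grade _ dz] subspace_diff[OF subspace_grade _ dz, of "f x + d' z"] by auto
    moreover have "f x + d' z - y \<in> d' ` grade (k - 1) \<longleftrightarrow> f x - y \<in> d' ` grade (k - 1)"
    proof -
      have "d' z \<in> d' ` grade (k - 1)" using z(1) by blast
      then show ?thesis
        using subspace_add[OF sub, of "f x - y" "d' z"] subspace_diff[OF sub, of "f x + d' z - y" "d' z"]
        by (auto simp: algebra_simps)
    qed
    ultimately show ?thesis
      by (simp add: cohomologous_def cocycles_def z(2) linear_add[OF d'(1)] d'(3))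
  qed
  have "cohomologous d' k `` (g ` C) = cohomologous d' k `` (f ` C)" if "C \<in> cohomology d k" for C
  proof -
    have "C \<subseteq> cocycles d k"
      using that by (auto simp: cohomology_def quotient_def cohomologous_def)
    then show ?thesis using eq by (auto simp: Image_iff subset_iff)
  qed
  then show "bij_betw (\<lambda>C. cohomologous d' k `` (g ` C)) (cohomology d k) (cohomology d' k)"
    using f by (simp add: quasi_isomorphism_def cong: bij_betw_cong)
qed

section \<open>The linear structure map\<close>

lemma structure_map_singleton: "structure_map Q [x] = susp (pr (Q (word [desusp x])))"
proof -
  have "hscale (\<lambda>k. 1) x = x"
    by (rule linear_eq_on_homogeneous[where x = x]) (auto simp: linear_hscale linear_ident hscale_homogeneous)
  then show ?thesis by (simp add: structure_map_def)
qed

text \<open>One letter has no proper unshuffle. This is how the vanishing of the square passes from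
  \<open>Q\<close> to Q_1.\<close>

lemma coderivation_letter:
  assumes "degree_one_coderivation Q"
  shows "Q (word [v]) = word [pr (Q (word [v]))]"
proof -
  note Q = coderivation_eq_coder[OF assms]
  have "Q (word [v]) = coder (\<lambda>x. pr (Q x)) (word [v])" using Q(2) by (rule fun_cong)
  also have "\<dots> = word [pr (Q (word [v]))]"
    using Q(1) linear_0[of "\<lambda>x. pr (Q x)"]
    by (simp add: odd_map_def coder_word put_left_def put_right_def word_zero_Cons)
  finally show ?thesis .
qed

lemma structure_map_differential:
  assumes "L_infty_algebra Q"
  shows "linear (\<lambda>x. structure_map Q [x])" "has_degree 1 (\<lambda>x. structure_map Q [x])"
    "structure_map Q [structure_map Q [x]] = 0"
proof -
  have Q: "linear Q" "has_degree 1 Q" "\<And>x. Q (Q x) = 0" "degree_one_coderivation Q"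
    using assms by (auto simp: L_infty_algebra_def degree_one_coderivation_def)
  show "linear (\<lambda>x. structure_map Q [x])"
    unfolding structure_map_singleton
    by (intro linear_comp[OF linear_susp] linear_comp[OF linear_pr] linear_comp[OF Q(1)]
        linear_comp[OF linear_letter] linear_desusp)
  show "has_degree 1 (\<lambda>x. structure_map Q [x])"
    unfolding has_degree_def structure_map_singleton
  proof (intro allI ballI)
    fix k and x :: 'a assume "x \<in> grade k"
    then have "word [desusp x] \<in> grade (k - 1)"
      using word_in_grade[of "[k - 1]" "[desusp x]"] by (simp add: homogeneous_list_Cons desusp_grade)
    then have "Q (word [desusp x]) \<in> grade k" using Q(2) by (force simp: has_degree_def)
    then have "pr (Q (word [desusp x])) \<in> grade k"
      using has_degree_pr by (force simp: has_degree_def)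
    then show "susp (pr (Q (word [desusp x]))) \<in> grade (k + 1)" by (rule susp_grade)
  qed
  have "Q (word [pr (Q (word [desusp x]))]) = 0"
    using Q(3) coderivation_letter[OF Q(4), of "desusp x"] by metis
  then show "structure_map Q [structure_map Q [x]] = 0"
    by (simp add: structure_map_singleton linear_0[OF linear_pr] linear_0[OF linear_susp])
qed

theorem lemma1:
  fixes Q :: "'a::graded_real_vector bar \<Rightarrow> 'a bar"
    and Q' :: "'b::graded_real_vector bar \<Rightarrow> 'b bar"
    and F :: "'a bar \<Rightarrow> 'b bar"
    and H :: "'a list \<Rightarrow> 'b"
    and n :: nat
  assumes "L_infty_algebra Q"
    and "L_infty_algebra Q'"
    and "L_infty_quasi_isomorphism Q Q' F"
    and "n \<ge> 1"
    and "graded_alternating n (- int n) H"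
  shows "\<exists>F' :: 'a bar \<Rightarrow> 'b bar.
    L_infty_quasi_isomorphism Q Q' F' \<and>
    (\<forall>m \<gamma>s. 1 \<le> m \<and> m < n \<and> length \<gamma>s = m \<longrightarrow> structure_map F' \<gamma>s = structure_map F \<gamma>s) \<and>
    (\<forall>ks \<gamma>s. length \<gamma>s = n \<and> homogeneous_list ks \<gamma>s \<longrightarrow>
      structure_map F' \<gamma>s = structure_map F \<gamma>s + structure_map Q' [H \<gamma>s]
        - (\<Sum>i<n. (-1) powi (int n + (\<Sum>j<i. ks ! j)) *\<^sub>R
            H (\<gamma>s[i := structure_map Q [\<gamma>s ! i]])))"
proof -
  note H = assms(5)
  define h where "h = sym_lift (cochain n H)"
  have lin_h: "linear h" and h_cochain: "h (word vs) = cochain n H vs" for vs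
    using sym_lift[OF gsym_cochain[OF H]] assms(4) by (simp_all add: h_def cochain_def)
  have mor_F: "L_infty_morphism Q Q' F" and lin_F: "linear F"
    and qF: "quasi_isomorphism (\<lambda>x. structure_map Q [x]) (\<lambda>x. structure_map Q' [x]) (\<lambda>x. structure_map F [x])"
    using assms(3)
    by (auto simp: L_infty_quasi_isomorphism_def L_infty_morphism_def coalgebra_morphism_def)
  interpret homotopy_flow Q Q' F h n
    by (rule homotopy_flow.intro)
      (use assms(1,2) mor_F lin_h h_cochain has_degree_cochain[OF H assms(4)] in \<open>simp_all add: h_def[symmetric] cochain_def\<close>)
  have low: "structure_map flowed \<gamma>s = structure_map F \<gamma>s" if "length \<gamma>s < n" for \<gamma>s
    using that by (simp add: structure_map_def flowed_below)
  have top: "structure_map flowed \<gamma>s = structure_map F \<gamma>s + structure_map Q' [H \<gamma>s]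
        - (\<Sum>i<n. (-1) powi (int n + (\<Sum>j<i. ks ! j)) *\<^sub>R
            H (\<gamma>s[i := structure_map Q [\<gamma>s ! i]]))"
    if len: "length \<gamma>s = n" and hom: "homogeneous_list ks \<gamma>s" for ks \<gamma>s
  proof -
    let ?w = "map desusp \<gamma>s" and ?q = "\<lambda>x. pr (Q x)" and ?s = "decalage_sign ks"
    have lks: "length ks = n" using homogeneous_list_length[OF hom] len by simp
    \<comment> \<open>The decalage sign enters \<open>h\<close> through \<open>cochain\<close> and
      must cancel against that of \<open>structure_map\<close>.\<close>
    have s2: "?s * ?s = 1" by (simp add: decalage_sign_def sign_int)
    have h_word': "h (word (map desusp gs)) = decalage_sign ls *\<^sub>R desusp (H gs)"
      if "length gs = n" "homogeneous_list ls gs" for ls gs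
      using decal_homogeneous[OF H that(2), of "[]"] that(1)
      by (simp add: h_cochain cochain_def linear_scale[OF linear_desusp])
    have sm: "structure_map G \<gamma>s = ?s *\<^sub>R susp (pr (G (word ?w)))" if "linear G" for G :: "'a bar \<Rightarrow> 'b bar"
      using structure_map_homogeneous[OF that hom] by (simp add: decalage_sign_def len lks)
    have homw: "homogeneous_list (map (\<lambda>k. k - 1) ks) ?w"
      using hom by (simp add: homogeneous_list_def list_all2_conv_all_nth desusp_grade)
    note Qc = coderivation_eq_coder[OF Q_props(4)]
    have "h (Q (word ?w)) = h (coder ?q (word ?w))" using Qc(2) by simp
    \<comment> \<open>\<open>h\<close> kills words shorter than n, so only Q_1 applied to one letter
      remains.\<close>
    also have "\<dots> = (\<Sum>i<n. (-1) powi (\<Sum>j<i. map (\<lambda>k. k - 1) ks ! j) *\<^sub>R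
        h (word (?w[i := ?q (word [?w ! i])])))"
      using leading_term_coder[OF Qc(1) lin_h homw] len by (simp add: h_cochain cochain_def)
    also have "\<dots> = (\<Sum>i<n. - (?s * (-1) powi (int n + (\<Sum>j<i. ks ! j))) *\<^sub>R
        desusp (H (\<gamma>s[i := structure_map Q [\<gamma>s ! i]])))"
    proof (rule sum.cong[OF refl])
      fix i assume "i \<in> {..<n}"
      then have i: "i < n" by simp
      let ?g = "\<gamma>s[i := structure_map Q [\<gamma>s ! i]]" and ?l = "ks[i := ks ! i + 1]"
      have w: "?w[i := ?q (word [?w ! i])] = map desusp ?g"
        using i len by (simp add: structure_map_singleton map_update)
      have "structure_map Q [\<gamma>s ! i] \<in> grade (ks ! i + 1)"
        using structure_map_differential(2)[OF assms(1)] hom i len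
        by (auto simp: has_degree_def homogeneous_list_def list_all2_conv_all_nth)
      then have homl: "homogeneous_list ?l ?g"
        using hom by (auto simp: homogeneous_list_def intro: list_all2_update_cong)
      \<comment> \<open>Raising the i-th degree by 1 adds n - 1 - i to the decalage
        exponent.\<close>
      have sgn: "decalage_sign ?l = ?s * (-1) powi int (n - Suc i)"
      proof -
        have "(\<Sum>j<n. int (n - Suc j) * (?l ! j - 1))
            = (\<Sum>j<n. int (n - Suc j) * (ks ! j - 1) + (if j = i then int (n - Suc i) else 0))"
          by (rule sum.cong[OF refl]) (use lks in \<open>auto simp: nth_list_update algebra_simps\<close>)
        also have "\<dots> = (\<Sum>j<n. int (n - Suc j) * (ks ! j - 1)) + int (n - Suc i)"
          using i by (simp add: sum.distrib sum.delta)
        finally show ?thesis by (simp add: decalage_sign_def lks power_int_add)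
      qed
      have pre: "(\<Sum>j<i. map (\<lambda>k. k - 1) ks ! j) = (\<Sum>j<i. ks ! j) - int i"
        using i lks by (simp add: sum_subtractf)
      \<comment> \<open>The exponents -i, from the desuspended degrees, and n - 1 - i, from
        decalage, add up to n - 1 modulo 2: the source of (-1)^n and of the minus sign before the
        sum.\<close>
      have "(-1) powi ((\<Sum>j<i. ks ! j) - int i) * (-1) powi int (n - Suc i)
          = - ((-1) powi (int n + (\<Sum>j<i. ks ! j)) :: real)"
        using i by (simp add: of_nat_diff sign_int)
      then have "(-1) powi ((\<Sum>j<i. ks ! j) - int i) * (?s * (-1) powi int (n - Suc i))
          = - (?s * (-1) powi (int n + (\<Sum>j<i. ks ! j)))"
        by (simp add: mult.left_commute)
      then show "(-1) powi (\<Sum>j<i. map (\<lambda>k. k - 1) ks ! j) *\<^sub>R h (word (?w[i := ?q (word [?w ! i])]))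
          = - (?s * (-1) powi (int n + (\<Sum>j<i. ks ! j))) *\<^sub>R desusp (H ?g)"
        unfolding w pre by (simp add: h_word'[OF _ homl] len sgn)
    qed
    finally have hQ: "?s *\<^sub>R susp (h (Q (word ?w)))
        = - (\<Sum>i<n. (-1) powi (int n + (\<Sum>j<i. ks ! j)) *\<^sub>R H (\<gamma>s[i := structure_map Q [\<gamma>s ! i]]))"
      by (simp add: linear_sum[OF linear_susp] linear_neg[OF linear_susp] linear_scale[OF linear_susp]
          scaleR_sum_right sum_negf mult.assoc[symmetric] s2)
    have lin: "linear (\<lambda>v. susp (pr (Q' (word [v]))))"
      by (intro linear_comp[OF linear_susp] linear_comp[OF linear_pr] linear_comp[OF Q'_props(1)] linear_letter)
    have hH: "?s *\<^sub>R susp (pr (Q' (word [h (word ?w)]))) = structure_map Q' [H \<gamma>s]"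
      using linear_scale[OF lin, of ?s "desusp (H \<gamma>s)"]
      by (simp add: h_word'[OF len hom] structure_map_singleton s2)
    have "structure_map flowed \<gamma>s = ?s *\<^sub>R susp (pr (F (word ?w)))
        + ?s *\<^sub>R susp (pr (Q' (word [h (word ?w)]))) + ?s *\<^sub>R susp (h (Q (word ?w)))"
      using flowed_low[of ?w] len
      by (simp add: sm[OF linear_flowed] linear_add[OF linear_pr] linear_add[OF linear_susp]
          pr_word scaleR_add_right)
    then show ?thesis unfolding hQ hH sm[OF lin_F] by simp
  qed
  have "quasi_isomorphism (\<lambda>x. structure_map Q [x]) (\<lambda>x. structure_map Q' [x]) (\<lambda>x. structure_map flowed [x])"
  proof (rule quasi_isomorphism_homotopic[OF qF structure_map_differential[OF assms(2)]])
    fix k and x :: 'a assume x: "x \<in> grade k" "structure_map Q [x] = 0"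
    show "\<exists>z\<in>grade (k - 1). structure_map flowed [x] = structure_map F [x] + structure_map Q' [z]"
    proof (cases "n = 1")
      case True
      \<comment> \<open>For a cocycle the only summand of the formula is \<open>H [0]\<close> up to
        sign, so \<open>z = H [x]\<close> serves.\<close>
      have "H [0] = 0" using linear_0[OF graded_alternatingD(1)[OF H, of "[]" "[]"]] True by simp
      moreover have "H [x] \<in> grade (k - 1)"
        using graded_alternatingD(3)[OF H, of "[x]" "[k]"] True x(1) by (simp add: homogeneous_list_Cons)
      ultimately show ?thesis
        using top[of "[x]" "[k]"] True x by (auto simp: homogeneous_list_Cons)
    next
      case False
      then have "structure_map flowed [x] = structure_map F [x]"
        using assms(4) by (intro low) simp
      then show ?thesis
        using linear_0[OF structure_map_differential(1)[OF assms(2)]] by (intro bexI[of _ 0]) simp_all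
    qed
  qed
  then have "L_infty_quasi_isomorphism Q Q' flowed"
    using L_infty_morphism_flowed by (simp add: L_infty_quasi_isomorphism_def)
  then show ?thesis using low top by (intro exI[of _ flowed]) blast
qed

end
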